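(* Let $n \ge 2$, let $\Omega \subset \mathbb{R}^n$ be a bounded convex domain, and let $G:[0,\infty)\to\mathbb{R}$ be a strictly positive locally integrable function. Suppose there exists an integrable function $f:\Omega\to\mathbb{R}$ such that $$\int_{\Omega\cap\Sigma} f(x)\,d\mathcal{H}^{n-1}(x) = G\left(\min_{j=1,2}\operatorname{dist}(\Sigma,\Pi_j)\right)$$ for all $(n-1)$-dimensional hyperplanes $\Sigma\subset\mathbb{R}^n$ satisfying $\mathcal{H}^{n-1}(\Omega\cap\Sigma)>0$, where $\Pi_1,\Pi_2$ are the two supporting $(n-1)$-dimensional hyperplanes to $\Omega$ that are parallel to $\Sigma$. Then $\Omega$ is a ball, and $f$ is radial about the center of $\Omega$ and is the unique integrable function on $\Omega$ satisfying $\int_{\Omega\cap\Sigma} f(x)\,d\mathcal{H}^{n-1}(x) = G\left(\min_{j=1,2}\operatorname{dist}(\Sigma,\Pi_j)\right)$ for all $(n-1)$-dimensional hyperplanes $\Sigma\subset\mathbb{R}^n$ with $\mathcal{H}^{n-1}(\Omega\cap\Sigma)>0$, where $\Pi_1,\Pi_2$ are the two supporting hyperplanes to $\Omega$ parallel to $\Sigma$.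
   Context: A domain is a nonempty connected open set. $\mathcal{H}^{k}$ denotes $k$-dimensional Hausdorff measure. "Hyperplane" means affine hyperplane. A function is radial about a point $p_c$ if its value at $x$ depends only on $|x-p_c|$. Integrable functions are identified when they agree almost everywhere, so "radial" and "unique" are understood up to almost-everywhere equality. *)

theory Defs
  imports "HOL-Analysis.Analysis"
begin

text \<open>
  Hausdorff measure on a metric space, normalised so that it agrees with Lebesgue measure on
  \<open>k\<close>-dimensional subspaces. Since \<^const>\<open>diameter\<close> is only meaningful for bounded sets,
  boundedness of the covering sets is required separately; the empty set has weight \<open>0\<close>
  also for \<open>k = 0\<close>.
\<close>

definition hausdorff_weight :: "nat \<Rightarrow> 'a::metric_space set \<Rightarrow> ennreal" where
  "hausdorff_weight k U =
     (if U = {} then 0 else ennreal (unit_ball_vol (real k) * (diameter U / 2) ^ k))"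

definition hausdorff_covers :: "real \<Rightarrow> 'a::metric_space set \<Rightarrow> (nat \<Rightarrow> 'a set) set" where
  "hausdorff_covers \<delta> A = {U. A \<subseteq> (\<Union>i. U i) \<and> (\<forall>i. bounded (U i) \<and> diameter (U i) \<le> \<delta>)}"

definition hausdorff_content :: "nat \<Rightarrow> real \<Rightarrow> 'a::metric_space set \<Rightarrow> ennreal" where
  "hausdorff_content k \<delta> A = (INF U\<in>hausdorff_covers \<delta> A. \<Sum>i. hausdorff_weight k (U i))"

definition hausdorff_outer :: "nat \<Rightarrow> 'a::metric_space set \<Rightarrow> ennreal" where
  "hausdorff_outer k A = (SUP \<delta>\<in>{0<..}. hausdorff_content k \<delta> A)"

text \<open>The measure lives on the Caratheodory-measurable sets of the outer measure.\<close>

definition hausdorff_measure :: "nat \<Rightarrow> 'a::metric_space measure" where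
  "hausdorff_measure k =
     measure_of UNIV (lambda_system UNIV (Pow UNIV) (hausdorff_outer k)) (hausdorff_outer k)"

lemma hausdorff_content_empty:
  assumes "\<delta> > 0"
  shows "hausdorff_content k \<delta> ({} :: 'a::metric_space set) = 0"
proof -
  have "(\<lambda>i. {} :: 'a set) \<in> hausdorff_covers \<delta> {}"
    using assms by (simp add: hausdorff_covers_def)
  then have "hausdorff_content k \<delta> ({} :: 'a set) \<le> (\<Sum>i::nat. hausdorff_weight k ({} :: 'a set))"
    unfolding hausdorff_content_def by (rule INF_lower)
  then show ?thesis by (simp add: hausdorff_weight_def)
qed

lemma hausdorff_content_mono: "A \<subseteq> B \<Longrightarrow> hausdorff_content k \<delta> A \<le> hausdorff_content k \<delta> B"
  unfolding hausdorff_content_def hausdorff_covers_def by (rule INF_superset_mono) auto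

lemma hausdorff_content_countably_subadditive:
  "hausdorff_content k \<delta> (\<Union>i. A i) \<le> (\<Sum>i. hausdorff_content k \<delta> (A i))"
proof (rule ennreal_le_epsilon)
  fix e :: real
  assume fin: "(\<Sum>i. hausdorff_content k \<delta> (A i)) < top" and e: "0 < e"
  have "\<exists>U\<in>hausdorff_covers \<delta> (A n).
      (\<Sum>i. hausdorff_weight k (U i)) < hausdorff_content k \<delta> (A n) + ennreal (e * (1/2) ^ Suc n)" for n
  proof -
    have "hausdorff_content k \<delta> (A n) < hausdorff_content k \<delta> (A n) + ennreal (e * (1/2) ^ Suc n)"
      using e fin by (auto simp: less_top dest!: ennreal_suminf_lessD)
    then show ?thesis
      unfolding hausdorff_content_def[of k \<delta> "A n"] INF_less_iff .
  qed
  then obtain U where U: "\<And>n. U n \<in> hausdorff_covers \<delta> (A n)"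
    and less: "\<And>n. (\<Sum>i. hausdorff_weight k (U n i))
      < hausdorff_content k \<delta> (A n) + ennreal (e * (1/2) ^ Suc n)"
    by metis
  define V where "V = case_prod U \<circ> prod_decode"
  have V: "V \<in> hausdorff_covers \<delta> (\<Union>i. A i)"
  proof -
    have "(\<Union>i. A i) \<subseteq> (\<Union>i. V i)"
    proof
      fix x assume "x \<in> (\<Union>i. A i)"
      then obtain n i where "x \<in> U n i"
        using U by (fastforce simp: hausdorff_covers_def)
      then have "x \<in> V (prod_encode (n, i))"
        by (simp add: V_def)
      then show "x \<in> (\<Union>i. V i)" by blast
    qed
    then show ?thesis
      using U by (auto simp: hausdorff_covers_def V_def split: prod.split)
  qed
  have "hausdorff_content k \<delta> (\<Union>i. A i) \<le> (\<Sum>i. hausdorff_weight k (V i))"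
    unfolding hausdorff_content_def by (rule INF_lower[OF V])
  also have "\<dots> = (\<Sum>i. (\<lambda>p. hausdorff_weight k (case_prod U p)) (prod_decode i))"
    by (simp add: V_def)
  also have "\<dots> = (\<Sum>n. \<Sum>i. hausdorff_weight k (U n i))"
    by (subst suminf_ennreal_2dimen) (auto simp: o_def)
  also have "\<dots> \<le> (\<Sum>n. hausdorff_content k \<delta> (A n) + ennreal (e * (1/2) ^ Suc n))"
    by (intro suminf_le less_imp_le less) auto
  also have "\<dots> = (\<Sum>n. hausdorff_content k \<delta> (A n)) + (\<Sum>n. ennreal (e * (1/2) ^ Suc n))"
    by (rule suminf_add[symmetric]) auto
  also have "(\<Sum>n. ennreal (e * (1/2) ^ Suc n)) = ennreal e"
    using e sums_mult[OF power_half_series, of e] by (intro suminf_ennreal_eq) auto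
  finally show "hausdorff_content k \<delta> (\<Union>i. A i)
      \<le> (\<Sum>n. hausdorff_content k \<delta> (A n)) + ennreal e" .
qed

lemma outer_measure_space_hausdorff_outer:
  "outer_measure_space (Pow UNIV) (hausdorff_outer k :: 'a::metric_space set \<Rightarrow> ennreal)"
  unfolding outer_measure_space_def
proof (intro conjI)
  show "positive (Pow UNIV) (hausdorff_outer k :: 'a set \<Rightarrow> ennreal)"
    by (simp add: positive_def hausdorff_outer_def hausdorff_content_empty)
  show "increasing (Pow UNIV) (hausdorff_outer k :: 'a set \<Rightarrow> ennreal)"
    unfolding increasing_def hausdorff_outer_def
    by (auto intro!: SUP_mono hausdorff_content_mono)
  show "countably_subadditive (Pow UNIV) (hausdorff_outer k :: 'a set \<Rightarrow> ennreal)"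
    unfolding countably_subadditive_def
  proof (intro allI impI)
    fix A :: "nat \<Rightarrow> 'a set"
    show "hausdorff_outer k (\<Union>i. A i) \<le> (\<Sum>i. hausdorff_outer k (A i))"
      unfolding hausdorff_outer_def[of k "\<Union>i. A i"]
    proof (rule SUP_least)
      fix \<delta> :: real assume d: "\<delta> \<in> {0<..}"
      have "hausdorff_content k \<delta> (\<Union>i. A i) \<le> (\<Sum>i. hausdorff_content k \<delta> (A i))"
        by (rule hausdorff_content_countably_subadditive)
      also have "\<dots> \<le> (\<Sum>i. hausdorff_outer k (A i))"
        unfolding hausdorff_outer_def by (intro suminf_le SUP_upper d) auto
      finally show "hausdorff_content k \<delta> (\<Union>i. A i) \<le> (\<Sum>i. hausdorff_outer k (A i))" .
    qed
  qed
qed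

lemma measure_space_hausdorff_outer:
  "measure_space UNIV (lambda_system UNIV (Pow UNIV) (hausdorff_outer k)) (hausdorff_outer k)"
  using sigma_algebra.caratheodory_lemma[OF sigma_algebra_Pow outer_measure_space_hausdorff_outer] .

lemma space_hausdorff_measure [simp]: "space (hausdorff_measure k) = UNIV"
  by (simp add: hausdorff_measure_def space_measure_of_conv)

lemma sets_hausdorff_measure:
  "sets (hausdorff_measure k) = lambda_system UNIV (Pow UNIV) (hausdorff_outer k)"
  unfolding hausdorff_measure_def
  by (rule sigma_algebra.sets_measure_of_eq[OF conjunct1])
    (rule measure_space_hausdorff_outer[unfolded measure_space_def])

lemma emeasure_hausdorff_measure:
  "A \<in> sets (hausdorff_measure k) \<Longrightarrow> emeasure (hausdorff_measure k) A = hausdorff_outer k A"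
  unfolding sets_hausdorff_measure unfolding hausdorff_measure_def
  by (rule emeasure_measure_of_sigma)
    (use measure_space_hausdorff_outer in \<open>auto simp: measure_space_def\<close>)

definition hyperplane :: "(real ^ 'n) set \<Rightarrow> bool" where
  "hyperplane \<Sigma> \<longleftrightarrow> (\<exists>a b. a \<noteq> 0 \<and> \<Sigma> = {x. a \<bullet> x = b})"

definition supporting_hyperplane :: "(real ^ 'n) set \<Rightarrow> (real ^ 'n) set \<Rightarrow> bool" where
  "supporting_hyperplane \<Omega> P \<longleftrightarrow>
     (\<exists>a b. a \<noteq> 0 \<and> P = {x. a \<bullet> x = b} \<and> \<Omega> \<subseteq> {x. a \<bullet> x \<le> b} \<and> closure \<Omega> \<inter> P \<noteq> {})"

text \<open>
  A bounded nonempty open \<open>\<Omega>\<close> has exactly two supporting hyperplanes parallel to a given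
  hyperplane, so \<open>P\<^sub>1\<close> and \<open>P\<^sub>2\<close> below are determined by \<open>\<Sigma>\<close> up to order.
  Integrability over each section is stated explicitly because the Bochner integral of a
  nonintegrable function is \<open>0\<close> by convention.
\<close>

definition hyperplane_integrals ::
    "(real ^ 'n) set \<Rightarrow> (real \<Rightarrow> real) \<Rightarrow> (real ^ 'n \<Rightarrow> real) \<Rightarrow> bool" where
  "hyperplane_integrals \<Omega> G f \<longleftrightarrow>
     (\<forall>\<Sigma> P\<^sub>1 P\<^sub>2.
        hyperplane \<Sigma> \<and> emeasure (hausdorff_measure (CARD('n) - 1)) (\<Omega> \<inter> \<Sigma>) > 0 \<and>
        supporting_hyperplane \<Omega> P\<^sub>1 \<and> affine_parallel \<Sigma> P\<^sub>1 \<and>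
        supporting_hyperplane \<Omega> P\<^sub>2 \<and> affine_parallel \<Sigma> P\<^sub>2 \<and> P\<^sub>1 \<noteq> P\<^sub>2 \<longrightarrow>
        set_integrable (hausdorff_measure (CARD('n) - 1)) (\<Omega> \<inter> \<Sigma>) f \<and>
        (LINT x:\<Omega> \<inter> \<Sigma>|hausdorff_measure (CARD('n) - 1). f x)
          = G (min (setdist \<Sigma> P\<^sub>1) (setdist \<Sigma> P\<^sub>2)))"

definition ae_radial_on :: "(real ^ 'n) set \<Rightarrow> real ^ 'n \<Rightarrow> (real ^ 'n \<Rightarrow> real) \<Rightarrow> bool" where
  "ae_radial_on \<Omega> c f \<longleftrightarrow>
     (\<exists>g. (\<forall>x\<in>\<Omega>. \<forall>y\<in>\<Omega>. dist x c = dist y c \<longrightarrow> g x = g y) \<and>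
          (AE x in lebesgue. x \<in> \<Omega> \<longrightarrow> f x = g x))"

end

theory Submission
  imports Defs "HOL-Probability.Conditional_Expectation"
begin

text \<open>
  For a unit vector \<open>e\<close> let \<open>m(e)\<close> and \<open>r(e)\<close> be the midpoint and half the length of the shadow
  \<open>{e \<bullet> x | x \<in> \<Omega>}\<close>. The hyperplane \<open>e \<bullet> x = m(e) + \<tau>\<close> has distances \<open>r(e) - \<tau>\<close> and
  \<open>r(e) + \<tau>\<close> to the two parallel supporting hyperplanes, so the hypothesis prescribes the section
  integral \<open>G (r(e) - \<bar>\<tau>\<bar>)\<close>. Multiplying by \<open>\<phi> \<tau>\<close> and integrating over all hyperplanes
  orthogonal to \<open>e\<close>, Fubini's theorem turns this into an identity for plane waves
  (\<open>plane_wave_integral\<close>):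
  \<open>\<integral> \<phi>(\<tau>) G (r(e) - \<bar>\<tau>\<bar>) d\<tau> = \<kappa> \<integral>\<^sub>\<Omega> \<phi> (e \<bullet> x - m(e)) f(x) dx\<close>,
  where \<open>\<tau>\<close> runs through \<open>(- r(e), r(e))\<close>. Three choices of \<open>\<phi>\<close> prove the theorem.

  \<^item> \<open>\<phi> = 1\<close>: the right-hand side is the same for all \<open>e\<close>, and the left-hand side is strictly
    increasing in \<open>r(e)\<close> because \<open>G > 0\<close>. Hence \<open>r(e) = r\<close> is constant.
  \<^item> \<open>\<phi> \<tau> = \<tau>\<close>: the left-hand side vanishes, being the integral of an odd function. Hence
    \<open>m(e) = e \<bullet> c\<close>, where \<open>c\<close> is the centre of mass of the density \<open>f\<close>; its total mass is nonzero
    by the first choice. The support function \<open>m(e) + r(e) = e \<bullet> c + r\<close> is that of a ball,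
    and a convex open set is determined by its support function (\<open>domain_is_ball\<close>).
  \<^item> \<open>\<phi> \<tau> = exp (s * \<tau>)\<close>: the exponential moments \<open>\<integral>\<^sub>\<Omega> exp (a \<bullet> (x - c)) f(x) dx\<close> are determined by
    \<open>G\<close>, \<open>r\<close> and \<open>norm a\<close>. Exponentials span an algebra that separates points, so by the theorem of
    Stone and Weierstrass the exponential moments determine \<open>f\<close> almost everywhere. This is uniqueness.
    Since the moments depend on \<open>norm a\<close> only, \<open>f\<close> is radial: it agrees with its conditional
    expectation given the distance from \<open>c\<close> (\<open>ae_radial_if_exponential_moments_radial\<close>).

  Fubini's theorem needs a link between Hausdorff measure on hyperplanes and Lebesgue measure. Hausdorff
  measure of dimension \<open>n - 1\<close> is defined on Borel sets, is invariant under isometries, and is finite and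
  positive on discs in hyperplanes. Integrating it along the hyperplanes orthogonal to \<open>e\<close> therefore gives a
  translation invariant, locally finite, nonzero Borel measure, that is, \<open>\<kappa>\<close> times Lebesgue measure with
  \<open>0 < \<kappa> < \<infinity>\<close>, and rotations show that \<open>\<kappa>\<close> is the same for all \<open>e\<close> (\<open>slice_measure_eq_lborel\<close>).
  These two properties of \<open>\<kappa>\<close> are all that the three choices above use.
\<close>

section \<open>Borel sets are Hausdorff measurable\<close>

lemma hausdorff_outer_mono: "A \<subseteq> B \<Longrightarrow> hausdorff_outer k A \<le> hausdorff_outer k B"
  unfolding hausdorff_outer_def by (intro SUP_mono) (use hausdorff_content_mono in blast)

lemma hausdorff_outer_empty: "hausdorff_outer k ({} :: 'a::metric_space set) = 0"
  by (simp add: hausdorff_outer_def hausdorff_content_empty)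

lemma hausdorff_outer_countably_subadditive:
  "hausdorff_outer k (\<Union>i. A i) \<le> (\<Sum>i. hausdorff_outer k (A i :: 'a::metric_space set))"
  unfolding hausdorff_outer_def[of k "\<Union>i. A i"]
proof (rule SUP_least)
  fix \<delta> :: real assume d: "\<delta> \<in> {0<..}"
  have "hausdorff_content k \<delta> (\<Union>i. A i) \<le> (\<Sum>i. hausdorff_content k \<delta> (A i))"
    by (rule hausdorff_content_countably_subadditive)
  also have "\<dots> \<le> (\<Sum>i. hausdorff_outer k (A i))"
    unfolding hausdorff_outer_def by (intro suminf_le SUP_upper d) auto
  finally show "hausdorff_content k \<delta> (\<Union>i. A i) \<le> (\<Sum>i. hausdorff_outer k (A i))" .
qed

lemma hausdorff_outer_Un_le:
  "hausdorff_outer k (A \<union> B) \<le> hausdorff_outer k A + hausdorff_outer k (B :: 'a::metric_space set)"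
proof -
  have "hausdorff_outer k (A \<union> B) = hausdorff_outer k (\<Union>i. binaryset A B i)"
    by (simp only: UN_binaryset_eq)
  also have "\<dots> \<le> (\<Sum>i. hausdorff_outer k (binaryset A B i))"
    by (rule hausdorff_outer_countably_subadditive)
  also have "\<dots> = hausdorff_outer k A + hausdorff_outer k B"
    by (intro suminf_binaryset_eq hausdorff_outer_empty)
  finally show ?thesis .
qed

lemma hausdorff_content_antimono:
  "\<delta> \<le> \<epsilon> \<Longrightarrow> hausdorff_content k \<epsilon> A \<le> hausdorff_content k \<delta> A"
  unfolding hausdorff_content_def hausdorff_covers_def
  by (rule INF_superset_mono) (auto intro: order_trans)

text \<open>
  If all covering sets are too small to bridge the gap between two sets, then every cover of the union
  contains two disjoint subfamilies, one covering each part.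
\<close>

lemma hausdorff_content_separated:
  assumes sep: "\<And>x y. x \<in> A \<Longrightarrow> y \<in> B \<Longrightarrow> \<delta> < dist x y"
    and d: "0 < \<delta>"
  shows "hausdorff_content k \<delta> A + hausdorff_content k \<delta> B \<le> hausdorff_content k \<delta> (A \<union> B)"
  unfolding hausdorff_content_def[of k \<delta> "A \<union> B"]
proof (rule INF_greatest)
  fix U assume U: "U \<in> hausdorff_covers \<delta> (A \<union> B)"
  define V where "V = (\<lambda>C i. if U i \<inter> C = {} then {} else U i)"
  have V: "V C \<in> hausdorff_covers \<delta> C" if "C \<subseteq> A \<union> B" for C
  proof -
    have "C \<subseteq> (\<Union>i. V C i)"
    proof
      fix x assume "x \<in> C"
      then obtain i where "x \<in> U i" using U \<open>C \<subseteq> A \<union> B\<close> unfolding hausdorff_covers_def by blast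
      then have "x \<in> V C i" using \<open>x \<in> C\<close> by (auto simp: V_def)
      then show "x \<in> (\<Union>i. V C i)" by blast
    qed
    then show ?thesis using U d by (auto simp: hausdorff_covers_def V_def)
  qed
  \<comment> \<open>A set of diameter at most \<open>\<delta>\<close> cannot meet both parts, so the cover splits.\<close>
  have split: "hausdorff_weight k (V A i) + hausdorff_weight k (V B i) \<le> hausdorff_weight k (U i)" for i
  proof -
    have "U i \<inter> A = {} \<or> U i \<inter> B = {}"
    proof (rule ccontr)
      assume "\<not> ?thesis"
      then obtain x y where xy: "x \<in> U i" "x \<in> A" "y \<in> U i" "y \<in> B" by blast
      have "dist x y \<le> diameter (U i)"
        using U xy by (intro diameter_bounded_bound) (auto simp: hausdorff_covers_def)
      also have "\<dots> \<le> \<delta>" using U by (auto simp: hausdorff_covers_def)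
      finally show False using sep[OF xy(2,4)] by simp
    qed
    then show ?thesis by (auto simp: V_def hausdorff_weight_def)
  qed
  have "hausdorff_content k \<delta> A + hausdorff_content k \<delta> B
      \<le> (\<Sum>i. hausdorff_weight k (V A i)) + (\<Sum>i. hausdorff_weight k (V B i))"
    unfolding hausdorff_content_def by (intro add_mono INF_lower V) auto
  also have "\<dots> = (\<Sum>i. hausdorff_weight k (V A i) + hausdorff_weight k (V B i))"
    by (rule suminf_add) auto
  also have "\<dots> \<le> (\<Sum>i. hausdorff_weight k (U i))"
    by (intro suminf_le split) auto
  finally show "hausdorff_content k \<delta> A + hausdorff_content k \<delta> B \<le> (\<Sum>i. hausdorff_weight k (U i))" .
qed

lemma hausdorff_outer_separated:
  assumes sep: "\<And>x y. x \<in> A \<Longrightarrow> y \<in> B \<Longrightarrow> e \<le> dist x y" and e: "0 < e"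
  shows "hausdorff_outer k A + hausdorff_outer k B \<le> hausdorff_outer k (A \<union> B)"
proof -
  have "hausdorff_content k d1 A + hausdorff_content k d2 B \<le> hausdorff_outer k (A \<union> B)"
    if "0 < d1" "0 < d2" for d1 d2
  proof -
    \<comment> \<open>A scale finer than both given ones and below the gap \<open>e\<close>.\<close>
    define d where "d = min (e/2) (min d1 d2)"
    have d: "0 < d" "d < e" "d \<le> d1" "d \<le> d2" using that e by (auto simp: d_def)
    have "hausdorff_content k d1 A + hausdorff_content k d2 B
        \<le> hausdorff_content k d A + hausdorff_content k d B"
      by (intro add_mono hausdorff_content_antimono d)
    also have "\<dots> \<le> hausdorff_content k d (A \<union> B)"
      using sep d by (intro hausdorff_content_separated) (auto intro: less_le_trans)
    also have "\<dots> \<le> hausdorff_outer k (A \<union> B)"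
      unfolding hausdorff_outer_def using d by (intro SUP_upper) auto
    finally show ?thesis .
  qed
  then have "(SUP p\<in>{0<..}. hausdorff_content k p A + hausdorff_content k d2 B) \<le> hausdorff_outer k (A \<union> B)"
    if "0 < d2" for d2
    using that by (intro SUP_least) auto
  then have *: "hausdorff_outer k A + hausdorff_content k d2 B \<le> hausdorff_outer k (A \<union> B)"
    if "0 < d2" for d2
    using that unfolding hausdorff_outer_def[of k A]
    by (simp add: ennreal_SUP_add_left)
  then have "(SUP q\<in>{0<..}. hausdorff_outer k A + hausdorff_content k q B) \<le> hausdorff_outer k (A \<union> B)"
    by (intro SUP_least) auto
  then show ?thesis
    unfolding hausdorff_outer_def[of k B]
    by (simp add: ennreal_SUP_add_right)
qed

lemma hausdorff_outer_sum_separated: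
  assumes sep': "\<And>j. \<exists>e>0. \<forall>i<j. \<forall>x\<in>R i. \<forall>y\<in>R j. e \<le> dist x y"
  shows "(\<Sum>i<n. hausdorff_outer k (R i)) \<le> hausdorff_outer k (\<Union>i<n. R (i::nat) :: 'a::metric_space set)"
proof (induction n)
  case 0 then show ?case by simp
next
  case (Suc n)
  obtain e where e: "e > 0" "\<forall>i<n. \<forall>x\<in>R i. \<forall>y\<in>R n. e \<le> dist x y" using sep' by blast
  have "(\<Sum>i<Suc n. hausdorff_outer k (R i)) \<le> hausdorff_outer k (\<Union>i<n. R i) + hausdorff_outer k (R n)"
    using Suc by (simp add: add_mono)
  also have "\<dots> \<le> hausdorff_outer k ((\<Union>i<n. R i) \<union> R n)"
    using e by (intro hausdorff_outer_separated) auto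
  also have "(\<Union>i<n. R i) \<union> R n = (\<Union>i<Suc n. R i)" by (auto simp: less_Suc_eq)
  finally show ?case .
qed

text \<open>
  Caratheodory's criterion for metric outer measures. The part of \<open>A\<close> outside \<open>C\<close> is exhausted by the sets
  \<open>F i\<close> of points at distance at least \<open>1 / (i + 1)\<close> from \<open>C\<close>, to which additivity for separated sets
  applies. What \<open>F i\<close> misses is covered by the shells \<open>R j\<close> with \<open>j \<ge> i\<close>. Shells whose indices differ by at
  least two are separated, so the measures of the shells with even index, and likewise of those with odd
  index, have a sum of at most the measure of \<open>A\<close>. If that measure is finite, the tails of the series
  tend to zero; otherwise the inequality is trivial.
\<close>

lemma hausdorff_outer_closed_split:
  fixes C A :: "'a::metric_space set"
  assumes "closed C"
  shows "hausdorff_outer k (A \<inter> C) + hausdorff_outer k (A - C) \<le> hausdorff_outer k A"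
proof (cases "hausdorff_outer k A = \<infinity> \<or> C = {}")
  case True
  then show ?thesis by (auto simp: hausdorff_outer_empty)
next
  case False
  let ?\<mu> = "hausdorff_outer k"
  define F where "F = (\<lambda>i::nat. {x\<in>A. 1 / (real i + 1) \<le> infdist x C})"
  define R where "R = (\<lambda>i::nat. {x\<in>A. 1 / (real i + 2) \<le> infdist x C \<and> infdist x C < 1 / (real i + 1)})"
  have fin: "?\<mu> A < \<infinity>" and ne: "C \<noteq> {}" using False by (auto simp: less_top)
  have infd: "infdist x C \<le> infdist y C + dist x y" for x y by (rule infdist_triangle)
  have sepR: "\<exists>e>0. \<forall>i. i + 2 \<le> j \<longrightarrow> (\<forall>x\<in>R i. \<forall>y\<in>R j. e \<le> dist x y)" for j
  proof (intro exI conjI allI impI ballI)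
    show "(if j = 0 then 1 else 1 / (real j) - 1 / (real j + 1)) > 0"
      by (auto simp: frac_less2)
    fix i x y assume i: "i + 2 \<le> j" and x: "x \<in> R i" and y: "y \<in> R j"
    have "1 / real j \<le> 1 / (real i + 2)" using i by (intro divide_left_mono) auto
    also have "\<dots> \<le> infdist x C" using x by (auto simp: R_def)
    also have "\<dots> \<le> infdist y C + dist x y" by (rule infd)
    also have "infdist y C < 1 / (real j + 1)" using y by (auto simp: R_def)
    finally show "(if j = 0 then 1 else 1 / (real j) - 1 / (real j + 1)) \<le> dist x y"
      using i by auto
  qed
  \<comment> \<open>The offset \<open>p\<close> is \<open>0\<close> for the even and \<open>1\<close> for the odd shells.\<close>
  have half: "(\<Sum>i. ?\<mu> (R (2 * i + p))) \<le> ?\<mu> A" for p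
  proof -
    have "(\<Sum>i<n. ?\<mu> (R (2 * i + p))) \<le> ?\<mu> A" for n
    proof -
      have "\<exists>e>0. \<forall>i<j. \<forall>x\<in>R (2 * i + p). \<forall>y\<in>R (2 * j + p). e \<le> dist x y" for j
      proof -
        obtain e where e: "e > 0" "\<forall>i. i + 2 \<le> 2 * j + p \<longrightarrow> (\<forall>x\<in>R i. \<forall>y\<in>R (2 * j + p). e \<le> dist x y)"
          using sepR by blast
        have "2 * i + p + 2 \<le> 2 * j + p" if "i < j" for i using that by simp
        then show ?thesis using e by blast
      qed
      then have "(\<Sum>i<n. ?\<mu> (R (2 * i + p))) \<le> ?\<mu> (\<Union>i<n. R (2 * i + p))"
        by (rule hausdorff_outer_sum_separated)
      also have "\<dots> \<le> ?\<mu> A" by (intro hausdorff_outer_mono) (auto simp: R_def)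
      finally show ?thesis .
    qed
    then show ?thesis by (intro suminf_le_const) auto
  qed
  have sumR: "(\<Sum>i. ?\<mu> (R i)) < \<infinity>"
  proof -
    have "(\<Sum>i. ?\<mu> (R i)) \<le> ?\<mu> A + ?\<mu> A"
    proof (intro suminf_le_const)
      fix n
      have "(\<Sum>i<n. ?\<mu> (R i)) \<le> (\<Sum>i<2*n. ?\<mu> (R i))" by (intro sum_mono2) auto
      also have "\<dots> = (\<Sum>i<n. ?\<mu> (R (2 * i + 0))) + (\<Sum>i<n. ?\<mu> (R (2 * i + 1)))"
        by (induction n) (auto simp: ac_simps)
      also have "\<dots> \<le> ?\<mu> A + ?\<mu> A"
        by (intro add_mono order_trans[OF sum_le_suminf half]) auto
      finally show "(\<Sum>i<n. ?\<mu> (R i)) \<le> ?\<mu> A + ?\<mu> A" .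
    qed auto
    also have "\<dots> < \<infinity>" using fin by auto
    finally show ?thesis .
  qed
  have split: "?\<mu> (A \<inter> C) + ?\<mu> (F i) \<le> ?\<mu> A" for i
  proof -
    have "?\<mu> (A \<inter> C) + ?\<mu> (F i) \<le> ?\<mu> ((A \<inter> C) \<union> F i)"
    proof (rule hausdorff_outer_separated[of _ _ "1 / (real i + 1)"])
      fix x y assume "x \<in> A \<inter> C" "y \<in> F i"
      then have "1 / (real i + 1) \<le> infdist y C" by (auto simp: F_def)
      also have "\<dots> \<le> dist y x" using \<open>x \<in> A \<inter> C\<close> by (intro infdist_le) auto
      finally show "1 / (real i + 1) \<le> dist x y" by (simp add: dist_commute)
    qed auto
    also have "\<dots> \<le> ?\<mu> A" by (intro hausdorff_outer_mono) (auto simp: F_def)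
    finally show ?thesis .
  qed
  have tail: "?\<mu> (A - C) \<le> ?\<mu> (F i) + (\<Sum>j. ?\<mu> (R (j + i)))" for i
  proof -
    have "A - C \<subseteq> F i \<union> (\<Union>j. R (j + i))"
    proof
      fix x assume x: "x \<in> A - C"
      then have pos: "infdist x C > 0"
        using assms ne by (metis DiffD2 in_closed_iff_infdist_zero infdist_nonneg order_less_le)
      show "x \<in> F i \<union> (\<Union>j. R (j + i))"
      proof (cases "x \<in> F i")
        case False
        obtain m :: nat where m: "1 / (real m + 1) < infdist x C"
          using pos nat_approx_posE by (metis of_nat_Suc add.commute)
        \<comment> \<open>With \<open>l\<close> minimal, \<open>x\<close> lies in the shell of index \<open>l - 1\<close>.\<close>
        define l where "l = (LEAST l. 1 / (real l + 1) \<le> infdist x C)"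
        have l: "1 / (real l + 1) \<le> infdist x C"
          unfolding l_def by (rule LeastI[of _ m]) (use m in auto)
        have lmin: "infdist x C < 1 / (real q + 1)" if "q < l" for q
          using not_less_Least[OF that[unfolded l_def]] by auto
        have "i < l"
        proof (rule ccontr)
          assume "\<not> i < l"
          then have "1 / (real i + 1) \<le> 1 / (real l + 1)" by (intro divide_left_mono) auto
          then have "x \<in> F i" using l x by (auto simp: F_def)
          then show False using False by simp
        qed
        then obtain j where j: "l = Suc (j + i)" by (metis add.commute less_imp_Suc_add add_Suc)
        then have "x \<in> R (j + i)" using l lmin[of "j + i"] x by (auto simp: R_def algebra_simps)
        then show ?thesis by blast
      qed auto
    qed
    then have "?\<mu> (A - C) \<le> ?\<mu> (F i \<union> (\<Union>j. R (j + i)))" by (rule hausdorff_outer_mono)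
    also have "\<dots> \<le> ?\<mu> (F i) + ?\<mu> (\<Union>j. R (j + i))" by (rule hausdorff_outer_Un_le)
    also have "\<dots> \<le> ?\<mu> (F i) + (\<Sum>j. ?\<mu> (R (j + i)))"
      by (intro add_left_mono hausdorff_outer_countably_subadditive)
    finally show ?thesis .
  qed
  have "(\<lambda>i. \<Sum>j. ?\<mu> (R (j + i))) \<longlonglongrightarrow> 0"
  proof -
    have eq: "?\<mu> (R i) = ennreal (enn2real (?\<mu> (R i)))" for i
    proof -
      have "?\<mu> (R i) \<le> ?\<mu> A" by (rule hausdorff_outer_mono) (auto simp: R_def)
      then show ?thesis using fin by (simp add: ennreal_enn2real_if less_top order_le_less_trans)
    qed
    have "summable (\<lambda>i. enn2real (?\<mu> (R i)))"
      using sumR eq by (intro summable_suminf_not_top) (auto simp flip: eq)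
    then have sm: "summable (\<lambda>i. enn2real (?\<mu> (R i)))" .
    have "(\<lambda>i. \<Sum>j. enn2real (?\<mu> (R (j + i)))) \<longlonglongrightarrow> 0"
      by (rule suminf_exist_split2[OF sm])
    moreover have "(\<Sum>j. ?\<mu> (R (j + i))) = ennreal (\<Sum>j. enn2real (?\<mu> (R (j + i))))" for i
      by (subst eq) (intro suminf_ennreal2 summable_ignore_initial_segment sm enn2real_nonneg)
    ultimately show ?thesis by (simp add: tendsto_ennrealI flip: ennreal_0)
  qed
  then have lim: "(\<lambda>i. ?\<mu> A + (\<Sum>j. ?\<mu> (R (j + i)))) \<longlonglongrightarrow> ?\<mu> A + 0"
    by (intro tendsto_add tendsto_const)
  have "?\<mu> (A \<inter> C) + ?\<mu> (A - C) \<le> ?\<mu> A + (\<Sum>j. ?\<mu> (R (j + i)))" for i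
  proof -
    have "?\<mu> (A \<inter> C) + ?\<mu> (A - C) \<le> ?\<mu> (A \<inter> C) + (?\<mu> (F i) + (\<Sum>j. ?\<mu> (R (j + i))))"
      by (intro add_left_mono tail)
    also have "\<dots> \<le> ?\<mu> A + (\<Sum>j. ?\<mu> (R (j + i)))"
      unfolding add.assoc[symmetric] by (intro add_right_mono split)
    finally show ?thesis .
  qed
  then show ?thesis using LIMSEQ_le_const[OF lim] by (metis add_0_right)
qed

lemma borel_sets_hausdorff: "sets borel \<subseteq> sets (hausdorff_measure k :: 'a::metric_space measure)"
proof -
  have "C \<in> sets (hausdorff_measure k)" if "closed C" for C :: "'a set"
    unfolding sets_hausdorff_measure lambda_system_def
  proof (clarsimp, intro order_antisym)
    fix A :: "'a set"
    have "C \<inter> A = A \<inter> C" "(UNIV - C) \<inter> A = A - C" by auto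
    then show "hausdorff_outer k (C \<inter> A) + hausdorff_outer k ((UNIV - C) \<inter> A) \<le> hausdorff_outer k A"
      using hausdorff_outer_closed_split[OF that] by metis
    have "hausdorff_outer k A \<le> hausdorff_outer k ((C \<inter> A) \<union> ((UNIV - C) \<inter> A))"
      by (intro hausdorff_outer_mono) auto
    also have "\<dots> \<le> hausdorff_outer k (C \<inter> A) + hausdorff_outer k ((UNIV - C) \<inter> A)"
      by (rule hausdorff_outer_Un_le)
    finally show "hausdorff_outer k A \<le> hausdorff_outer k (C \<inter> A) + hausdorff_outer k ((UNIV - C) \<inter> A)" .
  qed
  then show ?thesis
    unfolding borel_eq_closed
    using sets.sigma_sets_subset[of "Collect closed" "hausdorff_measure k :: 'a measure"] by auto
qed

section \<open>Invariance under isometries\<close>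

lemma hausdorff_outer_isometry_le:
  fixes T :: "'a::metric_space \<Rightarrow> 'b::metric_space"
  assumes T: "\<And>x y. dist (T x) (T y) = dist x y"
  shows "hausdorff_outer k (T ` A) \<le> hausdorff_outer k A"
proof -
  have bd: "bounded (T ` U)" if U: "bounded U" for U
  proof -
    obtain x e where "\<forall>y\<in>U. dist x y \<le> e" using U by (auto simp: bounded_def)
    then have "\<forall>y\<in>T ` U. dist (T x) y \<le> e" using T by auto
    then show ?thesis unfolding bounded_def by blast
  qed
  have diam: "diameter (T ` U) = diameter U" for U
  proof -
    have "T ` U \<times> T ` U = (\<lambda>(x, y). (T x, T y)) ` (U \<times> U)" by auto
    then show ?thesis by (simp add: diameter_def image_image split_def T)
  qed
  have w: "hausdorff_weight k (T ` U) = hausdorff_weight k U" for U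
    by (auto simp: hausdorff_weight_def diam)
  have "hausdorff_content k d (T ` A) \<le> hausdorff_content k d A" for d
    unfolding hausdorff_content_def[of k d A]
  proof (rule INF_greatest)
    fix U assume U: "U \<in> hausdorff_covers d A"
    then have "(\<lambda>i. T ` U i) \<in> hausdorff_covers d (T ` A)"
      by (fastforce simp: hausdorff_covers_def diam bd)
    then have "hausdorff_content k d (T ` A) \<le> (\<Sum>i. hausdorff_weight k (T ` U i))"
      unfolding hausdorff_content_def by (rule INF_lower)
    then show "hausdorff_content k d (T ` A) \<le> (\<Sum>i. hausdorff_weight k (U i))"
      by (simp add: w)
  qed
  then show ?thesis unfolding hausdorff_outer_def by (intro SUP_mono) blast
qed

lemma hausdorff_outer_isometry:
  fixes T :: "'a::metric_space \<Rightarrow> 'b::metric_space"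
  assumes T: "\<And>x y. dist (T x) (T y) = dist x y" and "surj T"
  shows "hausdorff_outer k (T ` A) = hausdorff_outer k A"
proof (rule order_antisym[OF hausdorff_outer_isometry_le[OF T]])
  have "inj T" using T by (metis dist_eq_0_iff injI)
  then have "hausdorff_outer k A = hausdorff_outer k (inv T ` T ` A)"
    by (simp add: image_image)
  also have "\<dots> \<le> hausdorff_outer k (T ` A)"
    using T \<open>surj T\<close> by (intro hausdorff_outer_isometry_le) (metis surj_f_inv_f)
  finally show "hausdorff_outer k A \<le> hausdorff_outer k (T ` A)" .
qed

lemma emeasure_hausdorff_borel:
  "A \<in> sets borel \<Longrightarrow> emeasure (hausdorff_measure k) A = hausdorff_outer k (A :: 'a::metric_space set)"
  using borel_sets_hausdorff by (intro emeasure_hausdorff_measure) blast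

section \<open>Hausdorff measure of pieces of a coordinate hyperplane\<close>

text \<open>
  A grid of mesh \<open>1 / m\<close> covers the box by at most \<open>((2 R + 1) m) ^ k\<close> cells, each of weight proportional to
  \<open>(1 / m) ^ k\<close>, so the total weight is bounded independently of \<open>m\<close>.
\<close>

lemma hausdorff_outer_coordinate_box_finite:
  fixes i :: "'n::finite"
  assumes k: "k = CARD('n) - 1"
  shows "hausdorff_outer k {x :: real ^ 'n. x $ i = 0 \<and> (\<forall>j. \<bar>x $ j\<bar> \<le> real R)} < \<infinity>"
proof -
  define A where "A = {x :: real ^ 'n. x $ i = 0 \<and> (\<forall>j. \<bar>x $ j\<bar> \<le> real R)}"
  define N where "N = CARD('n)"
  have N: "N \<ge> 1" unfolding N_def by (simp add: Suc_leI)
  define B where "B = unit_ball_vol (real k) * (real (2 * R + 1) * real N / 2) ^ k"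
  have wpos: "unit_ball_vol (real k) \<ge> 0" by simp
  have "hausdorff_content k \<delta> A \<le> ennreal B" if \<delta>: "\<delta> > 0" for \<delta>
  proof -
    \<comment> \<open>The cells of side \<open>1 / m\<close> are indexed by the integer corners of the cube scaled by \<open>m\<close>.\<close>
    obtain m :: nat where m: "m > 0" "real N / real m \<le> \<delta>"
    proof -
      obtain m :: nat where "real N / \<delta> < real m" using reals_Archimedean2 by blast
      moreover from this have "m > 0" using \<delta>
        by (metis divide_nonneg_pos gr0I linorder_not_less of_nat_0 of_nat_0_le_iff)
      ultimately show ?thesis using \<delta> by (intro that[of m]) (auto simp: field_simps)
    qed
    define I where "I = PiE (UNIV - {i}) (\<lambda>_. {- int (R * m) .. int (R * m)})"
    define cell where "cell = (\<lambda>v :: 'n \<Rightarrow> int. {x :: real ^ 'n. x $ i = 0 \<and>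
        (\<forall>j. j \<noteq> i \<longrightarrow> of_int (v j) \<le> real m * x $ j \<and> real m * x $ j \<le> of_int (v j) + 1)})"
    have finI: "finite I" unfolding I_def by (intro finite_PiE) auto
    have cardI: "card I = (2 * R * m + 1) ^ k"
      unfolding I_def k by (subst card_PiE) (auto simp: nat_add_distrib nat_mult_distrib algebra_simps)
    have cover: "A \<subseteq> (\<Union>v\<in>I. cell v)"
    proof
      fix x assume x: "x \<in> A"
      define v where "v = restrict (\<lambda>j. \<lfloor>real m * x $ j\<rfloor>) (UNIV - {i})"
      have "- int (R * m) \<le> \<lfloor>real m * x $ j\<rfloor> \<and> \<lfloor>real m * x $ j\<rfloor> \<le> int (R * m)" for j
      proof -
        have "\<bar>real m * x $ j\<bar> \<le> real m * real R"
          using x m by (auto simp: A_def abs_mult intro!: mult_left_mono)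
        then have "- real (R * m) \<le> real m * x $ j \<and> real m * x $ j \<le> real (R * m)"
          by (auto simp: mult.commute abs_le_iff)
        then show ?thesis by (simp add: le_floor_iff floor_le_iff)
      qed
      then have "v \<in> I" by (auto simp: v_def I_def)
      moreover have "x \<in> cell v" using x by (auto simp: cell_def v_def A_def intro: less_imp_le)
      ultimately show "x \<in> (\<Union>v\<in>I. cell v)" by blast
    qed
    have cell_dist: "norm (x - y) \<le> real N / real m" if "x \<in> cell v" "y \<in> cell v" for x y v
    proof -
      have "\<bar>(x - y) $ j\<bar> \<le> 1 / real m" for j
      proof (cases "j = i")
        case False
        then have "\<bar>real m * x $ j - real m * y $ j\<bar> \<le> 1"
          using that by (auto simp: cell_def abs_le_iff) (smt (verit))+
        then have "real m * \<bar>x $ j - y $ j\<bar> \<le> 1"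
          by (metis abs_mult abs_of_nat right_diff_distrib)
        then show ?thesis using m by (simp add: field_simps)
      qed (use that m in \<open>auto simp: cell_def\<close>)
      then have "(\<Sum>j\<in>UNIV. \<bar>(x - y) $ j\<bar>) \<le> (\<Sum>j\<in>(UNIV::'n set). 1 / real m)" by (intro sum_mono) auto
      then show ?thesis using norm_le_l1_cart[of "x - y"] by (simp add: N_def)
    qed
    have bcell: "bounded (cell v)" for v
    proof (cases "cell v = {}")
      case False
      then obtain y where "y \<in> cell v" by blast
      then show ?thesis unfolding bounded_def dist_norm using cell_dist by blast
    qed auto
    have dcell: "diameter (cell v) \<le> real N / real m" for v
      by (intro diameter_le cell_dist) auto
    obtain e where e: "bij_betw e {..<card I} I"
      using ex_bij_betw_nat_finite[OF finI] by (auto simp: atLeast0LessThan)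
    define U where "U = (\<lambda>l. if l < card I then cell (e l) else {})"
    have "A \<subseteq> (\<Union>l. U l)"
    proof
      fix x assume "x \<in> A"
      then obtain v where v: "v \<in> I" "x \<in> cell v" using cover by blast
      then obtain l where "l < card I" "v = e l" using e by (auto simp: bij_betw_def)
      then have "x \<in> U l" using v by (simp add: U_def)
      then show "x \<in> (\<Union>l. U l)" by blast
    qed
    moreover have "bounded (U l) \<and> diameter (U l) \<le> \<delta>" for l
      using bcell dcell m \<delta> by (auto simp: U_def intro: order_trans)
    ultimately have "U \<in> hausdorff_covers \<delta> A" by (auto simp: hausdorff_covers_def)
    then have "hausdorff_content k \<delta> A \<le> (\<Sum>l. hausdorff_weight k (U l))"
      unfolding hausdorff_content_def by (rule INF_lower)
    also have "\<dots> = (\<Sum>l<card I. hausdorff_weight k (U l))"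
      by (intro suminf_finite) (auto simp: U_def hausdorff_weight_def)
    also have "\<dots> \<le> (\<Sum>l<card I. ennreal (unit_ball_vol (real k) * (real N / real m / 2) ^ k))"
      using dcell diameter_ge_0[OF bcell]
      by (intro sum_mono) (auto simp: U_def hausdorff_weight_def intro!: ennreal_leI mult_left_mono power_mono divide_right_mono)
    also have "\<dots> = ennreal (real (card I) * (unit_ball_vol (real k) * (real N / real m / 2) ^ k))"
      by (simp add: ennreal_mult ennreal_of_nat_eq_real_of_nat)
    also have "\<dots> \<le> ennreal B"
    proof (intro ennreal_leI)
      have "real (card I) * (real N / real m / 2) ^ k = (real (2 * R * m + 1) * (real N / real m / 2)) ^ k"
        by (simp only: cardI of_nat_power power_mult_distrib)
      also have "\<dots> \<le> (real (2 * R + 1) * real N / 2) ^ k"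
      proof (intro power_mono)
        have "real (2 * R * m + 1) \<le> real (2 * R + 1) * real m"
          using m by (simp flip: of_nat_mult of_nat_add add: algebra_simps)
        then have "real (2 * R * m + 1) * (real N / real m / 2) \<le> real (2 * R + 1) * real m * (real N / real m / 2)"
          by (intro mult_right_mono) auto
        then show "real (2 * R * m + 1) * (real N / real m / 2) \<le> real (2 * R + 1) * real N / 2"
          using m by simp
      qed auto
      finally show "real (card I) * (unit_ball_vol (real k) * (real N / real m / 2) ^ k) \<le> B"
        unfolding B_def using wpos by (simp add: mult.left_commute mult_left_mono)
    qed
    finally show ?thesis .
  qed
  then have "hausdorff_outer k A \<le> ennreal B"
    unfolding hausdorff_outer_def by (intro SUP_least) auto
  also have "\<dots> < \<infinity>" by simp
  finally show ?thesis by (simp add: A_def)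
qed

lemma emeasure_lborel_cbox_cart:
  fixes a b :: "real ^ 'n"
  assumes "\<And>j. a $ j \<le> b $ j"
  shows "emeasure lborel (cbox a b) = ennreal (\<Prod>j\<in>UNIV. b $ j - a $ j)"
proof -
  have "a \<in> cbox a b" using assms by (simp add: mem_box_cart)
  then have "measure lborel (cbox a b) = (\<Prod>j\<in>UNIV. b $ j - a $ j)"
    by (subst content_cbox_cart) auto
  then show ?thesis
    using emeasure_lborel_cbox_finite[of a b] by (simp add: emeasure_eq_ennreal_measure less_top)
qed

text \<open>
  Thickening a cover of the disc by a unit segment in the direction of axis \<open>i\<close> gives a cover of a box of
  positive volume, and the volume of each thickened set is at most a constant times its weight. So the
  total weight of every cover is bounded below by a positive constant.
\<close>

lemma hausdorff_outer_coordinate_ball_pos: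
  fixes i :: "'n::finite"
  assumes k: "k = CARD('n) - 1" and n: "CARD('n) \<ge> 2" and \<rho>: "\<rho> > 0"
  shows "hausdorff_outer k {x :: real ^ 'n. x $ i = 0 \<and> norm x < \<rho>} > 0"
proof -
  define A where "A = {x :: real ^ 'n. x $ i = 0 \<and> norm x < \<rho>}"
  have kpos: "k > 0" using k n by simp
  define w where "w = unit_ball_vol (real k)"
  have w: "w > 0" by (simp add: w_def)
  \<comment> \<open>The cube of side \<open>s\<close> in the coordinates other than \<open>i\<close> fits into the disc, since its points have \<open>l\<^sub>1\<close> norm at most \<open>n * s\<close>.\<close>
  define s where "s = min 1 (\<rho> / (2 * real CARD('n)))"
  have s: "s > 0" "s \<le> 1" "real CARD('n) * s < \<rho>" using \<rho> by (auto simp: s_def min_def field_simps)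
  define Q where "Q = cbox (0 :: real ^ 'n) (\<chi> j. if j = i then 1 else s)"
  define c where "c = w * (s / 4) ^ k"
  have prod_i: "(\<Prod>j\<in>UNIV. if j = i then 1 else t) = t ^ k" for t :: real
  proof -
    have "(\<Prod>j\<in>UNIV. if j = i then 1 else t) = (\<Prod>j\<in>UNIV - {i}. t)"
      by (subst prod.remove[of _ i]) (auto intro!: prod.cong)
    then show ?thesis by (simp add: k)
  qed
  have emQ: "emeasure lborel Q = ennreal (s ^ k)"
    unfolding Q_def using s
    by (subst emeasure_lborel_cbox_cart) (auto simp: prod_i)
  have "ennreal c \<le> (\<Sum>l. hausdorff_weight k (U l))" if U: "U \<in> hausdorff_covers 1 A" for U
  proof -
    define d where "d = (\<lambda>l. diameter (U l))"
    have d: "d l \<ge> 0" for l using U by (auto simp: d_def hausdorff_covers_def intro: diameter_ge_0)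
    define y where "y = (\<lambda>l. SOME z. z \<in> U l)"
    \<comment> \<open>A piece of the hyperplane of diameter \<open>d\<close>, thickened by a unit segment, lies in a box of volume \<open>(2 d) ^ k\<close>.\<close>
    define V where "V = (\<lambda>l. if U l = {} then {} else
       cbox (\<chi> j. if j = i then 0 else y l $ j - d l) (\<chi> j. if j = i then 1 else y l $ j + d l))"
    have emV: "emeasure lborel (V l) \<le> ennreal (4 ^ k / w) * hausdorff_weight k (U l)" for l
    proof (cases "U l = {}")
      case False
      have "emeasure lborel (V l) = ennreal ((2 * d l) ^ k)"
      proof -
        have "emeasure lborel (V l) = ennreal (\<Prod>j\<in>UNIV. if j = i then 1 else 2 * d l)"
          using False d[of l] unfolding V_def
          by (simp, subst emeasure_lborel_cbox_cart)
            (auto intro!: prod.cong arg_cong[where f=ennreal] split: if_splits)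
        then show ?thesis by (simp add: prod_i)
      qed
      also have "\<dots> = ennreal (4 ^ k / w * (w * (d l / 2) ^ k))"
      proof -
        have "4 ^ k * (d l / 2) ^ k = (2 * d l) ^ k" by (simp only: power_mult_distrib[symmetric]) simp
        then show ?thesis using w by simp
      qed
      also have "\<dots> = ennreal (4 ^ k / w) * hausdorff_weight k (U l)"
        using w d[of l] False by (subst ennreal_mult) (auto simp: hausdorff_weight_def w_def d_def)
      finally show ?thesis by simp
    qed (simp add: V_def)
    have "Q \<subseteq> (\<Union>l. V l)"
    proof
      fix x assume x: "x \<in> Q"
      define z where "z = (\<chi> j. if j = i then 0 else x $ j)"
      have xb: "0 \<le> x $ j" "x $ j \<le> (if j = i then 1 else s)" for j
        using x by (auto simp: Q_def mem_box_cart)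
      have "norm z \<le> (\<Sum>j\<in>UNIV. \<bar>z $ j\<bar>)" by (rule norm_le_l1_cart)
      also have "\<dots> \<le> (\<Sum>j\<in>(UNIV::'n set). s)"
        using xb s by (intro sum_mono) (auto simp: z_def split: if_splits, smt (verit))
      also have "\<dots> < \<rho>" using s by simp
      finally have "z \<in> A" by (simp add: A_def z_def)
      then obtain l where l: "z \<in> U l" using U unfolding hausdorff_covers_def by blast
      then have "y l \<in> U l" unfolding y_def by (rule someI)
      have "\<bar>z $ j - y l $ j\<bar> \<le> d l" for j
      proof -
        have "\<bar>(z - y l) $ j\<bar> \<le> norm (z - y l)" by (rule component_le_norm_cart)
        also have "\<dots> = dist z (y l)" by (simp add: dist_norm)
        also have "\<dots> \<le> d l"
          using U l \<open>y l \<in> U l\<close> unfolding d_def by (intro diameter_bounded_bound) (auto simp: hausdorff_covers_def)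
        finally show ?thesis by simp
      qed
      then have "x \<in> V l"
        using l xb[of i] by (auto simp: V_def mem_box_cart z_def abs_le_iff split: if_splits) (smt (verit))+
      then show "x \<in> (\<Union>l. V l)" by blast
    qed
    then have "emeasure lborel Q \<le> emeasure lborel (\<Union>l. V l)"
      by (intro emeasure_mono) (auto simp: V_def)
    also have "\<dots> \<le> (\<Sum>l. emeasure lborel (V l))"
      by (intro emeasure_subadditive_countably) (auto simp: V_def)
    also have "\<dots> \<le> (\<Sum>l. ennreal (4 ^ k / w) * hausdorff_weight k (U l))"
      by (intro suminf_le emV) auto
    also have "\<dots> = ennreal (4 ^ k / w) * (\<Sum>l. hausdorff_weight k (U l))" by simp
    finally have "ennreal (w / 4 ^ k) * ennreal (s ^ k) \<le> ennreal (w / 4 ^ k) * (ennreal (4 ^ k / w) * (\<Sum>l. hausdorff_weight k (U l)))"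
      unfolding emQ by (intro mult_left_mono) auto
    also have "\<dots> = (\<Sum>l. hausdorff_weight k (U l))"
      unfolding mult.assoc[symmetric] using w by (subst ennreal_mult[symmetric]) auto
    also have "ennreal (w / 4 ^ k) * ennreal (s ^ k) = ennreal c"
      using w s by (subst ennreal_mult[symmetric]) (auto simp: c_def power_divide)
    finally show ?thesis .
  qed
  then have "ennreal c \<le> hausdorff_content k 1 A"
    unfolding hausdorff_content_def by (intro INF_greatest)
  also have "\<dots> \<le> hausdorff_outer k A" unfolding hausdorff_outer_def by (intro SUP_upper) auto
  finally have "ennreal c \<le> hausdorff_outer k A" .
  moreover have "c > 0" using w s by (simp add: c_def)
  ultimately show ?thesis unfolding A_def by (metis ennreal_less_zero_iff less_le_trans)
qed

section \<open>Translation invariant measures\<close>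

lemma sigma_finite_if_finite_on_balls:
  fixes \<nu> :: "'a::euclidean_space measure"
  assumes [measurable_cong]: "sets \<nu> = sets borel" and fin: "\<And>r. emeasure \<nu> (ball 0 r) < \<infinity>"
  shows "sigma_finite_measure \<nu>"
proof
  have sp: "space \<nu> = UNIV" using sets_eq_imp_space_eq[OF assms(1)] by simp
  have "(\<Union>n. ball 0 (real n)) = (UNIV :: 'a set)"
    using reals_Archimedean2 by (auto simp: set_eq_iff)
  then show "\<exists>A. countable A \<and> A \<subseteq> sets \<nu> \<and> \<Union> A = space \<nu> \<and> (\<forall>a\<in>A. emeasure \<nu> a \<noteq> \<infinity>)"
    using fin assms(1) sp by (intro exI[of _ "range (\<lambda>n::nat. ball 0 (real n))"]) (auto simp: less_top)
qed

text \<open>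
  The double integral of \<open>indicator A x * indicator B (y - x)\<close> over \<open>\<nu>\<close> and Lebesgue measure is evaluated in
  both orders of integration, with translation invariance of the inner measure used each time.
\<close>

lemma translation_invariant_measure_swap:
  fixes \<nu> :: "'a::euclidean_space measure"
  assumes s[measurable_cong]: "sets \<nu> = sets borel"
    and fin: "\<And>r. emeasure \<nu> (ball 0 r) < \<infinity>"
    and inv: "\<And>v A. A \<in> sets borel \<Longrightarrow> emeasure \<nu> ((\<lambda>x. x + v) -` A) = emeasure \<nu> A"
    and A[measurable]: "A \<in> sets borel" and B[measurable]: "B \<in> sets borel"
  shows "emeasure \<nu> A * emeasure lborel B = emeasure lborel A * emeasure \<nu> (uminus -` B)"
proof -
  have sp: "space \<nu> = UNIV" using sets_eq_imp_space_eq[OF s] by simp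
  interpret sigma_finite_measure \<nu> by (rule sigma_finite_if_finite_on_balls[OF s fin])
  interpret pair_sigma_finite \<nu> lborel ..
  have distr: "distr \<nu> borel (\<lambda>x. x + v) = \<nu>" for v
    by (rule measure_eqI) (auto simp: s sp emeasure_distr inv)
  have lshift: "(\<integral>\<^sup>+y. f (x + y) \<partial>lborel) = (\<integral>\<^sup>+y. f y \<partial>lborel)"
    if [measurable]: "f \<in> borel_measurable borel" for f :: "'a \<Rightarrow> ennreal" and x
    by (subst lborel_distr_plus[of x, symmetric], subst nn_integral_distr) auto
  have nshift: "(\<integral>\<^sup>+x. f (x + v) \<partial>\<nu>) = (\<integral>\<^sup>+x. f x \<partial>\<nu>)"
    if [measurable]: "f \<in> borel_measurable borel" for f :: "'a \<Rightarrow> ennreal" and v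
    by (subst (2) distr[of v, symmetric], subst nn_integral_distr) auto
  have "emeasure \<nu> A * emeasure lborel B = (\<integral>\<^sup>+x. indicator A x * emeasure lborel B \<partial>\<nu>)"
    by (simp add: nn_integral_multc)
  also have "\<dots> = (\<integral>\<^sup>+x. (\<integral>\<^sup>+y. indicator A x * indicator B (- x + y) \<partial>lborel) \<partial>\<nu>)"
    by (subst lshift) (auto simp: nn_integral_cmult)
  also have "\<dots> = (\<integral>\<^sup>+y. (\<integral>\<^sup>+x. indicator A x * indicator B (- x + y) \<partial>\<nu>) \<partial>lborel)"
    by (rule Fubini'[symmetric]) measurable
  also have "\<dots> = (\<integral>\<^sup>+y. (\<integral>\<^sup>+x. indicator A (x + y) * indicator B (- x) \<partial>\<nu>) \<partial>lborel)"
  proof (rule nn_integral_cong)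
    fix y :: 'a
    show "(\<integral>\<^sup>+x. indicator A x * indicator B (- x + y) \<partial>\<nu>) = (\<integral>\<^sup>+x. indicator A (x + y) * indicator B (- x) \<partial>\<nu>)"
      by (subst nshift[of _ y, symmetric]) auto
  qed
  also have "\<dots> = (\<integral>\<^sup>+x. (\<integral>\<^sup>+y. indicator A (x + y) * indicator B (- x) \<partial>lborel) \<partial>\<nu>)"
    by (rule Fubini') measurable
  also have "\<dots> = (\<integral>\<^sup>+x. emeasure lborel A * indicator (uminus -` B) x \<partial>\<nu>)"
    by (subst lshift[of "\<lambda>y. indicator A y * indicator B (- _)"])
      (auto simp: nn_integral_multc indicator_vimage[symmetric] vimage_def)
  also have "\<dots> = emeasure lborel A * emeasure \<nu> (uminus -` B)"
  proof (rule nn_integral_cmult_indicator)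
    have "uminus \<in> borel_measurable (borel :: 'a measure)" by simp
    then show "uminus -` B \<in> sets \<nu>" using measurable_sets_borel[of uminus borel B] B by (simp add: s)
  qed
  finally show ?thesis .
qed

lemma translation_invariant_measure_eq_lborel:
  fixes \<nu> :: "'a::euclidean_space measure"
  assumes s: "sets \<nu> = sets borel"
    and fin: "\<And>r. emeasure \<nu> (ball 0 r) < \<infinity>"
    and inv: "\<And>v A. A \<in> sets borel \<Longrightarrow> emeasure \<nu> ((\<lambda>x. x + v) -` A) = emeasure \<nu> A"
  shows "\<nu> = density lborel (\<lambda>_. ennreal (measure \<nu> (ball 0 1) / measure lborel (ball (0::'a) 1)))"
proof (rule measure_eqI)
  let ?b = "measure lborel (ball (0::'a) 1)"
  have b: "?b > 0" by (simp add: content_ball unit_ball_vol_pos)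
  have eb: "emeasure lborel (ball (0::'a) 1) = ennreal ?b"
    by (simp add: emeasure_ball content_ball)
  fix A assume "A \<in> sets \<nu>"
  then have A: "A \<in> sets borel" by (simp add: s)
  have ball: "uminus -` ball (0::'a) 1 = ball 0 1" by auto
  have en: "emeasure \<nu> (ball 0 1) = ennreal (measure \<nu> (ball 0 1))"
    using fin[of 1] by (simp add: emeasure_eq_ennreal_measure less_top)
  have "emeasure \<nu> A * ennreal ?b = emeasure lborel A * ennreal (measure \<nu> (ball 0 1))"
    using translation_invariant_measure_swap[OF s fin inv A, of "ball 0 1"] by (simp add: ball eb en)
  then have "emeasure \<nu> A * ennreal ?b * ennreal (1 / ?b)
      = emeasure lborel A * ennreal (measure \<nu> (ball 0 1)) * ennreal (1 / ?b)" by simp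
  then have "emeasure \<nu> A = emeasure lborel A * ennreal (measure \<nu> (ball 0 1) / ?b)"
    using b by (simp add: mult.assoc flip: ennreal_mult)
  then show "emeasure \<nu> A = emeasure (density lborel (\<lambda>_. ennreal (measure \<nu> (ball 0 1) / ?b))) A"
    using A by (simp add: emeasure_density nn_integral_cmult_indicator mult.commute[of "emeasure _ _"])
qed (simp add: s)

lemma orthogonal_image_vimage_ball:
  assumes "orthogonal_transformation T"
  shows "T -` ball (0 :: 'a::euclidean_space) r = ball 0 r"
  using assms by (auto simp: orthogonal_transformation_norm)

text \<open>
  The image of Lebesgue measure under an orthogonal map is again translation invariant and gives the
  unit ball the same mass, so the constant of proportionality is one.
\<close>

lemma lborel_distr_orthogonal:
  fixes T :: "'a::euclidean_space \<Rightarrow> 'a"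
  assumes T: "orthogonal_transformation T"
  shows "distr lborel borel T = lborel"
proof -
  have lin: "linear T" using T by (rule orthogonal_transformation_linear)
  then have [measurable]: "T \<in> borel_measurable borel"
    by (intro borel_measurable_continuous_onI linear_continuous_on linear_conv_bounded_linear[THEN iffD1])
  let ?\<nu> = "distr lborel borel T"
  have "?\<nu> = density lborel (\<lambda>_. ennreal (measure ?\<nu> (ball 0 1) / measure lborel (ball (0::'a) 1)))"
  proof (rule translation_invariant_measure_eq_lborel)
    fix r show "emeasure ?\<nu> (ball 0 r) < \<infinity>"
      using emeasure_bounded_finite[OF bounded_ball, of "0::'a" r]
      by (simp add: emeasure_distr orthogonal_image_vimage_ball[OF T])
  next
    fix v and A :: "'a set" assume [measurable]: "A \<in> sets borel"
    obtain w where w: "T w = v" using orthogonal_transformation_surj[OF T] unfolding surj_def by metis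
    have "emeasure ?\<nu> ((\<lambda>x. x + v) -` A) = emeasure lborel ((+) w -` (T -` A))"
      using w by (simp add: emeasure_distr vimage_def linear_add[OF lin] add.commute)
    also have "\<dots> = emeasure (distr lborel borel ((+) w)) (T -` A)"
      by (subst emeasure_distr) (auto intro!: measurable_sets_borel[of T borel])
    also have "\<dots> = emeasure ?\<nu> A" by (simp add: lborel_distr_plus emeasure_distr)
    finally show "emeasure ?\<nu> ((\<lambda>x. x + v) -` A) = emeasure ?\<nu> A" .
  qed simp
  moreover have "measure ?\<nu> (ball 0 1) = measure lborel (ball (0::'a) 1)"
    by (simp add: measure_distr orthogonal_image_vimage_ball[OF T])
  moreover have "measure lborel (ball (0::'a) 1) > 0" by (simp add: content_ball unit_ball_vol_pos)
  ultimately show ?thesis by (simp add: density_1)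
qed

section \<open>Disintegration of Lebesgue measure along parallel hyperplanes\<close>

text \<open>
  The push-forward along the identity cuts the Caratheodory sigma-algebra down to the Borel sets, on which the
  product with Lebesgue measure is formed; the restriction to a hyperplane makes the measure sigma-finite.
\<close>

definition hyperplane_measure :: "real ^ 'n \<Rightarrow> (real ^ 'n) measure" where
  "hyperplane_measure e =
     density (distr (hausdorff_measure (CARD('n) - 1)) borel (\<lambda>x. x)) (indicator {x. e \<bullet> x = 0})"

text \<open>
  For unit \<open>e\<close> this is the measure \<open>A \<mapsto> \<integral> H (A \<inter> {x. e \<bullet> x = t}) dt\<close> with \<open>H\<close> the Hausdorff measure of
  codimension one. Writing it as the image of a product measure makes Fubini's theorem applicable.
\<close>

definition slice_measure :: "real ^ 'n \<Rightarrow> (real ^ 'n) measure" where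
  "slice_measure e = distr (hyperplane_measure e \<Otimes>\<^sub>M lborel) borel (\<lambda>(y, t). y + t *\<^sub>R e)"

lemma id_measurable_hausdorff:
  "(\<lambda>x. x) \<in> hausdorff_measure k \<rightarrow>\<^sub>M (borel :: 'a::metric_space measure)"
  using borel_sets_hausdorff by (auto simp: measurable_def)

lemma borel_vimage_translation:
  fixes A :: "'a::euclidean_space set"
  assumes "A \<in> sets borel"
  shows "(\<lambda>x. x + u) -` A \<in> sets borel"
  by (rule measurable_sets_borel[OF _ assms]) measurable

lemma sets_hyperplane_measure [simp, measurable_cong]: "sets (hyperplane_measure e) = sets borel"
  by (simp add: hyperplane_measure_def)

lemma space_hyperplane_measure [simp]: "space (hyperplane_measure e) = UNIV"
  by (simp add: hyperplane_measure_def)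

lemma sets_slice_measure [simp, measurable_cong]: "sets (slice_measure e) = sets borel"
  by (simp add: slice_measure_def)

lemma emeasure_hyperplane_measure:
  fixes e :: "real ^ 'n"
  assumes A: "A \<in> sets borel"
  shows "emeasure (hyperplane_measure e) A = hausdorff_outer (CARD('n) - 1) (A \<inter> {x. e \<bullet> x = 0})"
proof -
  note [measurable] = id_measurable_hausdorff
  have P: "{x. e \<bullet> x = 0} \<in> sets borel" by measurable
  then have "emeasure (hyperplane_measure e) A = emeasure (distr (hausdorff_measure (CARD('n) - 1)) borel (\<lambda>x. x)) ({x. e \<bullet> x = 0} \<inter> A)"
    using A unfolding hyperplane_measure_def
    by (subst emeasure_density) (auto simp: indicator_inter_arith[symmetric] simp flip: nn_integral_indicator)
  also have "\<dots> = emeasure (hausdorff_measure (CARD('n) - 1)) ({x. e \<bullet> x = 0} \<inter> A)"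
    using A P by (subst emeasure_distr) auto
  also have "\<dots> = hausdorff_outer (CARD('n) - 1) (A \<inter> {x. e \<bullet> x = 0})"
    using A P by (subst emeasure_hausdorff_borel) (auto simp: Int_commute)
  finally show ?thesis .
qed

lemma hyperplane_measure_translation:
  assumes A: "A \<in> sets borel" and v: "e \<bullet> v = 0"
  shows "emeasure (hyperplane_measure e) ((\<lambda>x. x + v) -` A) = emeasure (hyperplane_measure e) A"
proof -
  have "(\<lambda>x. x + v) -` A \<in> sets borel" by (rule measurable_sets_borel[OF _ A]) measurable
  moreover have "A \<inter> {x. e \<bullet> x = 0} = (\<lambda>x. x + v) ` ((\<lambda>x. x + v) -` A \<inter> {x. e \<bullet> x = 0})"
    using v by (auto simp: image_iff inner_add_right inner_diff_right intro!: bexI[of _ "_ - v"])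
  moreover have "hausdorff_outer k ((\<lambda>x. x + v) ` B) = hausdorff_outer k B" for k B
    by (rule hausdorff_outer_isometry) (auto intro: surj_plus_right)
  ultimately show ?thesis using A by (simp add: emeasure_hyperplane_measure)
qed

lemma hyperplane_measure_rotation:
  fixes T :: "real ^ 'n \<Rightarrow> real ^ 'n"
  assumes A: "A \<in> sets borel" and T: "orthogonal_transformation T"
  shows "emeasure (hyperplane_measure e) (T -` A) = emeasure (hyperplane_measure (T e)) A"
proof -
  have lin: "linear T" using T by (rule orthogonal_transformation_linear)
  then have "T \<in> borel_measurable borel"
    by (intro borel_measurable_continuous_onI linear_continuous_on linear_conv_bounded_linear[THEN iffD1])
  then have "T -` A \<in> sets borel" by (rule measurable_sets_borel[OF _ A])
  moreover have "A \<inter> {x. T e \<bullet> x = 0} = T ` (T -` A \<inter> {x. e \<bullet> x = 0})"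
  proof -
    have "x \<in> T ` (T -` A \<inter> {x. e \<bullet> x = 0})" if "x \<in> A" "T e \<bullet> x = 0" for x
    proof -
      obtain y where "x = T y" using orthogonal_transformation_surj[OF T] unfolding surj_def by metis
      then show ?thesis using that T by (auto simp: orthogonal_transformation_def)
    qed
    then show ?thesis using T by (auto simp: orthogonal_transformation_def)
  qed
  moreover have "hausdorff_outer k (T ` B) = hausdorff_outer k B" for k B
    using T by (intro hausdorff_outer_isometry orthogonal_transformation_surj)
      (simp_all add: orthogonal_transformation_isometry)
  ultimately show ?thesis using A by (simp add: emeasure_hyperplane_measure)
qed

text \<open>
  A rotation takes the hyperplane to a coordinate hyperplane, where covers by boxes have been estimated.
\<close>

lemma hyperplane_measure_ball:
  fixes e :: "real ^ 'n"
  assumes e: "norm e = 1"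
  shows "emeasure (hyperplane_measure e) (ball 0 r) < \<infinity>"
    and "CARD('n) \<ge> 2 \<Longrightarrow> r > 0 \<Longrightarrow> emeasure (hyperplane_measure e) (ball 0 r) > 0"
proof -
  obtain i :: 'n where True by blast
  define a :: "real ^ 'n" where "a = axis i 1"
  have "norm a = 1" by (simp add: a_def)
  then obtain T where T: "orthogonal_transformation T" "T a = e"
    using orthogonal_transformation_exists_1 e by metis
  have "emeasure (hyperplane_measure e) (ball 0 r) = emeasure (hyperplane_measure a) (ball 0 r)"
    using hyperplane_measure_rotation[OF _ T(1), of "ball 0 r" a]
    by (simp add: T(2) orthogonal_image_vimage_ball[OF T(1)])
  also have "\<dots> = hausdorff_outer (CARD('n) - 1) {x :: real ^ 'n. x $ i = 0 \<and> norm x < r}"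
    by (simp add: emeasure_hyperplane_measure a_def inner_axis' Int_def conj_commute)
  finally have eq: "emeasure (hyperplane_measure e) (ball 0 r)
      = hausdorff_outer (CARD('n) - 1) {x :: real ^ 'n. x $ i = 0 \<and> norm x < r}" .
  obtain R :: nat where R: "r \<le> real R" using real_arch_simple by blast
  have "{x :: real ^ 'n. x $ i = 0 \<and> norm x < r} \<subseteq> {x. x $ i = 0 \<and> (\<forall>j. \<bar>x $ j\<bar> \<le> real R)}"
  proof
    fix x :: "real ^ 'n" assume x: "x \<in> {x. x $ i = 0 \<and> norm x < r}"
    have "\<bar>x $ j\<bar> \<le> real R" for j
      using component_le_norm_cart[of x j] x R by simp
    then show "x \<in> {x. x $ i = 0 \<and> (\<forall>j. \<bar>x $ j\<bar> \<le> real R)}" using x by simp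
  qed
  from order_le_less_trans[OF hausdorff_outer_mono[OF this] hausdorff_outer_coordinate_box_finite[OF refl]]
  show "emeasure (hyperplane_measure e) (ball 0 r) < \<infinity>" unfolding eq .
  show "emeasure (hyperplane_measure e) (ball 0 r) > 0" if "CARD('n) \<ge> 2" "r > 0"
    unfolding eq using that by (intro hausdorff_outer_coordinate_ball_pos) auto
qed

lemma sigma_finite_hyperplane_measure: "norm e = 1 \<Longrightarrow> sigma_finite_measure (hyperplane_measure e)"
  by (intro sigma_finite_if_finite_on_balls hyperplane_measure_ball) auto

lemma borel_measurable_hyperplane_slices:
  fixes e :: "real ^ 'n"
  assumes e: "norm e = 1" and A: "A \<in> sets borel"
  shows "(\<lambda>t. emeasure (hyperplane_measure e) ((\<lambda>y. y + t *\<^sub>R e) -` A)) \<in> borel_measurable lborel"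
proof -
  interpret sigma_finite_measure "hyperplane_measure e" by (rule sigma_finite_hyperplane_measure[OF e])
  interpret pair_sigma_finite "hyperplane_measure e" lborel ..
  let ?F = "(\<lambda>(y, t). y + t *\<^sub>R e) :: (real ^ 'n) \<times> real \<Rightarrow> real ^ 'n"
  have m: "?F \<in> hyperplane_measure e \<Otimes>\<^sub>M lborel \<rightarrow>\<^sub>M borel" by measurable
  have "(\<lambda>t. emeasure (hyperplane_measure e) ((\<lambda>y. (y, t)) -` (?F -` A \<inter> space (hyperplane_measure e \<Otimes>\<^sub>M lborel)))) \<in> borel_measurable lborel"
    by (rule measurable_emeasure_Pair2) (rule measurable_sets[OF m A])
  moreover have "(\<lambda>y. (y, t)) -` (?F -` A \<inter> space (hyperplane_measure e \<Otimes>\<^sub>M lborel)) = (\<lambda>y. y + t *\<^sub>R e) -` A" for t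
    by (auto simp: space_pair_measure)
  ultimately show ?thesis by simp
qed

lemma emeasure_slice_measure:
  fixes e :: "real ^ 'n"
  assumes e: "norm e = 1" and A: "A \<in> sets borel"
  shows "emeasure (slice_measure e) A = (\<integral>\<^sup>+t. emeasure (hyperplane_measure e) ((\<lambda>y. y + t *\<^sub>R e) -` A) \<partial>lborel)"
proof -
  interpret sigma_finite_measure "hyperplane_measure e" by (rule sigma_finite_hyperplane_measure[OF e])
  interpret pair_sigma_finite "hyperplane_measure e" lborel ..
  let ?F = "(\<lambda>(y, t). y + t *\<^sub>R e) :: (real ^ 'n) \<times> real \<Rightarrow> real ^ 'n"
  have m: "?F \<in> hyperplane_measure e \<Otimes>\<^sub>M lborel \<rightarrow>\<^sub>M borel" by measurable
  have "emeasure (slice_measure e) A = emeasure (hyperplane_measure e \<Otimes>\<^sub>M lborel) (?F -` A \<inter> space (hyperplane_measure e \<Otimes>\<^sub>M lborel))"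
    unfolding slice_measure_def by (rule emeasure_distr[OF m A])
  also have "\<dots> = (\<integral>\<^sup>+t. emeasure (hyperplane_measure e) ((\<lambda>y. (y, t)) -` (?F -` A \<inter> space (hyperplane_measure e \<Otimes>\<^sub>M lborel))) \<partial>lborel)"
    by (rule emeasure_pair_measure_alt2) (rule measurable_sets[OF m A])
  also have "\<dots> = (\<integral>\<^sup>+t. emeasure (hyperplane_measure e) ((\<lambda>y. y + t *\<^sub>R e) -` A) \<partial>lborel)"
    by (intro nn_integral_cong arg_cong2[where f=emeasure]) (auto simp: space_pair_measure)
  finally show ?thesis .
qed

text \<open>
  A translation splits into a part along \<open>e\<close>, absorbed by the integration over \<open>t\<close>, and a part orthogonal to
  \<open>e\<close>, absorbed by the invariance of the measure on the hyperplane.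
\<close>

lemma slice_measure_translation:
  fixes e :: "real ^ 'n"
  assumes e: "norm e = 1" and A: "A \<in> sets borel"
  shows "emeasure (slice_measure e) ((\<lambda>x. x + v) -` A) = emeasure (slice_measure e) A"
proof -
  interpret sigma_finite_measure "hyperplane_measure e" by (rule sigma_finite_hyperplane_measure[OF e])
  interpret pair_sigma_finite "hyperplane_measure e" lborel ..
  define s where "s = e \<bullet> v"
  define w where "w = v - s *\<^sub>R e"
  have ew: "e \<bullet> w = 0" using e by (simp add: w_def s_def inner_diff_right dot_square_norm)
  define h where "h = (\<lambda>t. emeasure (hyperplane_measure e) ((\<lambda>y. y + t *\<^sub>R e) -` A))"
  have vm: "(\<lambda>x. x + u) -` A \<in> sets borel" for u by (rule measurable_sets_borel[OF _ A]) measurable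
  have [measurable]: "h \<in> borel_measurable borel"
    unfolding h_def using borel_measurable_hyperplane_slices[OF e A] by simp
  have "emeasure (slice_measure e) ((\<lambda>x. x + v) -` A)
      = (\<integral>\<^sup>+t. emeasure (hyperplane_measure e) ((\<lambda>y. y + t *\<^sub>R e) -` (\<lambda>x. x + v) -` A) \<partial>lborel)"
    by (rule emeasure_slice_measure[OF e vm])
  also have "\<dots> = (\<integral>\<^sup>+t. h (s + t) \<partial>lborel)"
  proof (rule nn_integral_cong)
    fix t :: real
    have "(\<lambda>y. y + t *\<^sub>R e) -` (\<lambda>x. x + v) -` A = (\<lambda>y. y + w) -` ((\<lambda>y. y + (s + t) *\<^sub>R e) -` A)"
      by (auto simp: w_def algebra_simps)
    then show "emeasure (hyperplane_measure e) ((\<lambda>y. y + t *\<^sub>R e) -` (\<lambda>x. x + v) -` A) = h (s + t)"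
      using hyperplane_measure_translation[OF vm ew] by (simp add: h_def)
  qed
  also have "\<dots> = (\<integral>\<^sup>+t. h t \<partial>lborel)"
    by (subst (2) lborel_distr_plus[of s, symmetric], subst nn_integral_distr) auto
  also have "\<dots> = emeasure (slice_measure e) A"
    unfolding h_def by (rule emeasure_slice_measure[OF e A, symmetric])
  finally show ?thesis .
qed

lemma slice_measure_ball:
  fixes e :: "real ^ 'n"
  assumes e: "norm e = 1"
  shows "emeasure (slice_measure e) (ball 0 r) < \<infinity>"
    and "CARD('n) \<ge> 2 \<Longrightarrow> r > 0 \<Longrightarrow> emeasure (slice_measure e) (ball 0 r) > 0"
proof -
  define Q where "Q = (\<lambda>t. (\<lambda>y. y + t *\<^sub>R e) -` ball 0 r \<inter> {x. e \<bullet> x = 0})"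
  have Qm: "(\<lambda>y. y + t *\<^sub>R e) -` ball 0 r \<in> sets borel" for t
    by (intro borel_vimage_translation borel_open open_ball)
  have eQ: "emeasure (hyperplane_measure e) ((\<lambda>y. y + t *\<^sub>R e) -` ball 0 r) = hausdorff_outer (CARD('n) - 1) (Q t)" for t
    using Qm by (simp add: emeasure_hyperplane_measure Q_def)
  have eB: "emeasure (hyperplane_measure e) (ball 0 s) = hausdorff_outer (CARD('n) - 1) (ball 0 s \<inter> {x. e \<bullet> x = 0})" for s
    by (simp add: emeasure_hyperplane_measure)
  have pyth: "(norm (y + t *\<^sub>R e))\<^sup>2 = (norm y)\<^sup>2 + t\<^sup>2" if "e \<bullet> y = 0" for y t
  proof -
    have "(norm (y + t *\<^sub>R e))\<^sup>2 = (norm y)\<^sup>2 + (norm (t *\<^sub>R e))\<^sup>2"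
      using that by (intro norm_add_Pythagorean) (simp add: orthogonal_def inner_commute)
    then show ?thesis using e by simp
  qed
  have up: "Q t \<subseteq> ball 0 r \<inter> {x. e \<bullet> x = 0}" "t \<notin> {-r..r} \<Longrightarrow> Q t = {}" for t
  proof -
    have "norm y < r \<and> \<bar>t\<bar> < r" if "norm (y + t *\<^sub>R e) < r" "e \<bullet> y = 0" for y
    proof -
      have "(norm y)\<^sup>2 + t\<^sup>2 < r\<^sup>2"
        using that pyth[OF that(2), of t] norm_ge_zero by (metis power_strict_mono zero_less_numeral)
      then have "(norm y)\<^sup>2 < r\<^sup>2" "\<bar>t\<bar>\<^sup>2 < r\<^sup>2"
        using zero_le_power2[of "norm y"] zero_le_power2[of t] unfolding power2_abs by linarith+
      moreover have "r \<ge> 0" using that(1) norm_ge_zero[of "y + t *\<^sub>R e"] by linarith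
      ultimately show ?thesis using power2_less_imp_less by blast
    qed
    then show "Q t \<subseteq> ball 0 r \<inter> {x. e \<bullet> x = 0}" "t \<notin> {-r..r} \<Longrightarrow> Q t = {}"
      by (fastforce simp: Q_def)+
  qed
  have "emeasure (slice_measure e) (ball 0 r) = (\<integral>\<^sup>+t. hausdorff_outer (CARD('n) - 1) (Q t) \<partial>lborel)"
    by (simp add: emeasure_slice_measure[OF e] eQ)
  note eS = this
  have "\<dots> \<le> (\<integral>\<^sup>+t. emeasure (hyperplane_measure e) (ball 0 r) * indicator {-r..r} t \<partial>lborel)"
  proof (rule nn_integral_mono)
    fix t :: real
    show "hausdorff_outer (CARD('n) - 1) (Q t) \<le> emeasure (hyperplane_measure e) (ball 0 r) * indicator {-r..r} t"
      using hausdorff_outer_mono[OF up(1), of "CARD('n) - 1" t] up(2)[of t]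
      by (cases "t \<in> {-r..r}") (auto simp: eB hausdorff_outer_empty)
  qed
  also have "\<dots> = emeasure (hyperplane_measure e) (ball 0 r) * emeasure lborel {-r..r}"
    by (rule nn_integral_cmult_indicator) simp
  also have "\<dots> < \<infinity>"
    using hyperplane_measure_ball(1)[OF e] emeasure_bounded_finite[of "{-r..r}"] by (simp add: ennreal_mult_less_top)
  finally show "emeasure (slice_measure e) (ball 0 r) < \<infinity>" using eS by simp
  show "emeasure (slice_measure e) (ball 0 r) > 0" if n: "CARD('n) \<ge> 2" and r: "r > 0"
  proof -
    have low: "ball 0 (r / 2) \<inter> {x. e \<bullet> x = 0} \<subseteq> Q t" if "t \<in> {0..r/2}" for t
    proof
      fix y assume y: "y \<in> ball 0 (r / 2) \<inter> {x. e \<bullet> x = 0}"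
      have "norm (y + t *\<^sub>R e) \<le> norm y + \<bar>t\<bar>" using norm_triangle_ineq[of y "t *\<^sub>R e"] e by simp
      also have "\<dots> < r" using y that by auto
      finally show "y \<in> Q t" using y by (simp add: Q_def)
    qed
    have "0 < emeasure (hyperplane_measure e) (ball 0 (r/2)) * emeasure lborel {0..r/2}"
      using hyperplane_measure_ball(2)[OF e n, of "r/2"] r by (simp add: ennreal_zero_less_mult_iff)
    also have "\<dots> = (\<integral>\<^sup>+t. emeasure (hyperplane_measure e) (ball 0 (r/2)) * indicator {0..r/2} t \<partial>lborel)"
      by (rule nn_integral_cmult_indicator[symmetric]) simp
    also have "\<dots> \<le> (\<integral>\<^sup>+t. hausdorff_outer (CARD('n) - 1) (Q t) \<partial>lborel)"
    proof (rule nn_integral_mono)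
      fix t :: real
      show "emeasure (hyperplane_measure e) (ball 0 (r/2)) * indicator {0..r/2} t \<le> hausdorff_outer (CARD('n) - 1) (Q t)"
        using hausdorff_outer_mono[OF low, of t "CARD('n) - 1"]
        by (cases "t \<in> {0..r/2}") (auto simp: eB)
    qed
    finally show ?thesis using eS by simp
  qed
qed

lemma slice_measure_rotation:
  fixes T :: "real ^ 'n \<Rightarrow> real ^ 'n"
  assumes T: "orthogonal_transformation T" and e: "norm e = 1"
  shows "emeasure (slice_measure (T e)) (ball 0 r) = emeasure (slice_measure e) (ball 0 r)"
proof -
  have lin: "linear T" using T by (rule orthogonal_transformation_linear)
  have nT: "norm (T x) = norm x" for x using T by (simp add: orthogonal_transformation_norm)
  have B: "(\<lambda>y. y + u) -` ball 0 r \<in> sets borel" for u :: "real ^ 'n"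
    by (intro borel_vimage_translation borel_open open_ball)
  have "emeasure (hyperplane_measure (T e)) ((\<lambda>y. y + t *\<^sub>R T e) -` ball 0 r)
      = emeasure (hyperplane_measure e) ((\<lambda>y. y + t *\<^sub>R e) -` ball 0 r)" for t
  proof -
    have "T -` ((\<lambda>y. y + t *\<^sub>R T e) -` ball 0 r) = (\<lambda>y. y + t *\<^sub>R e) -` ball 0 r"
      by (auto simp: linear_add[OF lin, symmetric] linear_scale[OF lin, symmetric] nT)
    then show ?thesis using hyperplane_measure_rotation[OF B T, of e "t *\<^sub>R T e"] by simp
  qed
  then show ?thesis using e nT by (simp add: emeasure_slice_measure)
qed

text \<open>
  The slice measures are translation invariant, hence proportional to Lebesgue measure. Rotations map the
  slice measures of different directions to each other and preserve the unit ball, so the factor is common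
  to all directions.
\<close>

theorem slice_measure_eq_lborel:
  assumes n: "CARD('n) \<ge> 2"
  obtains \<kappa> :: real where "\<kappa> > 0"
    "\<And>e :: real ^ 'n. norm e = 1 \<Longrightarrow> slice_measure e = density lborel (\<lambda>_. ennreal \<kappa>)"
proof -
  obtain i :: 'n where True by blast
  define a :: "real ^ 'n" where "a = axis i 1"
  have a: "norm a = 1" by (simp add: a_def)
  define \<kappa> where "\<kappa> = measure (slice_measure a) (ball 0 1) / measure lborel (ball (0 :: real ^ 'n) 1)"
  have "measure (slice_measure a) (ball 0 1) > 0"
    using slice_measure_ball[OF a, of 1] n by (simp add: measure_def enn2real_positive_iff)
  then have "\<kappa> > 0" by (simp add: \<kappa>_def content_ball unit_ball_vol_pos)
  moreover have "slice_measure e = density lborel (\<lambda>_. ennreal \<kappa>)" if e: "norm e = 1" for e :: "real ^ 'n"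
  proof -
    obtain T where T: "orthogonal_transformation T" "T a = e"
      using orthogonal_transformation_exists_1 a e by metis
    have "measure (slice_measure e) (ball 0 1) = measure (slice_measure a) (ball 0 1)"
      using slice_measure_rotation[OF T(1) a, of 1] by (simp add: measure_def T(2))
    then show ?thesis
      using translation_invariant_measure_eq_lborel[of "slice_measure e"]
        slice_measure_ball(1)[OF e] slice_measure_translation[OF e]
      by (simp add: \<kappa>_def)
  qed
  ultimately show ?thesis by (rule that)
qed

section \<open>Integrals over hyperplane sections\<close>

lemma hausdorff_integral_translation:
  fixes h :: "'a::euclidean_space \<Rightarrow> real"
  assumes [measurable]: "h \<in> borel_measurable borel"
  shows "(\<integral>x. h (x + v) \<partial>hausdorff_measure k) = (\<integral>x. h x \<partial>hausdorff_measure k)"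
proof -
  note [measurable] = id_measurable_hausdorff
  define B :: "'a measure" where "B = distr (hausdorff_measure k) borel (\<lambda>x. x)"
  have sB [simp, measurable_cong]: "sets B = sets borel" and [simp]: "space B = UNIV" by (simp_all add: B_def)
  have eB: "emeasure B A = hausdorff_outer k A" if "A \<in> sets borel" for A
    using that by (simp add: B_def emeasure_distr emeasure_hausdorff_borel)
  have "distr B borel (\<lambda>x. x + v) = B"
  proof (rule measure_eqI)
    fix A assume "A \<in> sets (distr B borel (\<lambda>x. x + v))"
    then have A: "A \<in> sets borel" by simp
    have "hausdorff_outer k A = hausdorff_outer k ((\<lambda>x. x + v) ` ((\<lambda>x. x + v) -` A))"
      by (intro arg_cong[where f="hausdorff_outer k"]) (auto simp: image_iff intro!: bexI[of _ "_ - v"])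
    also have "\<dots> = hausdorff_outer k ((\<lambda>x. x + v) -` A)"
      by (rule hausdorff_outer_isometry) (auto intro: surj_plus_right)
    finally have "hausdorff_outer k A = hausdorff_outer k ((\<lambda>x. x + v) -` A)" .
    moreover have "emeasure (distr B borel (\<lambda>x. x + v)) A = emeasure B ((\<lambda>x. x + v) -` A)"
      using A by (subst emeasure_distr) (auto simp: measurable_def borel_vimage_translation)
    ultimately show "emeasure (distr B borel (\<lambda>x. x + v)) A = emeasure B A"
      using A borel_vimage_translation[OF A, of v] by (simp add: eB)
  qed simp
  moreover have "(\<lambda>x. x + v) \<in> B \<rightarrow>\<^sub>M borel" by (auto simp: measurable_def borel_vimage_translation)
  ultimately have "(\<integral>x. h x \<partial>B) = (\<integral>x. h (x + v) \<partial>B)"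
    using integral_distr[of "\<lambda>x. x + v" B borel h] assms by simp
  then show ?thesis by (simp add: B_def integral_distr)
qed

lemma hyperplane_measure_integral:
  fixes h :: "real ^ 'n \<Rightarrow> real"
  assumes e: "norm e = 1" and h[measurable]: "h \<in> borel_measurable borel"
  shows "(\<integral>y. h (y + t *\<^sub>R e) \<partial>hyperplane_measure e)
       = (LINT x:{x. e \<bullet> x = t}|hausdorff_measure (CARD('n) - 1). h x)"
proof -
  note [measurable] = id_measurable_hausdorff
  let ?M = "hausdorff_measure (CARD('n) - 1) :: (real ^ 'n) measure"
  have ee: "e \<bullet> e = 1" using e by (simp add: dot_square_norm)
  have "hyperplane_measure e = density (distr ?M borel (\<lambda>x. x)) (\<lambda>x. ennreal (indicator {x. e \<bullet> x = 0} x))"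
    unfolding hyperplane_measure_def by (simp add: ennreal_indicator)
  then have "(\<integral>y. h (y + t *\<^sub>R e) \<partial>hyperplane_measure e)
      = (\<integral>y. indicator {x. e \<bullet> x = 0} y *\<^sub>R h (y + t *\<^sub>R e) \<partial>distr ?M borel (\<lambda>x. x))"
    by (simp, subst integral_density) (auto simp: AE_I2)
  also have "\<dots> = (\<integral>y. indicator {x. e \<bullet> x = 0} y *\<^sub>R h (y + t *\<^sub>R e) \<partial>?M)"
    by (subst integral_distr) auto
  also have "\<dots> = (\<integral>y. indicator {x. e \<bullet> x = t} (y + t *\<^sub>R e) *\<^sub>R h (y + t *\<^sub>R e) \<partial>?M)"
    by (intro Bochner_Integration.integral_cong) (auto simp: indicator_def inner_add_right ee)
  also have "\<dots> = (\<integral>y. indicator {x. e \<bullet> x = t} y *\<^sub>R h y \<partial>?M)"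
    by (rule hausdorff_integral_translation) measurable
  finally show ?thesis by (simp add: set_lebesgue_integral_def)
qed

lemma integral_hyperplane_sections:
  fixes h :: "real ^ 'n \<Rightarrow> real"
  assumes e: "norm e = 1" and k: "\<kappa> > 0" and slice: "slice_measure e = density lborel (\<lambda>_. ennreal \<kappa>)"
    and h: "integrable lborel h"
  shows "integrable lborel (\<lambda>t. LINT x:{x. e \<bullet> x = t}|hausdorff_measure (CARD('n) - 1). h x)"
    and "(\<integral>t. (LINT x:{x. e \<bullet> x = t}|hausdorff_measure (CARD('n) - 1). h x) \<partial>lborel) = \<kappa> * (\<integral>x. h x \<partial>lborel)"
proof -
  interpret sigma_finite_measure "hyperplane_measure e" by (rule sigma_finite_hyperplane_measure[OF e])
  interpret pair_sigma_finite "hyperplane_measure e" lborel ..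
  have hm[measurable]: "h \<in> borel_measurable borel" using h by auto
  have "integrable (density lborel (\<lambda>_. ennreal \<kappa>)) h"
    using h k by (subst integrable_density) auto
  then have "integrable (slice_measure e) h" by (simp add: slice)
  then have int: "integrable (hyperplane_measure e \<Otimes>\<^sub>M lborel) (\<lambda>(y, t). h (y + t *\<^sub>R e))"
    unfolding slice_measure_def by (subst (asm) integrable_distr_eq) (auto simp: split_def)
  have eq: "(\<integral>y. h (y + t *\<^sub>R e) \<partial>hyperplane_measure e) = (LINT x:{x. e \<bullet> x = t}|hausdorff_measure (CARD('n) - 1). h x)" for t
    by (rule hyperplane_measure_integral[OF e hm])
  show "integrable lborel (\<lambda>t. LINT x:{x. e \<bullet> x = t}|hausdorff_measure (CARD('n) - 1). h x)"
    using integrable_snd[OF int] by (simp add: eq)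
  have "(\<integral>t. (LINT x:{x. e \<bullet> x = t}|hausdorff_measure (CARD('n) - 1). h x) \<partial>lborel)
      = (\<integral>p. (case p of (y, t) \<Rightarrow> h (y + t *\<^sub>R e)) \<partial>(hyperplane_measure e \<Otimes>\<^sub>M lborel))"
    using integral_snd[OF int] by (simp add: eq)
  also have "\<dots> = (\<integral>x. h x \<partial>slice_measure e)"
    unfolding slice_measure_def by (subst integral_distr) (auto simp: split_def)
  also have "\<dots> = (\<integral>x. \<kappa> *\<^sub>R h x \<partial>lborel)"
    unfolding slice using k by (subst integral_density) auto
  finally show "(\<integral>t. (LINT x:{x. e \<bullet> x = t}|hausdorff_measure (CARD('n) - 1). h x) \<partial>lborel) = \<kappa> * (\<integral>x. h x \<partial>lborel)"
    by simp
qed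

text \<open>
  Integrands that agree almost everywhere in space agree almost everywhere on almost all hyperplanes of a
  parallel family. This allows an integrable function to be replaced by a Borel representative.
\<close>

lemma AE_hyperplane_section_null:
  fixes N :: "(real ^ 'n) set"
  assumes e: "norm e = 1" and slice: "slice_measure e = density lborel (\<lambda>_. ennreal \<kappa>)"
    and N: "N \<in> null_sets lborel"
  shows "AE t in lborel. N \<inter> {x. e \<bullet> x = t} \<in> null_sets (hausdorff_measure (CARD('n) - 1))"
proof -
  interpret sigma_finite_measure "hyperplane_measure e" by (rule sigma_finite_hyperplane_measure[OF e])
  interpret pair_sigma_finite "hyperplane_measure e" lborel ..
  have ee: "e \<bullet> e = 1" using e by (simp add: dot_square_norm)
  have Nb: "N \<in> sets borel" and N0: "emeasure lborel N = 0" using N by (auto simp: null_sets_def)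
  let ?h = "\<lambda>t. emeasure (hyperplane_measure e) ((\<lambda>y. y + t *\<^sub>R e) -` N)"
  have hm: "?h \<in> borel_measurable lborel" by (rule borel_measurable_hyperplane_slices[OF e Nb])
  have "(\<integral>\<^sup>+t. ?h t \<partial>lborel) = emeasure (slice_measure e) N"
    by (rule emeasure_slice_measure[OF e Nb, symmetric])
  also have "\<dots> = 0" using Nb N0 by (simp add: slice emeasure_density_const)
  finally have "AE t in lborel. ?h t = 0" using hm by (subst (asm) nn_integral_0_iff_AE) auto
  moreover have "N \<inter> {x. e \<bullet> x = t} \<in> null_sets (hausdorff_measure (CARD('n) - 1))" if "?h t = 0" for t
  proof -
    have "N \<inter> {x. e \<bullet> x = t} = (\<lambda>y. y + t *\<^sub>R e) ` ((\<lambda>y. y + t *\<^sub>R e) -` N \<inter> {x. e \<bullet> x = 0})"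
      by (auto simp: image_iff inner_add_right inner_diff_right ee intro!: bexI[of _ "_ - t *\<^sub>R e"])
    then have "hausdorff_outer (CARD('n) - 1) (N \<inter> {x. e \<bullet> x = t})
        = hausdorff_outer (CARD('n) - 1) ((\<lambda>y. y + t *\<^sub>R e) ` ((\<lambda>y. y + t *\<^sub>R e) -` N \<inter> {x. e \<bullet> x = 0}))" by simp
    also have "\<dots> = hausdorff_outer (CARD('n) - 1) ((\<lambda>y. y + t *\<^sub>R e) -` N \<inter> {x. e \<bullet> x = 0})"
      by (rule hausdorff_outer_isometry) (auto intro: surj_plus_right)
    also have "\<dots> = 0"
      using that borel_vimage_translation[OF Nb] by (simp add: emeasure_hyperplane_measure)
    finally have 0: "hausdorff_outer (CARD('n) - 1) (N \<inter> {x. e \<bullet> x = t}) = 0" .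
    have b: "N \<inter> {x. e \<bullet> x = t} \<in> sets borel" using Nb by (rule sets.Int) (intro borel_closed closed_hyperplane)
    with 0 borel_sets_hausdorff show ?thesis by (auto simp: null_sets_def emeasure_hausdorff_borel)
  qed
  ultimately show ?thesis by (rule eventually_mono)
qed

text \<open>
  The prescribed integrals concern sections of positive measure only; by openness these are all the
  nonempty sections.
\<close>

lemma hyperplane_section_pos:
  fixes \<Omega> :: "(real ^ 'n) set"
  assumes n: "CARD('n) \<ge> 2" and e: "norm e = 1" and op: "open \<Omega>" and x: "x \<in> \<Omega>" "e \<bullet> x = t"
  shows "emeasure (hausdorff_measure (CARD('n) - 1)) (\<Omega> \<inter> {x. e \<bullet> x = t}) > 0"
proof -
  obtain \<rho> where \<rho>: "\<rho> > 0" "ball x \<rho> \<subseteq> \<Omega>" using op x openE by blast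
  have "0 < emeasure (hyperplane_measure e) (ball 0 \<rho>)" by (rule hyperplane_measure_ball(2)[OF e n \<rho>(1)])
  also have "\<dots> = hausdorff_outer (CARD('n) - 1) (ball 0 \<rho> \<inter> {x. e \<bullet> x = 0})" by (simp add: emeasure_hyperplane_measure)
  also have "\<dots> = hausdorff_outer (CARD('n) - 1) ((\<lambda>y. y + x) ` (ball 0 \<rho> \<inter> {x. e \<bullet> x = 0}))"
    by (rule hausdorff_outer_isometry[symmetric]) (auto intro: surj_plus_right)
  also have "\<dots> \<le> hausdorff_outer (CARD('n) - 1) (\<Omega> \<inter> {x. e \<bullet> x = t})"
    using \<rho> x by (intro hausdorff_outer_mono) (auto simp: inner_add_right dist_norm intro!: subsetD[OF \<rho>(2)])
  also have "\<dots> = emeasure (hausdorff_measure (CARD('n) - 1)) (\<Omega> \<inter> {x. e \<bullet> x = t})"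
    using op by (intro emeasure_hausdorff_borel[symmetric] sets.Int) measurable
  finally show ?thesis .
qed

lemma setdist_parallel_hyperplanes:
  fixes e :: "'a::euclidean_space"
  assumes e: "norm e = 1"
  shows "setdist {x. e \<bullet> x = s} {x. e \<bullet> x = t} = \<bar>s - t\<bar>"
proof (rule order_antisym)
  have ee: "e \<bullet> e = 1" using e by (simp add: dot_square_norm)
  have "setdist {x. e \<bullet> x = s} {x. e \<bullet> x = t} \<le> dist (s *\<^sub>R e) (t *\<^sub>R e)"
    by (rule setdist_le_dist) (simp_all add: ee)
  also have "\<dots> = \<bar>s - t\<bar>" using e by (simp add: dist_norm flip: scaleR_diff_left)
  finally show "setdist {x. e \<bullet> x = s} {x. e \<bullet> x = t} \<le> \<bar>s - t\<bar>" .
  have "s *\<^sub>R e \<in> {x. e \<bullet> x = s}" "t *\<^sub>R e \<in> {x. e \<bullet> x = t}" by (simp_all add: ee)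
  then show "\<bar>s - t\<bar> \<le> setdist {x. e \<bullet> x = s} {x. e \<bullet> x = t}"
  proof (intro le_setdistI)
    fix x y assume "x \<in> {x. e \<bullet> x = s}" "y \<in> {x. e \<bullet> x = t}"
    then have "\<bar>s - t\<bar> = \<bar>e \<bullet> (x - y)\<bar>" by (simp add: inner_diff_right)
    also have "\<dots> \<le> dist x y" using Cauchy_Schwarz_ineq2[of e "x - y"] e by (simp add: dist_norm)
    finally show "\<bar>s - t\<bar> \<le> dist x y" .
  qed blast+
qed

lemma parallel_hyperplanes:
  fixes e :: "'a::euclidean_space"
  assumes e: "norm e = 1"
  shows "affine_parallel {x. e \<bullet> x = s} {x. e \<bullet> x = t}"
  unfolding affine_parallel_def
proof (rule exI)
  have ee: "e \<bullet> e = 1" using e by (simp add: dot_square_norm)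
  show "{x. e \<bullet> x = t} = (+) ((t - s) *\<^sub>R e) ` {x. e \<bullet> x = s}"
  proof (intro equalityI subsetI)
    fix x assume "x \<in> {x. e \<bullet> x = t}"
    then have "x - (t - s) *\<^sub>R e \<in> {x. e \<bullet> x = s}" by (simp add: inner_diff_right ee)
    then show "x \<in> (+) ((t - s) *\<^sub>R e) ` {x. e \<bullet> x = s}" by (rule rev_image_eqI) simp
  qed (auto simp: inner_add_right ee)
qed

text \<open>
  The upper end of the shadow of \<open>\<Omega>\<close> on the line in direction \<open>e\<close>; as a function of \<open>e\<close> it is the support
  function of \<open>\<Omega>\<close>.
\<close>

definition shadow_sup :: "'a::euclidean_space set \<Rightarrow> 'a \<Rightarrow> real" where
  "shadow_sup \<Omega> e = Sup ((\<bullet>) e ` \<Omega>)"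

definition shadow_inf :: "'a::euclidean_space set \<Rightarrow> 'a \<Rightarrow> real" where
  "shadow_inf \<Omega> e = Inf ((\<bullet>) e ` \<Omega>)"

lemma shadow_uminus: "shadow_sup \<Omega> (- e) = - shadow_inf \<Omega> e"
proof -
  have "(\<bullet>) (- e) ` \<Omega> = uminus ` ((\<bullet>) e ` \<Omega>)" by (auto simp: image_image)
  then show ?thesis by (simp add: shadow_sup_def shadow_inf_def Inf_real_def image_image)
qed

lemma shadow_attained:
  fixes \<Omega> :: "'a::euclidean_space set"
  assumes "\<Omega> \<noteq> {}" "bounded \<Omega>"
  shows "\<exists>x\<in>closure \<Omega>. e \<bullet> x = shadow_sup \<Omega> e" "\<And>x. x \<in> \<Omega> \<Longrightarrow> e \<bullet> x \<le> shadow_sup \<Omega> e"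
proof -
  have bdd: "bdd_above ((\<bullet>) e ` \<Omega>)"
    by (rule bounded_imp_bdd_above[OF bounded_linear_image[OF assms(2) bounded_linear_inner_right]])
  show le: "e \<bullet> x \<le> shadow_sup \<Omega> e" if "x \<in> \<Omega>" for x
    unfolding shadow_sup_def using that by (intro cSup_upper bdd) auto
  have "compact (closure \<Omega>)" using assms by (simp add: compact_closure)
  moreover have "continuous_on (closure \<Omega>) ((\<bullet>) e)" by (intro continuous_intros)
  moreover have "closure \<Omega> \<noteq> {}" using assms(1) by simp
  ultimately have "\<exists>x\<in>closure \<Omega>. \<forall>y\<in>closure \<Omega>. e \<bullet> y \<le> e \<bullet> x"
    by (intro continuous_attains_sup)
  then obtain x where x: "x \<in> closure \<Omega>" "\<And>y. y \<in> closure \<Omega> \<Longrightarrow> e \<bullet> y \<le> e \<bullet> x"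
    by blast
  have "shadow_sup \<Omega> e \<le> e \<bullet> x"
    unfolding shadow_sup_def using assms x(2) closure_subset by (intro cSup_least) auto
  moreover have "closure \<Omega> \<subseteq> {x. e \<bullet> x \<le> shadow_sup \<Omega> e}"
    using le by (intro closure_minimal closed_halfspace_le) auto
  ultimately show "\<exists>x\<in>closure \<Omega>. e \<bullet> x = shadow_sup \<Omega> e" using x(1) by (intro bexI[of _ x]) auto
qed

lemma supporting_hyperplane_shadow:
  fixes \<Omega> :: "(real ^ 'n) set"
  assumes "\<Omega> \<noteq> {}" "bounded \<Omega>" "norm e = 1"
  shows "supporting_hyperplane \<Omega> {x. e \<bullet> x = shadow_sup \<Omega> e}"
proof -
  have "e \<noteq> 0" using assms by auto
  moreover have "closure \<Omega> \<inter> {x. e \<bullet> x = shadow_sup \<Omega> e} \<noteq> {}"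
    using shadow_attained(1)[OF assms(1,2), of e] by auto
  moreover have "\<Omega> \<subseteq> {x. e \<bullet> x \<le> shadow_sup \<Omega> e}"
    using shadow_attained(2)[OF assms(1,2), of _ e] by auto
  ultimately show ?thesis
    unfolding supporting_hyperplane_def by (intro exI[of _ e] exI[of _ "shadow_sup \<Omega> e"] conjI) auto
qed

lemma shadow_open_strict:
  fixes \<Omega> :: "'a::euclidean_space set"
  assumes \<Omega>: "open \<Omega>" "bounded \<Omega>" and e: "norm e = 1" and x: "x \<in> \<Omega>"
  shows "e \<bullet> x < shadow_sup \<Omega> e"
proof -
  have ee: "e \<bullet> e = 1" using e by (simp add: dot_square_norm)
  obtain \<rho> where \<rho>: "\<rho> > 0" "cball x \<rho> \<subseteq> \<Omega>" using \<Omega>(1) x unfolding open_contains_cball by blast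
  have "x + \<rho> *\<^sub>R e \<in> \<Omega>" using \<rho>(1) e by (intro subsetD[OF \<rho>(2)]) (simp add: dist_norm)
  then have "e \<bullet> (x + \<rho> *\<^sub>R e) \<le> shadow_sup \<Omega> e" using \<Omega>(2) by (intro shadow_attained(2)) auto
  then show ?thesis using \<rho> by (simp add: inner_add_right ee)
qed

lemma shadow_connected:
  fixes \<Omega> :: "'a::euclidean_space set"
  assumes ne: "\<Omega> \<noteq> {}" and "connected \<Omega>" and t: "shadow_inf \<Omega> e < t" "t < shadow_sup \<Omega> e"
  shows "\<exists>x\<in>\<Omega>. e \<bullet> x = t"
proof -
  have "connected ((\<bullet>) e ` \<Omega>)" using assms by (intro connected_continuous_image continuous_intros)
  moreover obtain a where "a \<in> (\<bullet>) e ` \<Omega>" "t < a"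
    using t(2) less_cSupE ne unfolding shadow_sup_def by (metis image_is_empty)
  moreover obtain b where "b \<in> (\<bullet>) e ` \<Omega>" "b < t"
    using t(1) cInf_lessD ne unfolding shadow_inf_def by (metis image_is_empty)
  ultimately have "t \<in> (\<bullet>) e ` \<Omega>" unfolding connected_iff_interval by (meson less_imp_le)
  then show ?thesis by auto
qed

text \<open>
  Strictly between the two ends of the shadow every section is nonempty and thus of positive measure, and the
  hyperplanes through the ends are the two supporting hyperplanes of that direction.
\<close>

lemma section_integral:
  fixes \<Omega> :: "(real ^ 'n) set"
  assumes n: "CARD('n) \<ge> 2"
    and \<Omega>: "\<Omega> \<noteq> {}" "open \<Omega>" "connected \<Omega>" "bounded \<Omega>"
    and f: "hyperplane_integrals \<Omega> G f" and e: "norm e = 1"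
    and t: "shadow_inf \<Omega> e < t" "t < shadow_sup \<Omega> e"
  shows "set_integrable (hausdorff_measure (CARD('n) - 1)) (\<Omega> \<inter> {x. e \<bullet> x = t}) f"
    and "(LINT x:\<Omega> \<inter> {x. e \<bullet> x = t}|hausdorff_measure (CARD('n) - 1). f x)
        = G (min (shadow_sup \<Omega> e - t) (t - shadow_inf \<Omega> e))"
proof -
  let ?u = "shadow_sup \<Omega> e" and ?l = "shadow_inf \<Omega> e"
  have e0: "e \<noteq> 0" using e by auto
  obtain x where x: "x \<in> \<Omega>" "e \<bullet> x = t" using shadow_connected[OF \<Omega>(1,3) t] by blast
  have "{x. e \<bullet> x = ?l} = {x. (- e) \<bullet> x = shadow_sup \<Omega> (- e)}" by (simp add: shadow_uminus)
  then have sl: "supporting_hyperplane \<Omega> {x. e \<bullet> x = ?l}"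
    using supporting_hyperplane_shadow[OF \<Omega>(1,4), of "- e"] e by simp
  have ne: "{x. e \<bullet> x = ?u} \<noteq> {x. e \<bullet> x = ?l}"
  proof
    assume "{x. e \<bullet> x = ?u} = {x. e \<bullet> x = ?l}"
    moreover have "?u *\<^sub>R e \<in> {x. e \<bullet> x = ?u}" using e by (simp add: dot_square_norm)
    ultimately have "e \<bullet> (?u *\<^sub>R e) = ?l" by blast
    then show False using t e by (simp add: dot_square_norm)
  qed
  have "hyperplane {x. e \<bullet> x = t}" using e0 unfolding hyperplane_def by blast
  then have "set_integrable (hausdorff_measure (CARD('n) - 1)) (\<Omega> \<inter> {x. e \<bullet> x = t}) f \<and>
    (LINT x:\<Omega> \<inter> {x. e \<bullet> x = t}|hausdorff_measure (CARD('n) - 1). f x)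
      = G (min (setdist {x. e \<bullet> x = t} {x. e \<bullet> x = ?u}) (setdist {x. e \<bullet> x = t} {x. e \<bullet> x = ?l}))"
    by (intro f[unfolded hyperplane_integrals_def, rule_format] conjI hyperplane_section_pos[OF n e \<Omega>(2) x]
        supporting_hyperplane_shadow[OF \<Omega>(1,4) e] sl ne parallel_hyperplanes[OF e])
  moreover have "\<bar>t - ?u\<bar> = ?u - t" "\<bar>t - ?l\<bar> = t - ?l" using t by auto
  ultimately show "set_integrable (hausdorff_measure (CARD('n) - 1)) (\<Omega> \<inter> {x. e \<bullet> x = t}) f"
    and "(LINT x:\<Omega> \<inter> {x. e \<bullet> x = t}|hausdorff_measure (CARD('n) - 1). f x) = G (min (?u - t) (t - ?l))"
    unfolding setdist_parallel_hyperplanes[OF e] by simp_all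
qed

section \<open>Plane wave integrals and the profile of the section function\<close>

definition shadow_mid :: "'a::euclidean_space set \<Rightarrow> 'a \<Rightarrow> real" where
  "shadow_mid \<Omega> e = (shadow_sup \<Omega> e + shadow_inf \<Omega> e) / 2"

definition shadow_radius :: "'a::euclidean_space set \<Rightarrow> 'a \<Rightarrow> real" where
  "shadow_radius \<Omega> e = (shadow_sup \<Omega> e - shadow_inf \<Omega> e) / 2"

text \<open>
  The section integral prescribed by \<open>G\<close>, as a function of the signed distance \<open>\<tau>\<close> from the midpoint of a
  shadow of half length \<open>r\<close>.
\<close>

definition section_profile :: "(real \<Rightarrow> real) \<Rightarrow> real \<Rightarrow> real \<Rightarrow> real" where
  "section_profile G r \<tau> = indicator {-r<..<r} \<tau> * G (r - \<bar>\<tau>\<bar>)"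

lemma borel_measurable_lebesgue_AE_eq:
  fixes g h :: "'a::euclidean_space \<Rightarrow> real"
  assumes h: "h \<in> borel_measurable lebesgue" and ae: "AE x in lebesgue. g x = h x"
  shows "g \<in> borel_measurable lebesgue"
proof (rule measurableI)
  fix A :: "real set" assume A: "A \<in> sets borel"
  have "h -` A \<inter> space lebesgue \<in> sets lebesgue" by (rule measurable_sets[OF h A])
  moreover have "AE x in lebesgue. x \<in> h -` A \<inter> space lebesgue \<longleftrightarrow> x \<in> g -` A \<inter> space lebesgue"
    using ae by (rule eventually_mono) simp
  ultimately show "g -` A \<inter> space lebesgue \<in> sets lebesgue"
    by (rule completion.in_sets_AE[OF _ _ Int_lower2, rotated])
qed simp

lemma set_integrable_borel_representative:
  fixes f :: "'a::euclidean_space \<Rightarrow> real"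
  assumes "set_integrable lebesgue S f"
  obtains f0 where "f0 \<in> borel_measurable borel" "integrable lborel f0"
    "AE x in lborel. indicator S x * f x = f0 x"
proof -
  have F: "integrable lebesgue (\<lambda>x. indicator S x * f x)"
    using assms by (simp add: set_integrable_def)
  then obtain f0 where f0: "f0 \<in> borel_measurable lborel" "AE x in lborel. indicator S x * f x = f0 x"
    using completion_ex_borel_measurable_real[of "\<lambda>x. indicator S x * f x" lborel] borel_measurable_integrable by blast
  from this have "integrable lebesgue f0"
    by (intro integrable_cong_AE_imp[OF F] measurable_completion AE_completion)
  then have "integrable lborel f0" using integrable_completion[OF f0(1)] by simp
  moreover have "f0 \<in> borel_measurable borel" using f0(1) by simp
  ultimately show ?thesis using f0(2) that by blast
qed

lemma bounded_continuous_on_bounded: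
  fixes \<psi> :: "'a::euclidean_space \<Rightarrow> real"
  assumes "continuous_on UNIV \<psi>" "bounded S"
  obtains B where "B > 0" "\<And>x. x \<in> S \<Longrightarrow> \<bar>\<psi> x\<bar> \<le> B"
proof -
  have "compact (\<psi> ` closure S)"
    using assms by (intro compact_continuous_image) (auto intro: continuous_on_subset simp: compact_closure)
  then have "bounded (\<psi> ` closure S)" by (rule compact_imp_bounded)
  then obtain B where "B > 0" "\<And>y. y \<in> \<psi> ` closure S \<Longrightarrow> norm y \<le> B"
    unfolding bounded_pos by blast
  moreover have "\<psi> x \<in> \<psi> ` closure S" if "x \<in> S" for x using that closure_subset by blast
  ultimately show ?thesis using that[of B] by simp
qed

lemma integrable_bounded_mult:
  fixes \<psi> h :: "'a \<Rightarrow> real"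
  assumes h: "integrable M h" and \<psi>: "\<psi> \<in> borel_measurable M" and B: "\<And>x. x \<in> space M \<Longrightarrow> \<bar>\<psi> x\<bar> \<le> B"
  shows "integrable M (\<lambda>x. \<psi> x * h x)"
proof (rule Bochner_Integration.integrable_bound)
  show "integrable M (\<lambda>x. B * h x)" using h by simp
  show "AE x in M. norm (\<psi> x * h x) \<le> norm (B * h x)"
  proof (rule AE_I2)
    fix x assume "x \<in> space M"
    then have "\<bar>\<psi> x\<bar> \<le> \<bar>B\<bar>" using B by fastforce
    then show "norm (\<psi> x * h x) \<le> norm (B * h x)" by (simp add: abs_mult mult_right_mono)
  qed
qed (use h \<psi> in auto)

lemma shadow_radius_pos:
  fixes \<Omega> :: "'a::euclidean_space set"
  assumes "\<Omega> \<noteq> {}" "open \<Omega>" "bounded \<Omega>" "norm e = 1"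
  shows "shadow_radius \<Omega> e > 0"
proof -
  obtain x where "x \<in> \<Omega>" using assms by blast
  then show ?thesis
    using shadow_open_strict[of \<Omega> e x] shadow_open_strict[of \<Omega> "- e" x] assms
    by (simp add: shadow_radius_def shadow_uminus)
qed

text \<open>
  Fubini's theorem along the hyperplanes orthogonal to \<open>e\<close>. The section integrals of a Borel representative
  of the integrand are a Borel function \<open>I\<close>. For almost every \<open>t\<close> the null set where \<open>f\<close> differs from its
  representative is negligible on the section, so that \<open>I t\<close> is the prescribed value.
\<close>

proposition plane_wave_integral:
  fixes \<Omega> :: "(real ^ 'n) set" and \<phi> :: "real \<Rightarrow> real"
  assumes n: "CARD('n) \<ge> 2"
    and \<Omega>: "\<Omega> \<noteq> {}" "open \<Omega>" "connected \<Omega>" "bounded \<Omega>"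
    and hyp: "hyperplane_integrals \<Omega> G f" and f: "set_integrable lebesgue \<Omega> f"
    and e: "norm e = 1" and \<kappa>: "\<kappa> > 0" and slice: "slice_measure e = density lborel (\<lambda>_. ennreal \<kappa>)"
    and \<phi>: "continuous_on UNIV \<phi>"
  shows "integrable lebesgue (\<lambda>\<tau>. \<phi> \<tau> * section_profile G (shadow_radius \<Omega> e) \<tau>)"
    and "(\<integral>\<tau>. \<phi> \<tau> * section_profile G (shadow_radius \<Omega> e) \<tau> \<partial>lebesgue)
       = \<kappa> * (LINT x:\<Omega>|lebesgue. \<phi> (e \<bullet> x - shadow_mid \<Omega> e) * f x)"
proof -
  let ?M = "hausdorff_measure (CARD('n) - 1) :: (real ^ 'n) measure"
  define m where "m = shadow_mid \<Omega> e"
  define r where "r = shadow_radius \<Omega> e"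
  define H where "H = (\<lambda>t. {x. e \<bullet> x = t})"
  have sup: "shadow_sup \<Omega> e = m + r" and inf: "shadow_inf \<Omega> e = m - r"
    by (simp_all add: m_def r_def shadow_mid_def shadow_radius_def field_simps)
  obtain f0 where f0[measurable]: "f0 \<in> borel_measurable borel" and f0int: "integrable lborel f0"
    and f0ae: "AE x in lborel. indicator \<Omega> x * f x = f0 x"
    using set_integrable_borel_representative[OF f] by blast
  define \<psi> where "\<psi> = (\<lambda>x. \<phi> (e \<bullet> x - m))"
  have cont\<psi>: "continuous_on UNIV \<psi>"
    unfolding \<psi>_def by (rule continuous_on_compose2[OF \<phi>]) (auto intro!: continuous_intros)
  then have \<psi>m[measurable]: "\<psi> \<in> borel_measurable borel" by (rule borel_measurable_continuous_onI)
  obtain B where B: "B > 0" "\<And>x. x \<in> \<Omega> \<Longrightarrow> \<bar>\<psi> x\<bar> \<le> B"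
    using bounded_continuous_on_bounded[OF cont\<psi> \<Omega>(4)] by blast
  have [measurable]: "\<Omega> \<in> sets borel" using \<Omega> by simp
  define h where "h = (\<lambda>x. (indicator \<Omega> x * \<psi> x) * f0 x)"
  have hm[measurable]: "h \<in> borel_measurable borel" unfolding h_def by measurable
  have hint: "integrable lborel h"
    unfolding h_def using B by (intro integrable_bounded_mult[OF f0int, of _ B]) (auto simp: indicator_def)
  define I where "I = (\<lambda>t. LINT x:H t|?M. h x)"
  define g where "g = (\<lambda>t. \<phi> (t - m) * section_profile G r (t - m))"
  have Iint: "integrable lborel I" and Ieq: "(\<integral>t. I t \<partial>lborel) = \<kappa> * (\<integral>x. h x \<partial>lborel)"
    unfolding I_def H_def by (rule integral_hyperplane_sections[OF e \<kappa> slice hint])+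
  obtain N where N: "\<And>x. x \<in> space lborel - N \<Longrightarrow> indicator \<Omega> x * f x = f0 x" "N \<in> null_sets lborel"
    using AE_E3[OF f0ae] by metis
  have "AE t in lborel. N \<inter> H t \<in> null_sets ?M"
    unfolding H_def by (rule AE_hyperplane_section_null[OF e slice N(2)])
  moreover have "g t = I t" if null: "N \<inter> H t \<in> null_sets ?M" for t
  proof (cases "m - r < t \<and> t < m + r")
    case True
    note sec = section_integral[OF n \<Omega> hyp e, of t, unfolded sup inf]
    have fs: "integrable ?M (\<lambda>x. indicator (\<Omega> \<inter> H t) x * f x)"
      using sec(1) True by (simp add: set_integrable_def H_def)
    have "H t \<in> sets borel" by (simp add: H_def closed_hyperplane borel_closed)
    then have "(\<lambda>x. indicator (H t) x * h x) \<in> borel_measurable borel" by measurable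
    then have m1: "(\<lambda>x. indicator (H t) x * h x) \<in> borel_measurable ?M"
      using measurable_compose[OF id_measurable_hausdorff] by blast
    have "I t = (\<integral>x. indicator (H t) x * h x \<partial>?M)" by (simp add: I_def set_lebesgue_integral_def)
    also have "\<dots> = (\<integral>x. \<phi> (t - m) * (indicator (\<Omega> \<inter> H t) x * f x) \<partial>?M)"
    proof (rule integral_cong_AE[OF m1])
      show "AE x in ?M. indicator (H t) x * h x = \<phi> (t - m) * (indicator (\<Omega> \<inter> H t) x * f x)"
      proof (rule eventually_mono[OF AE_not_in[OF null]])
        fix x assume "x \<notin> N \<inter> H t"
        then show "indicator (H t) x * h x = \<phi> (t - m) * (indicator (\<Omega> \<inter> H t) x * f x)"
          using N(1)[of x] by (cases "x \<in> H t"; cases "x \<in> \<Omega>") (simp_all add: h_def H_def \<psi>_def)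
      qed
    qed (use fs in measurable)
    also have "\<dots> = \<phi> (t - m) * G (min (m + r - t) (t - (m - r)))"
      using sec(2) True by (simp add: set_lebesgue_integral_def H_def)
    also have "min (m + r - t) (t - (m - r)) = r - \<bar>t - m\<bar>" by (simp add: min_def abs_if)
    finally show ?thesis using True by (simp add: g_def section_profile_def indicator_def)
  next
    case False
    have "\<not> (x \<in> \<Omega> \<and> e \<bullet> x = t)" for x
      using shadow_open_strict[OF \<Omega>(2,4) e, of x] shadow_open_strict[OF \<Omega>(2,4), of "- e" x] False e
      unfolding shadow_uminus sup inf by auto
    then have "indicator (H t) x *\<^sub>R h x = 0" for x by (auto simp: indicator_def H_def h_def)
    then have "I t = 0" by (simp only: I_def set_lebesgue_integral_def integral_zero)
    moreover have "t - m \<notin> {-r<..<r}" using False by auto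
    ultimately show ?thesis by (simp add: g_def section_profile_def)
  qed
  ultimately have "AE t in lborel. g t = I t" by (rule eventually_mono)
  then have ae: "AE t in lebesgue. g t = I t" by (rule AE_completion)
  have Im: "I \<in> borel_measurable lborel" using Iint by (rule borel_measurable_integrable)
  then have Il: "I \<in> borel_measurable lebesgue" by (rule measurable_completion)
  then have gm: "g \<in> borel_measurable lebesgue" by (rule borel_measurable_lebesgue_AE_eq[OF _ ae])
  have Iintl: "integrable lebesgue I" using Iint integrable_completion[OF Im] by simp
  have gint: "integrable lebesgue g"
    by (rule integrable_cong_AE_imp[OF Iintl gm]) (rule eventually_mono[OF ae], simp)
  have shift: "g (m + 1 * \<tau>) = \<phi> \<tau> * section_profile G r \<tau>" for \<tau> by (simp add: g_def)
  show "integrable lebesgue (\<lambda>\<tau>. \<phi> \<tau> * section_profile G (shadow_radius \<Omega> e) \<tau>)"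
    using lebesgue_integrable_real_affine[OF gint, of 1 m] unfolding shift r_def by simp
  have "(\<integral>\<tau>. \<phi> \<tau> * section_profile G r \<tau> \<partial>lebesgue) = (\<integral>t. g t \<partial>lebesgue)"
    using lebesgue_integral_real_affine[of 1 g m] unfolding shift by simp
  also have "\<dots> = (\<integral>t. I t \<partial>lebesgue)" by (rule integral_cong_AE[OF gm Il ae])
  also have "\<dots> = (\<integral>t. I t \<partial>lborel)" by (rule integral_completion[OF Im])
  also have "\<dots> = \<kappa> * (\<integral>x. h x \<partial>lborel)" by (rule Ieq)
  also have "(\<integral>x. h x \<partial>lborel) = (\<integral>x. h x \<partial>lebesgue)" by (rule integral_completion[symmetric]) simp
  also have "\<dots> = (\<integral>x. indicator \<Omega> x * (\<psi> x * f x) \<partial>lebesgue)"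
  proof (rule integral_cong_AE)
    show "h \<in> borel_measurable lebesgue" by (rule measurable_completion) simp
    show hae: "AE x in lebesgue. h x = indicator \<Omega> x * (\<psi> x * f x)"
      using AE_completion[OF f0ae] by (rule eventually_mono) (auto simp: h_def indicator_def split: if_splits)
    show "(\<lambda>x. indicator \<Omega> x * (\<psi> x * f x)) \<in> borel_measurable lebesgue"
      by (rule borel_measurable_lebesgue_AE_eq[OF \<open>h \<in> borel_measurable lebesgue\<close>])
        (rule eventually_mono[OF hae], simp)
  qed
  finally show "(\<integral>\<tau>. \<phi> \<tau> * section_profile G (shadow_radius \<Omega> e) \<tau> \<partial>lebesgue)
       = \<kappa> * (LINT x:\<Omega>|lebesgue. \<phi> (e \<bullet> x - shadow_mid \<Omega> e) * f x)"
    by (simp add: r_def \<psi>_def m_def set_lebesgue_integral_def)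
qed

text \<open>
  The two halves of the smaller profile, pushed apart by \<open>r2 - r1\<close>, form the outer parts of the larger profile.
  The part that remains in the middle has a positive integral.
\<close>

lemma section_profile_integral_strict_mono:
  assumes r: "0 < r1" "r1 < r2" and G: "\<And>t. t \<ge> 0 \<Longrightarrow> G t > 0"
    and int: "integrable lebesgue (section_profile G r1)" "integrable lebesgue (section_profile G r2)"
  shows "integral\<^sup>L lebesgue (section_profile G r1) < integral\<^sup>L lebesgue (section_profile G r2)"
proof -
  define d where "d = r2 - r1"
  have d: "d > 0" "d < r2" using r by (auto simp: d_def)
  let ?P = "section_profile G r2"
  define A where "A = (\<lambda>x. indicator {d<..} x * ?P x)"
  define B where "B = (\<lambda>x. indicator {..<-d} x * ?P x)"
  define C where "C = (\<lambda>x. indicator {-d..d} x * ?P x)"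
  have intA: "integrable lebesgue A" and intB: "integrable lebesgue B" and intC: "integrable lebesgue C"
    unfolding A_def B_def C_def using int(2) by (auto intro!: integrable_real_mult_indicator simp: mult.commute[of "indicator _ _"])
  have "?P x = A x + B x + C x" for x using d by (auto simp: A_def B_def C_def indicator_def)
  then have P: "integral\<^sup>L lebesgue ?P = integral\<^sup>L lebesgue A + integral\<^sup>L lebesgue B + integral\<^sup>L lebesgue C"
    using intA intB intC by (simp add: fun_eq_iff[symmetric] cong: Bochner_Integration.integral_cong)
  have intA': "integrable lebesgue (\<lambda>x. A (d + 1 * x))" and intB': "integrable lebesgue (\<lambda>x. B (- d + 1 * x))"
    using lebesgue_integrable_real_affine[OF intA, of 1 d] lebesgue_integrable_real_affine[OF intB, of 1 "- d"] by auto
  have ae: "AE x in lebesgue. section_profile G r1 x = A (d + 1 * x) + B (- d + 1 * x)"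
  proof -
    have "AE x in lebesgue. x \<noteq> (0::real)" by (rule AE_completion) (rule AE_lborel_singleton)
    then show ?thesis
      by (rule eventually_mono) (use r in \<open>auto simp: section_profile_def A_def B_def d_def indicator_def abs_if
        intro!: arg_cong[where f=G]\<close>)
  qed
  have "integral\<^sup>L lebesgue (section_profile G r1) = (\<integral>x. A (d + 1 * x) + B (- d + 1 * x) \<partial>lebesgue)"
    using int(1) intA' intB' ae by (intro integral_cong_AE) auto
  also have "\<dots> = (\<integral>x. A (d + 1 * x) \<partial>lebesgue) + (\<integral>x. B (- d + 1 * x) \<partial>lebesgue)"
    using intA' intB' by simp
  also have "\<dots> = integral\<^sup>L lebesgue A + integral\<^sup>L lebesgue B"
    using lebesgue_integral_real_affine[of 1 A d] lebesgue_integral_real_affine[of 1 B "- d"] by simp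
  finally have P1: "integral\<^sup>L lebesgue (section_profile G r1) = integral\<^sup>L lebesgue A + integral\<^sup>L lebesgue B" .
  have Cnn: "C x \<ge> 0" for x
  proof (cases "\<bar>x\<bar> < r2")
    case True
    then show ?thesis using G[of "r2 - \<bar>x\<bar>"] by (auto simp: C_def section_profile_def indicator_def)
  qed (auto simp: C_def section_profile_def indicator_def)
  have Cpos: "C x > 0" if "x \<in> {-d<..<d}" for x
    using G[of "r2 - \<bar>x\<bar>"] that d by (auto simp: C_def section_profile_def indicator_def)
  have "integral\<^sup>L lebesgue C \<noteq> 0"
  proof
    assume "integral\<^sup>L lebesgue C = 0"
    then have "AE x in lebesgue. C x = 0" using integral_nonneg_eq_0_iff_AE[OF intC] Cnn by auto
    then have "AE x in lebesgue. x \<notin> {-d<..<d}" by (rule eventually_mono) (use Cpos in fastforce)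
    then have "{-d<..<d} \<in> null_sets lebesgue"
      by (subst (asm) AE_iff_null) (auto simp: greaterThanLessThan_def greaterThan_def lessThan_def Int_def)
    then have "emeasure lebesgue {-d<..<d} = 0" by auto
    then show False using d by simp
  qed
  moreover have "integral\<^sup>L lebesgue C \<ge> 0" using Cnn by simp
  ultimately show ?thesis using P P1 by simp
qed

text \<open>
  A point outside an open convex set is separated from it by a hyperplane, whose normal is a direction in
  which the support function is at most the value of the linear functional at that point.
\<close>

lemma ball_if_shadow_of_ball:
  fixes \<Omega> :: "'a::euclidean_space set"
  assumes \<Omega>: "\<Omega> \<noteq> {}" "open \<Omega>" "convex \<Omega>" "bounded \<Omega>"
    and sup: "\<And>e. norm e = 1 \<Longrightarrow> shadow_sup \<Omega> e = e \<bullet> c + r"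
  shows "\<Omega> = ball c r"
proof
  show "\<Omega> \<subseteq> ball c r"
  proof
    fix x assume x: "x \<in> \<Omega>"
    show "x \<in> ball c r"
    proof (cases "x = c")
      case True
      obtain i :: 'a where i: "i \<in> Basis" using nonempty_Basis by blast
      then have "i \<bullet> x < i \<bullet> c + r" using shadow_open_strict[OF \<Omega>(2,4) _ x, of i] sup[of i] by simp
      then show ?thesis using True by simp
    next
      case False
      define e where "e = (x - c) /\<^sub>R norm (x - c)"
      have e: "norm e = 1" using False by (simp add: e_def)
      have "e \<bullet> (x - c) = norm (x - c)" using False by (simp add: e_def dot_square_norm power2_eq_square)
      moreover have "e \<bullet> x < e \<bullet> c + r" using shadow_open_strict[OF \<Omega>(2,4) e x] sup[OF e] by simp
      ultimately show ?thesis by (simp add: inner_diff_right dist_norm norm_minus_commute)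
    qed
  qed
  show "ball c r \<subseteq> \<Omega>"
  proof (rule ccontr)
    assume "\<not> ball c r \<subseteq> \<Omega>"
    then obtain y where y: "y \<in> ball c r" "y \<notin> \<Omega>" by blast
    then have "{y} \<inter> \<Omega> = {}" by simp
    then obtain a b where a: "a \<noteq> 0" "a \<bullet> y \<ge> b" "\<And>x. x \<in> \<Omega> \<Longrightarrow> a \<bullet> x \<le> b"
      using separating_hyperplane_sets[of \<Omega> "{y}"] \<Omega> by (auto simp: Int_commute)
    define e where "e = a /\<^sub>R norm a"
    have e: "norm e = 1" using a by (simp add: e_def)
    have "e \<bullet> x \<le> e \<bullet> y" if "x \<in> \<Omega>" for x
      using a(1) order_trans[OF a(3)[OF that] a(2)] by (simp add: e_def divide_right_mono inverse_eq_divide)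
    then have "shadow_sup \<Omega> e \<le> e \<bullet> y"
      unfolding shadow_sup_def using \<Omega> by (intro cSup_least) auto
    then have "r \<le> e \<bullet> (y - c)" using sup[OF e] by (simp add: inner_diff_right)
    also have "\<dots> \<le> norm (y - c)" using norm_cauchy_schwarz[of e "y - c"] e by simp
    also have "\<dots> < r" using y by (simp add: dist_norm norm_minus_commute)
    finally show False by simp
  qed
qed

section \<open>Exponential moments determine an integrable function\<close>

text \<open>
  The Borel sets over which \<open>g\<close> has integral zero form a Dynkin system containing the closed sets, so they
  are all Borel sets; two of them are the sets where \<open>g\<close> is nonnegative and where it is nonpositive.
\<close>

lemma AE_zero_if_closed_integrals_zero:
  fixes g :: "'a::euclidean_space \<Rightarrow> real"
  assumes g: "integrable lborel g"
    and zero: "\<And>C. closed C \<Longrightarrow> (\<integral>x. indicator C x * g x \<partial>lborel) = 0"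
  shows "AE x in lborel. g x = 0"
proof -
  have gm[measurable]: "g \<in> borel_measurable borel" using g by auto
  have sint: "set_integrable lborel A g" if "A \<in> sets borel" for A
    unfolding set_integrable_def using that g by (intro integrable_mult_indicator) auto
  have borel: "(LINT x:A|lborel. g x) = 0" if "A \<in> sets borel" for A
  proof -
    have "A \<in> sigma_sets UNIV (Collect closed)" using that by (simp add: borel_eq_closed)
    then show ?thesis
    proof (induction rule: sigma_sets_induct_disjoint[rotated 2, consumes 1, case_names basic empty compl union])
      case (basic A)
      then show ?case using zero by (simp add: set_lebesgue_integral_def)
    next
      case (compl A)
      then have A: "A \<in> sets borel" by (simp add: borel_eq_closed)
      have "(LINT x:UNIV|lborel. g x) = (LINT x:A|lborel. g x) + (LINT x:(UNIV - A)|lborel. g x)"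
        using set_integral_Un[of A "UNIV - A" lborel g] A sint by simp
      moreover have "(LINT x:UNIV|lborel. g x) = 0" using zero[of UNIV] by (simp add: set_lebesgue_integral_def)
      ultimately show ?case using compl.IH by simp
    next
      case (union A)
      then have A: "A i \<in> sets borel" for i by (auto simp: borel_eq_closed)
      have "(LINT x:(\<Union>i. A i)|lborel. g x) = (\<Sum>i. (LINT x:A i|lborel. g x))"
        using union.hyps(1) A sint
        by (intro lebesgue_integral_countable_add) (auto simp: disjoint_family_on_def)
      then show ?case using union.IH by simp
    qed (auto simp: Int_stable_def set_lebesgue_integral_def)
  qed
  have pos: "AE x in lborel. x \<in> A \<longrightarrow> h x = 0"
    if h: "integrable lborel h" "\<And>x. x \<in> A \<Longrightarrow> h x \<ge> 0" "A \<in> sets borel" "(LINT x:A|lborel. h x) = 0" for h :: "'a \<Rightarrow> real" and A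
  proof -
    have "integrable lborel (\<lambda>x. indicator A x * h x)"
      using integrable_mult_indicator[of A lborel h] h by simp
    then have "AE x in lborel. indicator A x * h x = 0"
      using integral_nonneg_eq_0_iff_AE[of lborel "\<lambda>x. indicator A x * h x"] h(2,4)
      by (auto simp: set_lebesgue_integral_def indicator_def)
    then show ?thesis by (rule eventually_mono) (auto simp: indicator_def split: if_splits)
  qed
  have sg: "{x. g x \<ge> 0} \<in> sets borel" "{x. g x \<le> 0} \<in> sets borel" by measurable
  have "AE x in lborel. x \<in> {x. g x \<ge> 0} \<longrightarrow> g x = 0"
    by (rule pos[OF g]) (use sg borel in auto)
  moreover have "AE x in lborel. x \<in> {x. g x \<le> 0} \<longrightarrow> - g x = 0"
    by (rule pos) (use g sg borel[OF sg(2)] in \<open>auto simp: set_lebesgue_integral_def\<close>)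
  ultimately show ?thesis by eventually_elim (smt (verit) mem_Collect_eq)
qed

text \<open>
  The indicator of a closed set is the limit of the continuous functions \<open>max 0 (1 - k * infdist x C)\<close>.
\<close>

lemma AE_zero_if_continuous_integrals_zero:
  fixes g :: "'a::euclidean_space \<Rightarrow> real"
  assumes g: "integrable lborel g"
    and zero: "\<And>\<phi>. continuous_on UNIV \<phi> \<Longrightarrow> (\<integral>x. \<phi> x * g x \<partial>lborel) = 0"
  shows "AE x in lborel. g x = 0"
proof (rule AE_zero_if_closed_integrals_zero[OF g])
  fix C :: "'a set" assume C: "closed C"
  have gm[measurable]: "g \<in> borel_measurable borel" using g by auto
  show "(\<integral>x. indicator C x * g x \<partial>lborel) = 0"
  proof (cases "C = {}")
    case False
    define \<phi> where "\<phi> = (\<lambda>k x. max 0 (1 - real k * infdist x C))"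
    have cont: "continuous_on UNIV (\<phi> k)" for k unfolding \<phi>_def by (intro continuous_intros)
    then have [measurable]: "\<phi> k \<in> borel_measurable borel" for k by (rule borel_measurable_continuous_onI)
    have [measurable]: "C \<in> sets borel" using C by simp
    have "(\<lambda>k. \<integral>x. \<phi> k x * g x \<partial>lborel) \<longlonglongrightarrow> (\<integral>x. indicator C x * g x \<partial>lborel)"
    proof (rule integral_dominated_convergence[where w="\<lambda>x. \<bar>g x\<bar>"])
      show "AE x in lborel. (\<lambda>k. \<phi> k x * g x) \<longlonglongrightarrow> indicator C x * g x"
      proof (rule AE_I2, rule tendsto_mult_right)
        fix x
        show "(\<lambda>k. \<phi> k x) \<longlonglongrightarrow> indicator C x"
        proof (cases "x \<in> C")
          case True
          then show ?thesis by (simp add: \<phi>_def)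
        next
          case out: False
          then have "infdist x C > 0"
            using C False in_closed_iff_infdist_zero[of C x] infdist_nonneg[of x C] by linarith
          then obtain k0 :: nat where k0: "1 < real k0 * infdist x C" using reals_Archimedean3 by blast
          have "\<phi> k x = 0" if "k0 \<le> k" for k
          proof -
            have "real k0 * infdist x C \<le> real k * infdist x C" using that by (intro mult_right_mono) (auto simp: infdist_nonneg)
            then show ?thesis using k0 by (simp add: \<phi>_def)
          qed
          then have "\<forall>\<^sub>F k in sequentially. \<phi> k x = indicator C x"
            using out by (auto simp: eventually_sequentially)
          then show ?thesis by (rule tendsto_eventually)
        qed
      qed
      show "AE x in lborel. norm (\<phi> k x * g x) \<le> \<bar>g x\<bar>" for k
      proof (rule AE_I2)
        fix x
        have "\<bar>\<phi> k x\<bar> \<le> 1" by (simp add: \<phi>_def infdist_nonneg)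
        then show "norm (\<phi> k x * g x) \<le> \<bar>g x\<bar>" by (simp add: abs_mult mult_left_le_one_le)
      qed
    qed (use g in auto)
    then have "(\<lambda>k. 0 :: real) \<longlonglongrightarrow> (\<integral>x. indicator C x * g x \<partial>lborel)" by (simp add: zero[OF cont])
    then show ?thesis using LIMSEQ_unique tendsto_const by blast
  qed simp
qed

text \<open>
  Linear combinations of exponentials. Products need no rule of their own, since the product of two
  exponentials is an exponential.
\<close>

inductive_set exponential_sums :: "('a::euclidean_space \<Rightarrow> real) set" where
  base: "(\<lambda>x. c * exp (a \<bullet> x)) \<in> exponential_sums"
| add: "p \<in> exponential_sums \<Longrightarrow> q \<in> exponential_sums \<Longrightarrow> (\<lambda>x. p x + q x) \<in> exponential_sums"

lemma exponential_sums_continuous: "p \<in> exponential_sums \<Longrightarrow> continuous_on S p"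
  by (induction rule: exponential_sums.induct) (auto intro!: continuous_intros)

lemma exponential_sums_mult:
  assumes "p \<in> exponential_sums" "q \<in> exponential_sums"
  shows "(\<lambda>x. p x * q x) \<in> exponential_sums"
  using assms(1)
proof induction
  case (base c a)
  show ?case using assms(2)
  proof induction
    case (base c' a')
    have "(\<lambda>x. c * exp (a \<bullet> x) * (c' * exp (a' \<bullet> x))) = (\<lambda>x. (c * c') * exp ((a + a') \<bullet> x))"
      by (simp add: inner_add_left exp_add algebra_simps)
    then show ?case by (simp only: exponential_sums.base)
  next
    case (add p q)
    then show ?case using exponential_sums.add[OF add.IH] by (simp add: distrib_left)
  qed
next
  case (add p1 p2)
  then show ?case using exponential_sums.add[OF add.IH] by (simp add: distrib_right)
qed

lemma function_ring_on_exponential_sums: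
  "compact K \<Longrightarrow> function_ring_on (exponential_sums :: ('a::euclidean_space \<Rightarrow> real) set) K"
proof
  show "(\<lambda>_. c) \<in> exponential_sums" for c using exponential_sums.base[of c 0] by simp
  fix x y :: 'a assume "x \<noteq> y"
  then have "(x - y) \<bullet> x \<noteq> (x - y) \<bullet> y" by (metis eq_iff_diff_eq_0 inner_diff_right inner_eq_zero_iff)
  then show "\<exists>f\<in>exponential_sums. f x \<noteq> f y"
    by (intro bexI[OF _ exponential_sums.base[of 1 "x - y"]]) simp
qed (auto intro: exponential_sums_continuous exponential_sums_mult exponential_sums.add)

text \<open>
  By the theorem of Stone and Weierstrass, a continuous function is uniformly approximated on \<open>K\<close> by
  combinations of exponentials, over which \<open>g\<close> integrates to zero.
\<close>

proposition AE_zero_if_exponential_moments_zero: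
  fixes g :: "'a::euclidean_space \<Rightarrow> real"
  assumes g: "integrable lborel g" and K: "compact K" and supp: "\<And>x. x \<notin> K \<Longrightarrow> g x = 0"
    and zero: "\<And>a. (\<integral>x. exp (a \<bullet> x) * g x \<partial>lborel) = 0"
  shows "AE x in lborel. g x = 0"
proof (rule AE_zero_if_continuous_integrals_zero[OF g])
  fix \<phi> :: "'a \<Rightarrow> real" assume \<phi>: "continuous_on UNIV \<phi>"
  interpret E: function_ring_on "exponential_sums :: ('a \<Rightarrow> real) set" K
    by (rule function_ring_on_exponential_sums[OF K])
  have gm[measurable]: "g \<in> borel_measurable borel" using g by auto
  have int: "integrable lborel (\<lambda>x. \<psi> x * g x)" if \<psi>: "continuous_on UNIV \<psi>" for \<psi>
  proof -
    obtain B where B: "B > 0" "\<And>x. x \<in> K \<Longrightarrow> \<bar>\<psi> x\<bar> \<le> B"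
      using bounded_continuous_on_bounded[OF \<psi> compact_imp_bounded[OF K]] by blast
    have [measurable]: "\<psi> \<in> borel_measurable borel" "K \<in> sets borel"
      using \<psi> K by (auto intro: borel_measurable_continuous_onI borel_compact)
    have "integrable lborel (\<lambda>x. (indicator K x * \<psi> x) * g x)"
      using B by (intro integrable_bounded_mult[OF g, of _ B]) (auto simp: indicator_def)
    moreover have "(indicator K x * \<psi> x) * g x = \<psi> x * g x" for x using supp by (auto simp: indicator_def)
    ultimately show ?thesis by simp
  qed
  have E0: "(\<integral>x. p x * g x \<partial>lborel) = 0" if "p \<in> exponential_sums" for p
    using that
  proof induction
    case (base c a)
    then show ?case using zero[of a] by (simp add: mult.assoc)
  next
    case (add p q)
    have "(\<integral>x. (p x + q x) * g x \<partial>lborel) = (\<integral>x. p x * g x \<partial>lborel) + (\<integral>x. q x * g x \<partial>lborel)"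
      using int[OF exponential_sums_continuous[OF add.hyps(1)]] int[OF exponential_sums_continuous[OF add.hyps(2)]]
      by (simp add: distrib_right)
    then show ?case using add.IH by simp
  qed
  have "\<bar>\<integral>x. \<phi> x * g x \<partial>lborel\<bar> \<le> \<epsilon> * (\<integral>x. \<bar>g x\<bar> \<partial>lborel)" if "\<epsilon> > 0" for \<epsilon>
  proof -
    obtain p where p: "p \<in> exponential_sums" "\<And>x. x \<in> K \<Longrightarrow> \<bar>\<phi> x - p x\<bar> < \<epsilon>"
      using E.Stone_Weierstrass_basic[OF continuous_on_subset[OF \<phi>] \<open>\<epsilon> > 0\<close>] by auto
    have ip: "integrable lborel (\<lambda>x. p x * g x)" by (rule int[OF exponential_sums_continuous[OF p(1)]])
    have i\<phi>: "integrable lborel (\<lambda>x. \<phi> x * g x)" by (rule int[OF \<phi>])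
    have "(\<integral>x. \<phi> x * g x \<partial>lborel) = (\<integral>x. \<phi> x * g x - p x * g x \<partial>lborel)"
      using E0[OF p(1)] ip i\<phi> by simp
    also have "\<bar>\<dots>\<bar> \<le> (\<integral>x. \<bar>\<phi> x * g x - p x * g x\<bar> \<partial>lborel)" by (rule integral_abs_bound)
    also have "\<dots> \<le> (\<integral>x. \<epsilon> * \<bar>g x\<bar> \<partial>lborel)"
    proof (rule integral_mono)
      show "\<bar>\<phi> x * g x - p x * g x\<bar> \<le> \<epsilon> * \<bar>g x\<bar>" for x
      proof (cases "x \<in> K")
        case True
        have "\<bar>\<phi> x * g x - p x * g x\<bar> = \<bar>\<phi> x - p x\<bar> * \<bar>g x\<bar>" by (simp add: abs_mult flip: left_diff_distrib)
        also have "\<dots> \<le> \<epsilon> * \<bar>g x\<bar>" using p(2)[OF True] by (intro mult_right_mono) auto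
        finally show ?thesis .
      qed (simp add: supp)
    qed (use ip i\<phi> g in auto)
    also have "\<dots> = \<epsilon> * (\<integral>x. \<bar>g x\<bar> \<partial>lborel)" by simp
    finally show ?thesis .
  qed
  note bound = this
  show "(\<integral>x. \<phi> x * g x \<partial>lborel) = 0"
  proof (rule ccontr)
    let ?J = "\<bar>\<integral>x. \<phi> x * g x \<partial>lborel\<bar>" and ?L = "\<integral>x. \<bar>g x\<bar> \<partial>lborel"
    assume "(\<integral>x. \<phi> x * g x \<partial>lborel) \<noteq> 0"
    then have J: "?J > 0" by simp
    have L: "?L \<ge> 0" by simp
    have "2 * (?L + 1) > 0" by (intro mult_pos_pos add_nonneg_pos L) auto
    then have "?J \<le> ?J / (2 * (?L + 1)) * ?L" by (intro bound divide_pos_pos J)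
    also have "\<dots> < ?J"
    proof -
      have "j / (2 * (l + 1)) * l < j" if "j > 0" "l \<ge> 0" for j l :: real
      proof -
        have "0 < j * l + j * 2" using that by (intro add_nonneg_pos) auto
        then show ?thesis using that by (simp add: pos_divide_less_eq algebra_simps)
      qed
      then show ?thesis using J L by blast
    qed
    finally show False by simp
  qed
qed

lemma integrable_continuous_mult_bounded_support:
  fixes \<psi> g :: "'a::euclidean_space \<Rightarrow> real"
  assumes g: "integrable lborel g" and \<Omega>: "\<Omega> \<in> sets borel" "bounded \<Omega>"
    and \<psi>: "continuous_on UNIV \<psi>"
  shows "integrable lborel (\<lambda>x. \<psi> x * (indicator \<Omega> x * g x))"
proof -
  obtain B where B: "B > 0" "\<And>x. x \<in> \<Omega> \<Longrightarrow> \<bar>\<psi> x\<bar> \<le> B"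
    using bounded_continuous_on_bounded[OF \<psi> \<Omega>(2)] by blast
  have [measurable]: "\<psi> \<in> borel_measurable borel" "\<Omega> \<in> sets borel"
    using \<psi> \<Omega> by (auto intro: borel_measurable_continuous_onI)
  have "integrable lborel (\<lambda>x. (\<psi> x * indicator \<Omega> x) * g x)"
    using B by (intro integrable_bounded_mult[OF g, of _ B]) (auto simp: indicator_def)
  then show ?thesis by (simp add: mult.assoc)
qed

lemma integral_borel_representative:
  fixes \<psi> f f0 :: "'a::euclidean_space \<Rightarrow> real"
  assumes [measurable]: "f0 \<in> borel_measurable borel" "\<Omega> \<in> sets borel" "\<psi> \<in> borel_measurable borel"
    and ae: "AE x in lborel. indicator \<Omega> x * f x = f0 x"
  shows "(\<integral>x. \<psi> x * (indicator \<Omega> x * f0 x) \<partial>lborel) = (LINT x:\<Omega>|lebesgue. \<psi> x * f x)"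
proof -
  let ?H = "\<lambda>x. \<psi> x * (indicator \<Omega> x * f0 x)"
  have H: "?H \<in> borel_measurable lborel" by measurable
  have ae': "AE x in lebesgue. indicator \<Omega> x * (\<psi> x * f x) = ?H x"
    using AE_completion[OF ae] by (rule eventually_mono) (auto simp: indicator_def split: if_splits)
  have "(\<integral>x. ?H x \<partial>lborel) = (\<integral>x. ?H x \<partial>lebesgue)" by (rule integral_completion[OF H, symmetric])
  also have "\<dots> = (\<integral>x. indicator \<Omega> x * (\<psi> x * f x) \<partial>lebesgue)"
    by (rule integral_cong_AE[OF measurable_completion[OF H] borel_measurable_lebesgue_AE_eq[OF measurable_completion[OF H] ae']])
      (rule eventually_mono[OF ae'], rule sym)
  finally show ?thesis by (simp add: set_lebesgue_integral_def)
qed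

lemma continuous_on_exp_inner: "continuous_on S (\<lambda>x. exp (a \<bullet> (x - c)))"
  by (intro continuous_intros)

lemma set_AE_eq_if_exponential_moments_eq:
  fixes f g :: "'a::euclidean_space \<Rightarrow> real"
  assumes f: "set_integrable lebesgue \<Omega> f" and g: "set_integrable lebesgue \<Omega> g"
    and \<Omega>: "\<Omega> \<in> sets borel" "bounded \<Omega>"
    and eq: "\<And>a. (LINT x:\<Omega>|lebesgue. exp (a \<bullet> (x - c)) * f x) = (LINT x:\<Omega>|lebesgue. exp (a \<bullet> (x - c)) * g x)"
  shows "AE x in lebesgue. x \<in> \<Omega> \<longrightarrow> f x = g x"
proof -
  obtain f0 where f0: "f0 \<in> borel_measurable borel" "integrable lborel f0"
    "AE x in lborel. indicator \<Omega> x * f x = f0 x"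
    using set_integrable_borel_representative[OF f] by blast
  obtain g0 where g0: "g0 \<in> borel_measurable borel" "integrable lborel g0"
    "AE x in lborel. indicator \<Omega> x * g x = g0 x"
    using set_integrable_borel_representative[OF g] by blast
  have E: "(\<lambda>x. exp (a \<bullet> (x - c))) \<in> borel_measurable borel" for a
    by (rule borel_measurable_continuous_onI[OF continuous_on_exp_inner])
  let ?d = "\<lambda>x. indicator \<Omega> x * (f0 x - g0 x)"
  have "AE x in lborel. ?d x = 0"
  proof (rule AE_zero_if_exponential_moments_zero)
    show "integrable lborel ?d"
      using integrable_continuous_mult_bounded_support[OF _ \<Omega> continuous_on_const, of "\<lambda>x. f0 x - g0 x" 1] f0(2) g0(2) by simp
    show "compact (closure \<Omega>)" using \<Omega> by (simp add: compact_closure)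
    show "?d x = 0" if "x \<notin> closure \<Omega>" for x using that closure_subset[of \<Omega>] by (auto simp: indicator_def)
    fix a
    have i: "integrable lborel (\<lambda>x. exp (a \<bullet> (x - c)) * (indicator \<Omega> x * h x))" if "integrable lborel h" for h
      by (rule integrable_continuous_mult_bounded_support[OF that \<Omega> continuous_on_exp_inner])
    have "(\<integral>x. exp (a \<bullet> x) * ?d x \<partial>lborel) = (\<integral>x. exp (a \<bullet> c) * (exp (a \<bullet> (x - c)) * ?d x) \<partial>lborel)"
      by (intro Bochner_Integration.integral_cong) (auto simp: inner_diff_right mult.assoc[symmetric] simp flip: exp_add)
    also have "\<dots> = exp (a \<bullet> c) * (\<integral>x. exp (a \<bullet> (x - c)) * (indicator \<Omega> x * f0 x) - exp (a \<bullet> (x - c)) * (indicator \<Omega> x * g0 x) \<partial>lborel)"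
      by (subst integral_mult_right_zero[symmetric]) (simp only: right_diff_distrib)
    also have "\<dots> = 0"
      using integral_borel_representative[OF f0(1) \<Omega>(1) E f0(3)] integral_borel_representative[OF g0(1) \<Omega>(1) E g0(3)] eq[of a]
      by (simp add: i f0(2) g0(2))
    finally show "(\<integral>x. exp (a \<bullet> x) * ?d x \<partial>lborel) = 0" .
  qed
  with f0(3) g0(3) have "AE x in lborel. x \<in> \<Omega> \<longrightarrow> f x = g x"
    by eventually_elim (auto simp: indicator_def split: if_splits)
  then show ?thesis by (rule AE_completion)
qed

section \<open>Radial exponential moments force a radial function\<close>

lemma lborel_integral_rotation_about:
  fixes k :: "'a::euclidean_space \<Rightarrow> real"
  assumes T: "orthogonal_transformation T" and k[measurable]: "k \<in> borel_measurable borel"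
  shows "(\<integral>x. k (c + T (x - c)) \<partial>lborel) = (\<integral>x. k x \<partial>lborel)"
proof -
  have lin: "linear T" using T by (rule orthogonal_transformation_linear)
  then have Tm[measurable]: "T \<in> borel_measurable borel"
    by (intro borel_measurable_continuous_onI linear_continuous_on linear_conv_bounded_linear[THEN iffD1])
  have plus: "(\<integral>x. h (v + x) \<partial>lborel) = (\<integral>x. h x \<partial>lborel)"
    if [measurable]: "h \<in> borel_measurable borel" for h :: "'a \<Rightarrow> real" and v
    by (subst (2) lborel_distr_plus[of v, symmetric], subst integral_distr) auto
  have "(\<integral>x. k x \<partial>lborel) = (\<integral>x. k (c + x) \<partial>lborel)" by (rule plus[symmetric]) simp
  also have "\<dots> = (\<integral>x. k (c + T x) \<partial>lborel)"
    by (subst lborel_distr_orthogonal[OF T, symmetric], subst integral_distr) auto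
  also have "\<dots> = (\<integral>x. k (c + T (- c + x)) \<partial>lborel)" by (rule plus[symmetric]) measurable
  finally show ?thesis by simp
qed

text \<open>
  Each level set of \<open>g\<close> is the preimage of a Borel set under \<open>p\<close>. Thus a conditional expectation given
  \<open>p\<close> is a function of \<open>p\<close> at every point and not only almost everywhere, as the definition of a radial
  function requires.
\<close>

lemma vimage_algebra_measurable_fibre:
  fixes g :: "'a \<Rightarrow> real" and p :: "'a \<Rightarrow> real"
  assumes g: "g \<in> borel_measurable (vimage_algebra UNIV p borel)" and xy: "p x = p y"
  shows "g x = g y"
proof -
  have "g -` {g x} \<inter> space (vimage_algebra UNIV p borel) \<in> sets (vimage_algebra UNIV p borel)"
    by (rule measurable_sets[OF g]) simp
  then obtain A where "g -` {g x} = p -` A" by (auto simp: sets_vimage_algebra2)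
  then have "z \<in> g -` {g x} \<longleftrightarrow> p z \<in> A" for z by simp
  from this[of x] this[of y] show ?thesis using xy by simp
qed

lemma continuous_AE_zero_imp_zero:
  fixes \<Phi> :: "'a::euclidean_space \<Rightarrow> real"
  assumes cont: "continuous_on UNIV \<Phi>" and ae: "AE a in lborel. a \<in> U \<longrightarrow> \<Phi> a = 0"
    and U: "open U" "a \<in> U"
  shows "\<Phi> a = 0"
proof (rule ccontr)
  assume "\<Phi> a \<noteq> 0"
  define V where "V = U \<inter> {a. \<Phi> a \<noteq> 0}"
  have "open {a. \<Phi> a \<noteq> 0}" using cont by (intro open_Collect_neq continuous_on_const)
  then have V: "open V" "a \<in> V" using U \<open>\<Phi> a \<noteq> 0\<close> by (auto simp: V_def)
  have "AE a in lebesgue. a \<notin> V" using AE_completion[OF ae] by (rule eventually_mono) (auto simp: V_def)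
  moreover have "V \<in> sets lebesgue" using V by auto
  ultimately have "V \<in> null_sets lebesgue"
    using AE_iff_null_sets[of V lebesgue] by blast
  then have "negligible V" by (simp add: negligible_iff_null_sets)
  then show False using V open_not_negligible by blast
qed

lemma borel_measurable_parametric_integral:
  fixes h :: "'a::euclidean_space \<times> 'a \<Rightarrow> real"
  assumes [measurable]: "h \<in> borel_measurable (borel \<Otimes>\<^sub>M lborel)"
  shows "(\<lambda>a. \<integral>x. h (a, x) \<partial>lborel) \<in> borel_measurable borel"
  by measurable

text \<open>
  Let \<open>g\<close> be the conditional expectation of \<open>f\<close> given the distance from \<open>c\<close>, with respect to Lebesgue
  measure on the ball, and \<open>d = f - g\<close>. Then \<open>d\<close> is orthogonal to all bounded measurable functions of the
  distance. Let \<open>\<Phi> a\<close> be the exponential moment of \<open>d\<close>; it depends on \<open>norm a\<close> only, for \<open>f\<close> by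
  hypothesis and for \<open>g\<close> by rotation invariance. For a ball \<open>B\<close> around the origin the function
  \<open>K x = \<integral>\<^sub>B \<Phi> b * exp (b \<bullet> (x - c)) db\<close> is then radial about \<open>c\<close>, hence orthogonal to \<open>d\<close>. By Fubini's
  theorem \<open>0 = \<integral> K x * d x dx = \<integral>\<^sub>B (\<Phi> b)\<^sup>2 db\<close>. So \<open>\<Phi>\<close> vanishes, and with it \<open>d\<close>.
\<close>

proposition ae_radial_if_exponential_moments_radial:
  fixes f :: "real ^ 'n \<Rightarrow> real"
  assumes f: "set_integrable lebesgue (ball c r) f"
    and rad: "\<And>a b. norm a = norm b \<Longrightarrow>
      (LINT x:ball c r|lebesgue. exp (a \<bullet> (x - c)) * f x) = (LINT x:ball c r|lebesgue. exp (b \<bullet> (x - c)) * f x)"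
  shows "ae_radial_on (ball c r) c f"
proof -
  define \<Omega> where "\<Omega> = ball c r"
  have \<Omega>: "\<Omega> \<in> sets borel" "bounded \<Omega>" by (auto simp: \<Omega>_def)
  note [measurable] = \<Omega>(1)
  obtain f0 where f0[measurable]: "f0 \<in> borel_measurable borel" and f0int: "integrable lborel f0"
    and f0ae: "AE x in lborel. indicator \<Omega> x * f x = f0 x"
    using set_integrable_borel_representative[OF f[folded \<Omega>_def]] by blast
  define M where "M = density lborel (\<lambda>x. ennreal (indicator \<Omega> x))"
  define F where "F = vimage_algebra UNIV (\<lambda>x. dist x c) (borel :: real measure)"
  have [measurable_cong, simp]: "sets M = sets borel" "space M = UNIV" by (simp_all add: M_def)
  have intM: "(\<integral>x. u x \<partial>M) = (\<integral>x. indicator \<Omega> x * u x \<partial>lborel)" if "u \<in> borel_measurable borel" for u :: "real ^ 'n \<Rightarrow> real"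
    unfolding M_def using that by (subst integral_density) auto
  have intgM: "integrable M u \<longleftrightarrow> integrable lborel (\<lambda>x. indicator \<Omega> x * u x)" if "u \<in> borel_measurable borel" for u :: "real ^ 'n \<Rightarrow> real"
    unfolding M_def using that by (subst integrable_density) auto
  have sub: "subalgebra M F"
  proof -
    have "sets F = {(\<lambda>x. dist x c) -` A \<inter> UNIV |A. A \<in> sets borel}"
      unfolding F_def by (rule sets_vimage_algebra2) simp
    moreover have "(\<lambda>x. dist x c) -` A \<in> sets borel" if "A \<in> sets borel" for A
      by (rule measurable_sets_borel[OF _ that]) measurable
    ultimately have "sets F \<subseteq> sets borel" by auto
    then show ?thesis by (simp add: subalgebra_def F_def)
  qed
  have "finite_measure M"
  proof
    have "emeasure M (space M) = emeasure lborel \<Omega>"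
      by (simp add: M_def emeasure_density ennreal_indicator)
    then show "emeasure M (space M) \<noteq> \<infinity>" using emeasure_bounded_finite[OF \<Omega>(2)] by auto
  qed
  then interpret finite_measure_subalgebra M F
    by (simp add: finite_measure_subalgebra_def finite_measure_subalgebra_axioms_def sub)
  define g where "g = real_cond_exp M F f0"
  have gF: "g \<in> borel_measurable F" unfolding g_def by (rule borel_measurable_cond_exp)
  have g[measurable]: "g \<in> borel_measurable borel"
    using measurable_from_subalg[OF sub gF] by simp
  have g_radial: "g x = g y" if "dist x c = dist y c" for x y
    by (rule vimage_algebra_measurable_fibre[OF gF[unfolded F_def] that])
  have f0M: "integrable M f0"
    using integrable_mult_indicator[of \<Omega> lborel f0] f0int by (simp add: intgM)
  then have "integrable M g" unfolding g_def by (rule real_cond_exp_int)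
  then have gint: "integrable lborel (\<lambda>x. indicator \<Omega> x * g x)" by (simp add: intgM)
  define d where "d = (\<lambda>x. indicator \<Omega> x * (f0 x - g x))"
  have d[measurable]: "d \<in> borel_measurable borel" unfolding d_def by measurable
  have dint: "integrable lborel d"
    using gint integrable_mult_indicator[of \<Omega> lborel f0] f0int by (simp add: d_def right_diff_distrib)
  define E where "E = (\<lambda>a x. exp (a \<bullet> (x - c)))"
  have E[measurable]: "(\<lambda>p. E (fst p) (snd p)) \<in> borel_measurable (borel \<Otimes>\<^sub>M borel)" unfolding E_def by measurable
  have Ea[measurable]: "E a \<in> borel_measurable borel" for a unfolding E_def by measurable
  have Epos: "E a x > 0" for a x by (simp add: E_def)
  have Ebound: "E a x \<le> exp (R * r)" if "x \<in> \<Omega>" "norm a \<le> R" for a x R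
  proof -
    have "a \<bullet> (x - c) \<le> norm a * norm (x - c)" by (rule norm_cauchy_schwarz)
    also have "\<dots> \<le> R * r" using that by (intro mult_mono) (auto simp: \<Omega>_def dist_norm norm_minus_commute intro: order_trans[OF norm_ge_zero])
    finally show ?thesis by (simp add: E_def)
  qed
  have dsupp: "d x = indicator \<Omega> x * d x" for x by (auto simp: d_def indicator_def)
  have Ed: "\<bar>E a x * d x\<bar> \<le> exp (R * r) * \<bar>d x\<bar>" if "norm a \<le> R" for a x R
    using Ebound[OF _ that, of x] Epos[of a x] by (cases "x \<in> \<Omega>") (auto simp: abs_mult d_def intro!: mult_right_mono)
  have iE: "integrable lborel (\<lambda>x. E a x * (indicator \<Omega> x * u x))" if "integrable lborel u" for a u
    unfolding E_def by (rule integrable_continuous_mult_bounded_support[OF that \<Omega> continuous_on_exp_inner])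
  have iEd: "integrable lborel (\<lambda>x. E a x * d x)" for a
    using iE[OF dint] dsupp by simp
  define \<Phi> where "\<Phi> = (\<lambda>a. \<integral>x. E a x * d x \<partial>lborel)"
  have \<Phi>m[measurable]: "\<Phi> \<in> borel_measurable borel"
    unfolding \<Phi>_def using borel_measurable_parametric_integral[of "\<lambda>p. E (fst p) (snd p) * d (snd p)"] by simp
  have \<Phi>_radial: "\<Phi> a = \<Phi> b" if ab: "norm a = norm b" for a b
  proof -
    have split: "\<Phi> a = (LINT x:\<Omega>|lebesgue. E a x * f x) - (\<integral>x. E a x * (indicator \<Omega> x * g x) \<partial>lborel)" for a
    proof -
      have ig: "integrable lborel (\<lambda>x. E a x * (indicator \<Omega> x * g x))"
        using iE[OF gint] by (simp add: indicator_inter_arith[symmetric] mult.assoc[symmetric])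
      have "\<Phi> a = (\<integral>x. E a x * (indicator \<Omega> x * f0 x) - E a x * (indicator \<Omega> x * g x) \<partial>lborel)"
        by (simp add: \<Phi>_def d_def right_diff_distrib)
      also have "\<dots> = (\<integral>x. E a x * (indicator \<Omega> x * f0 x) \<partial>lborel) - (\<integral>x. E a x * (indicator \<Omega> x * g x) \<partial>lborel)"
        by (rule Bochner_Integration.integral_diff[OF iE[OF f0int] ig])
      also have "(\<integral>x. E a x * (indicator \<Omega> x * f0 x) \<partial>lborel) = (LINT x:\<Omega>|lebesgue. E a x * f x)"
        by (rule integral_borel_representative[OF f0 \<Omega>(1) Ea f0ae])
      finally show ?thesis .
    qed
    obtain T where T: "orthogonal_transformation T" "T a = b" using orthogonal_transformation_exists[OF ab] by blast
    have "(\<integral>x. E b x * (indicator \<Omega> x * g x) \<partial>lborel)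
        = (\<integral>x. E b (c + T (x - c)) * (indicator \<Omega> (c + T (x - c)) * g (c + T (x - c))) \<partial>lborel)"
      by (rule lborel_integral_rotation_about[OF T(1), symmetric]) measurable
    also have "\<dots> = (\<integral>x. E a x * (indicator \<Omega> x * g x) \<partial>lborel)"
    proof (rule Bochner_Integration.integral_cong[OF refl])
      fix x
      have "dist (c + T (x - c)) c = dist x c" using T(1) by (simp add: dist_norm orthogonal_transformation_norm)
      moreover have "b \<bullet> T (x - c) = a \<bullet> (x - c)"
        using T by (auto simp: orthogonal_transformation_def)
      ultimately show "E b (c + T (x - c)) * (indicator \<Omega> (c + T (x - c)) * g (c + T (x - c))) = E a x * (indicator \<Omega> x * g x)"
        using g_radial[of "c + T (x - c)" x] by (simp add: E_def \<Omega>_def indicator_def dist_commute)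
    qed
    finally have "(\<integral>x. E b x * (indicator \<Omega> x * g x) \<partial>lborel) = (\<integral>x. E a x * (indicator \<Omega> x * g x) \<partial>lborel)" .
    then show ?thesis using rad[OF ab] by (simp add: split) (simp add: E_def \<Omega>_def)
  qed
  have \<Phi>_bound: "\<bar>\<Phi> a\<bar> \<le> exp (R * r) * (\<integral>x. \<bar>d x\<bar> \<partial>lborel)" if "norm a \<le> R" for a R
  proof -
    have "\<bar>\<Phi> a\<bar> \<le> (\<integral>x. \<bar>E a x * d x\<bar> \<partial>lborel)" unfolding \<Phi>_def by (rule integral_abs_bound)
    also have "\<dots> \<le> (\<integral>x. exp (R * r) * \<bar>d x\<bar> \<partial>lborel)"
      using iEd dint Ed[OF that] by (intro integral_mono) auto
    finally show ?thesis by simp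
  qed
  have \<Phi>_cont: "continuous_on UNIV \<Phi>"
    unfolding continuous_on_sequentially
  proof (intro ballI allI impI, elim conjE)
    fix u :: "nat \<Rightarrow> real ^ 'n" and a assume u: "u \<longlonglongrightarrow> a"
    then have "Bseq u" by (rule convergentI[THEN convergent_imp_Bseq])
    then obtain R where R: "\<And>i. norm (u i) \<le> R" by (auto simp: Bseq_def)
    have "(\<lambda>i. \<integral>x. E (u i) x * d x \<partial>lborel) \<longlonglongrightarrow> (\<integral>x. E a x * d x \<partial>lborel)"
    proof (rule integral_dominated_convergence[where w="\<lambda>x. exp (R * r) * \<bar>d x\<bar>"])
      show "AE x in lborel. (\<lambda>i. E (u i) x * d x) \<longlonglongrightarrow> E a x * d x"
        unfolding E_def by (rule AE_I2) (intro tendsto_intros u)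
      show "AE x in lborel. norm (E (u i) x * d x) \<le> exp (R * r) * \<bar>d x\<bar>" for i
        using Ed[OF R[of i]] by (intro AE_I2) simp
    qed (use dint in auto)
    then show "(\<Phi> \<circ> u) \<longlonglongrightarrow> \<Phi> a" by (simp add: \<Phi>_def o_def)
  qed
  have \<Phi>_zero: "\<Phi> a = 0" for a
  proof -
    \<comment> \<open>The radius only has to put \<open>a\<close> inside the ball \<open>B\<close>.\<close>
    define R where "R = norm a + 1"
    define B where "B = ball (0 :: real ^ 'n) R"
    have [measurable]: "B \<in> sets borel" by (simp add: B_def)
    define L where "L = exp (R * r) * (\<integral>x. \<bar>d x\<bar> \<partial>lborel)"
    have L: "\<bar>\<Phi> b\<bar> \<le> L" if "b \<in> B" for b unfolding L_def using that by (intro \<Phi>_bound) (simp add: B_def)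
    have iB: "integrable lborel (\<lambda>b. indicator B b * (k :: real))" for k
      using emeasure_bounded_finite[of B] by (intro integrable_mult_left integrable_real_indicator) (auto simp: B_def)
    define K where "K = (\<lambda>x. \<integral>b. indicator B b * \<Phi> b * E b x \<partial>lborel)"
    have Km[measurable]: "K \<in> borel_measurable borel"
      unfolding K_def using borel_measurable_parametric_integral[of "\<lambda>p. indicator B (snd p) * \<Phi> (snd p) * E (snd p) (fst p)"]
      by (simp add: E_def)
    have K_radial: "K x = K y" if xy: "dist x c = dist y c" for x y
    proof -
      have "norm (x - c) = norm (y - c)" using xy by (simp add: dist_norm)
      then obtain T where T: "orthogonal_transformation T" "T (x - c) = y - c"
        using orthogonal_transformation_exists by blast
      have "K y = (\<integral>b. indicator B (0 + T (b - 0)) * \<Phi> (0 + T (b - 0)) * E (0 + T (b - 0)) y \<partial>lborel)"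
        unfolding K_def by (rule lborel_integral_rotation_about[OF T(1), symmetric]) (simp add: E_def)
      also have "\<dots> = K x"
        unfolding K_def
      proof (rule Bochner_Integration.integral_cong[OF refl])
        fix b
        have n: "norm (T b) = norm b" using T(1) by (simp add: orthogonal_transformation_norm)
        have "T b \<bullet> (y - c) = b \<bullet> (x - c)" using T by (metis orthogonal_transformation_def)
        then show "indicator B (0 + T (b - 0)) * \<Phi> (0 + T (b - 0)) * E (0 + T (b - 0)) y = indicator B b * \<Phi> b * E b x"
          using \<Phi>_radial[OF n] n by (simp add: E_def B_def indicator_def)
      qed
      finally show ?thesis by simp
    qed
    have KF: "K \<in> borel_measurable F"
    proof -
      obtain i :: 'n where True by blast
      \<comment> \<open>Restricting to a ray exhibits \<open>K\<close> as a Borel function of the distance.\<close>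
      define k where "k = (\<lambda>s. K (c + s *\<^sub>R axis i 1))"
      have "k \<in> borel_measurable borel" unfolding k_def by measurable
      moreover have "(\<lambda>x. dist x c) \<in> F \<rightarrow>\<^sub>M borel" unfolding F_def by (rule measurable_vimage_algebra1) simp
      ultimately have "(\<lambda>x. k (dist x c)) \<in> borel_measurable F" by (rule measurable_compose[rotated])
      moreover have "K x = k (dist x c)" for x
        unfolding k_def by (rule K_radial) (simp add: dist_norm)
      then have "K = (\<lambda>x. k (dist x c))" by (rule ext)
      ultimately show ?thesis by simp
    qed
    have Kbound: "\<bar>K x\<bar> \<le> (\<integral>b. indicator B b * (L * exp (R * r)) \<partial>lborel)" if "x \<in> \<Omega>" for x
    proof -
      have "\<bar>indicator B b * \<Phi> b * E b x\<bar> \<le> indicator B b * (L * exp (R * r))" for b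
      proof (cases "b \<in> B")
        case True
        have "E b x \<le> exp (R * r)" using True by (intro Ebound[OF that]) (simp add: B_def)
        then have "\<bar>\<Phi> b\<bar> * E b x \<le> L * exp (R * r)"
          using L[OF True] Epos[of b x] by (intro mult_mono) (auto intro: order_trans[OF abs_ge_zero])
        then show ?thesis using True Epos[of b x] by (simp add: abs_mult)
      qed simp
      note le = this
      have "integrable lborel (\<lambda>b. indicator B b * \<Phi> b * E b x)"
        by (rule Bochner_Integration.integrable_bound[OF iB[of "L * exp (R * r)"]])
          (use le in \<open>auto simp: E_def intro!: AE_I2 order_trans[OF _ abs_ge_self]\<close>)
      then have "(\<integral>b. \<bar>indicator B b * \<Phi> b * E b x\<bar> \<partial>lborel) \<le> (\<integral>b. indicator B b * (L * exp (R * r)) \<partial>lborel)"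
        using le iB by (intro integral_mono) auto
      then show ?thesis unfolding K_def by (rule order_trans[OF integral_abs_bound])
    qed
    have Kd: "(\<integral>x. K x * d x \<partial>lborel) = 0"
    proof -
      let ?C = "\<integral>b. indicator B b * (L * exp (R * r)) \<partial>lborel"
      have bm: "integrable lborel (\<lambda>x. (indicator \<Omega> x * K x) * h x)" if "integrable lborel h" for h
      proof (rule integrable_bounded_mult[OF that, of _ "\<bar>?C\<bar>"])
        show "\<bar>indicator \<Omega> x * K x\<bar> \<le> \<bar>?C\<bar>" for x
          using Kbound[of x] by (cases "x \<in> \<Omega>") auto
      qed measurable
      have i1: "integrable M (\<lambda>x. K x * f0 x)"
        using bm[OF f0int] by (simp add: intgM mult.assoc)
      have "(\<integral>x. K x * g x \<partial>M) = (\<integral>x. K x * f0 x \<partial>M)"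
        unfolding g_def by (rule real_cond_exp_intg(2)[OF i1 KF]) simp
      then have eq: "(\<integral>x. indicator \<Omega> x * (K x * g x) \<partial>lborel) = (\<integral>x. indicator \<Omega> x * (K x * f0 x) \<partial>lborel)"
        by (simp add: intM)
      have i2: "integrable lborel (\<lambda>x. indicator \<Omega> x * (K x * g x))"
      proof -
        have "(\<lambda>x. (indicator \<Omega> x * K x) * (indicator \<Omega> x * g x)) = (\<lambda>x. indicator \<Omega> x * (K x * g x))"
          by (auto simp: indicator_def)
        then show ?thesis using bm[OF gint] by (simp only:)
      qed
      have "(\<integral>x. K x * d x \<partial>lborel) = (\<integral>x. indicator \<Omega> x * (K x * f0 x) - indicator \<Omega> x * (K x * g x) \<partial>lborel)"
        by (intro Bochner_Integration.integral_cong) (auto simp: d_def algebra_simps)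
      also have "\<dots> = 0"
        using eq i1 i2 by (subst Bochner_Integration.integral_diff) (auto simp: intgM)
      finally show ?thesis .
    qed
    define W where "W = (\<lambda>(b, x). indicator B b * \<Phi> b * E b x * d x)"
    have Wm: "W \<in> borel_measurable (lborel \<Otimes>\<^sub>M lborel)" unfolding W_def E_def by measurable
    have Wint: "integrable (lborel \<Otimes>\<^sub>M lborel) W"
    proof (rule Bochner_Integration.integrable_bound[OF _ Wm])
      let ?W0 = "\<lambda>(b, x). indicator B b * (L * exp (R * r)) * \<bar>d x\<bar>"
      show "integrable (lborel \<Otimes>\<^sub>M lborel) ?W0"
      proof (rule lborel_pair.Fubini_integrable)
        show "AE b in lborel. integrable lborel (\<lambda>x. ?W0 (b, x))" using dint by simp
        have "(\<integral>x. norm (?W0 (b, x)) \<partial>lborel) = indicator B b * (\<bar>L * exp (R * r)\<bar> * (\<integral>x. \<bar>d x\<bar> \<partial>lborel))" for b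
          by (simp add: abs_mult)
        then show "integrable lborel (\<lambda>b. \<integral>x. norm (?W0 (b, x)) \<partial>lborel)" using iB by simp
      qed measurable
      show "AE p in lborel \<Otimes>\<^sub>M lborel. norm (W p) \<le> norm (?W0 p)"
      proof (rule AE_I2)
        fix p :: "(real ^ 'n) \<times> (real ^ 'n)"
        obtain b x where p: "p = (b, x)" by (cases p)
        have "norm (W (b, x)) \<le> norm (?W0 (b, x))"
        proof (cases "b \<in> B")
          case True
          have "\<bar>\<Phi> b\<bar> * \<bar>E b x * d x\<bar> \<le> L * (exp (R * r) * \<bar>d x\<bar>)"
            using L[OF True] Ed[of b R x] True by (intro mult_mono) (auto simp: B_def intro: order_trans[OF abs_ge_zero])
          also have "\<dots> \<le> \<bar>L * (exp (R * r) * \<bar>d x\<bar>)\<bar>" by (rule abs_ge_self)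
          finally show ?thesis using True by (simp add: W_def abs_mult mult.assoc)
        qed (simp add: W_def)
        then show "norm (W p) \<le> norm (?W0 p)" by (simp only: p)
      qed
    qed
    have i\<Phi>: "(\<integral>x. W (b, x) \<partial>lborel) = indicator B b * (\<Phi> b)\<^sup>2" for b
    proof -
      have "(\<integral>x. W (b, x) \<partial>lborel) = (\<integral>x. (indicator B b * \<Phi> b) * (E b x * d x) \<partial>lborel)"
        by (simp add: W_def mult.assoc)
      also have "\<dots> = indicator B b * \<Phi> b * \<Phi> b" by (simp add: \<Phi>_def)
      finally show ?thesis by (simp add: power2_eq_square mult.assoc)
    qed
    have "(\<integral>b. indicator B b * (\<Phi> b)\<^sup>2 \<partial>lborel) = (\<integral>b. (\<integral>x. W (b, x) \<partial>lborel) \<partial>lborel)" by (simp only: i\<Phi>)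
    also have "\<dots> = (\<integral>x. (\<integral>b. W (b, x) \<partial>lborel) \<partial>lborel)"
      using lborel_pair.Fubini_integral[of "\<lambda>b x. W (b, x)"] Wint by simp
    also have "\<dots> = (\<integral>x. K x * d x \<partial>lborel)" by (simp add: W_def K_def)
    finally have "(\<integral>b. indicator B b * (\<Phi> b)\<^sup>2 \<partial>lborel) = 0" using Kd by simp
    moreover have "integrable lborel (\<lambda>b. indicator B b * (\<Phi> b)\<^sup>2)"
      using lborel_pair.integrable_fst'[OF Wint] by (simp only: i\<Phi>)
    ultimately have "AE b in lborel. indicator B b * (\<Phi> b)\<^sup>2 = 0"
      using integral_nonneg_eq_0_iff_AE[of lborel "\<lambda>b. indicator B b * (\<Phi> b)\<^sup>2"] by simp
    then have "AE b in lborel. b \<in> B \<longrightarrow> \<Phi> b = 0"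
      by (rule eventually_mono) (auto simp: indicator_def)
    then show "\<Phi> a = 0"
      by (rule continuous_AE_zero_imp_zero[OF \<Phi>_cont]) (auto simp: B_def R_def)
  qed
  have "AE x in lborel. d x = 0"
  proof (rule AE_zero_if_exponential_moments_zero[OF dint compact_cball[of c r]])
    show "d x = 0" if "x \<notin> cball c r" for x using that by (auto simp: d_def \<Omega>_def indicator_def)
    fix a
    have "(\<integral>x. exp (a \<bullet> x) * d x \<partial>lborel) = (\<integral>x. exp (a \<bullet> c) * (E a x * d x) \<partial>lborel)"
      by (intro Bochner_Integration.integral_cong) (auto simp: E_def inner_diff_right mult.assoc[symmetric] simp flip: exp_add)
    also have "\<dots> = exp (a \<bullet> c) * \<Phi> a" by (simp add: \<Phi>_def)
    finally show "(\<integral>x. exp (a \<bullet> x) * d x \<partial>lborel) = 0" by (simp add: \<Phi>_zero)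
  qed
  with f0ae have "AE x in lborel. x \<in> \<Omega> \<longrightarrow> f x = g x"
    by eventually_elim (auto simp: d_def indicator_def split: if_splits)
  then have "AE x in lebesgue. x \<in> \<Omega> \<longrightarrow> f x = g x" by (rule AE_completion)
  then show ?thesis unfolding ae_radial_on_def \<Omega>_def[symmetric] using g_radial by blast
qed

section \<open>The domain is a ball\<close>

lemma section_profile_odd_moment: "(\<integral>\<tau>. \<tau> * section_profile G r \<tau> \<partial>lebesgue) = 0"
proof -
  have "(\<integral>\<tau>. \<tau> * section_profile G r \<tau> \<partial>lebesgue) = (\<integral>\<tau>. - (\<tau> * section_profile G r \<tau>) \<partial>lebesgue)"
    by (subst lebesgue_integral_real_affine[of "-1" _ 0]) (auto simp: section_profile_def indicator_def intro!: Bochner_Integration.integral_cong)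
  then show ?thesis by simp
qed

lemma set_integrable_bounded_vector:
  fixes f :: "'a::euclidean_space \<Rightarrow> real"
  assumes f: "set_integrable lebesgue \<Omega> f" and \<Omega>: "bounded \<Omega>"
  shows "set_integrable lebesgue \<Omega> (\<lambda>x. f x *\<^sub>R x)"
proof -
  obtain B where B: "\<And>x. x \<in> \<Omega> \<Longrightarrow> norm x \<le> B" using \<Omega> by (auto simp: bounded_iff)
  have F: "integrable lebesgue (\<lambda>x. indicator \<Omega> x * f x)" using f by (simp add: set_integrable_def)
  have "integrable lebesgue (\<lambda>x. (indicator \<Omega> x * f x) *\<^sub>R x)"
  proof (rule Bochner_Integration.integrable_bound)
    show "integrable lebesgue (\<lambda>x. B * (indicator \<Omega> x * f x))" using F by simp
    have "(\<lambda>x::'a. x) \<in> borel_measurable lebesgue" by (rule measurable_completion) simp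
    then show "(\<lambda>x. (indicator \<Omega> x * f x) *\<^sub>R x) \<in> borel_measurable lebesgue"
      using borel_measurable_integrable[OF F] by (intro borel_measurable_scaleR)
    show "AE x in lebesgue. norm ((indicator \<Omega> x * f x) *\<^sub>R x) \<le> norm (B * (indicator \<Omega> x * f x))"
    proof (rule AE_I2)
      fix x :: 'a
      show "norm ((indicator \<Omega> x * f x) *\<^sub>R x) \<le> norm (B * (indicator \<Omega> x * f x))"
      proof (cases "x \<in> \<Omega>")
        case True
        then have "norm x \<le> \<bar>B\<bar>" using B[of x] by linarith
        then show ?thesis using True by (simp add: abs_mult mult.commute mult_right_mono)
      qed simp
    qed
  qed
  then show ?thesis by (simp add: set_integrable_def)
qed

lemma exists_unit_vector: "\<exists>e :: real ^ 'n. norm e = 1"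
proof -
  obtain i :: 'n where True by blast
  show ?thesis by (rule exI[of _ "axis i 1"]) simp
qed

text \<open>
  The plane wave \<open>\<phi> = 1\<close> gives constant width and \<open>\<phi> \<tau> = \<tau>\<close> gives midpoints \<open>e \<bullet> c\<close> of all shadows.
\<close>

proposition domain_is_ball:
  fixes \<Omega> :: "(real ^ 'n) set"
  assumes n: "CARD('n) \<ge> 2"
    and \<Omega>: "\<Omega> \<noteq> {}" "open \<Omega>" "connected \<Omega>" "bounded \<Omega>" "convex \<Omega>"
    and G: "\<And>t. t \<ge> 0 \<Longrightarrow> G t > 0"
    and f: "set_integrable lebesgue \<Omega> f" and hyp: "hyperplane_integrals \<Omega> G f"
  obtains c r where "r > 0" "\<Omega> = ball c r"
    "\<And>e. norm e = 1 \<Longrightarrow> shadow_radius \<Omega> e = r" "\<And>e. norm e = 1 \<Longrightarrow> shadow_mid \<Omega> e = e \<bullet> c"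
proof -
  obtain \<kappa> :: real where \<kappa>: "\<kappa> > 0"
    and slice: "\<And>e :: real ^ 'n. norm e = 1 \<Longrightarrow> slice_measure e = density lborel (\<lambda>_. ennreal \<kappa>)"
    using slice_measure_eq_lborel[OF n] by blast
  note pw = plane_wave_integral[OF n \<Omega>(1-4) hyp f _ \<kappa> slice]
  let ?P = "section_profile G"
  define m where "m = (LINT x:\<Omega>|lebesgue. f x)"
  have rpos: "shadow_radius \<Omega> e > 0" if "norm e = 1" for e by (rule shadow_radius_pos[OF \<Omega>(1,2,4) that])
  have Pint: "integrable lebesgue (?P (shadow_radius \<Omega> e))" if e: "norm e = 1" for e
    using pw(1)[OF e e, of "\<lambda>_. 1"] by simp
  have mass: "integral\<^sup>L lebesgue (?P (shadow_radius \<Omega> e)) = \<kappa> * m" if e: "norm e = 1" for e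
    using pw(2)[OF e e, of "\<lambda>_. 1"] by (simp add: m_def)
  obtain e0 :: "real ^ 'n" where e0: "norm e0 = 1" using exists_unit_vector by blast
  define r where "r = shadow_radius \<Omega> e0"
  have r: "r > 0" unfolding r_def by (rule rpos[OF e0])
  have radius: "shadow_radius \<Omega> e = r" if e: "norm e = 1" for e
    using section_profile_integral_strict_mono[where G=G, OF rpos[OF e] _ G Pint[OF e] Pint[OF e0]]
      section_profile_integral_strict_mono[where G=G, OF rpos[OF e0] _ G Pint[OF e0] Pint[OF e]] mass[OF e] mass[OF e0]
    unfolding r_def by (metis less_irrefl linorder_neqE_linordered_idom)
  have "integral\<^sup>L lebesgue (?P r) \<noteq> 0"
  proof
    assume 0: "integral\<^sup>L lebesgue (?P r) = 0"
    have nn: "?P r x \<ge> 0" for x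
    proof (cases "\<bar>x\<bar> < r")
      case True
      then show ?thesis using G[of "r - \<bar>x\<bar>"] by (simp add: section_profile_def)
    qed (auto simp: section_profile_def indicator_def)
    have "AE x in lebesgue. ?P r x = 0"
      using integral_nonneg_eq_0_iff_AE[OF Pint[OF e0, folded r_def]] nn 0 by simp
    then have "AE x in lebesgue. x \<notin> {-r<..<r}"
    proof (rule eventually_mono)
      fix x assume P0: "?P r x = 0"
      show "x \<notin> {-r<..<r}"
      proof
        assume x: "x \<in> {-r<..<r}"
        then have "r - \<bar>x\<bar> \<ge> 0" by auto
        then show False using G[of "r - \<bar>x\<bar>"] P0 x by (simp add: section_profile_def)
      qed
    qed
    moreover have "{-r<..<r} \<in> sets lebesgue" by simp
    ultimately have "{-r<..<r} \<in> null_sets lebesgue" by (subst AE_iff_null_sets)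
    then have "emeasure lebesgue {-r<..<r} = 0" by auto
    then show False using r by simp
  qed
  then have m0: "m \<noteq> 0" using mass[OF e0] by (auto simp: r_def)
  define c where "c = (LINT x:\<Omega>|lebesgue. f x *\<^sub>R x) /\<^sub>R m"
  have mid: "shadow_mid \<Omega> e = e \<bullet> c" if e: "norm e = 1" for e
  proof -
    have fx: "integrable lebesgue (\<lambda>x. indicator \<Omega> x *\<^sub>R f x *\<^sub>R x)"
      using set_integrable_bounded_vector[OF f \<Omega>(4)] by (simp add: set_integrable_def)
    have fi: "integrable lebesgue (\<lambda>x. indicator \<Omega> x * f x)" using f by (simp add: set_integrable_def)
    have "0 = \<kappa> * (LINT x:\<Omega>|lebesgue. (e \<bullet> x - shadow_mid \<Omega> e) * f x)"
      using pw(2)[OF e e, of "\<lambda>\<tau>. \<tau>"] section_profile_odd_moment by (simp add: continuous_on_id)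
    then have "0 = (LINT x:\<Omega>|lebesgue. (e \<bullet> x - shadow_mid \<Omega> e) * f x)" using \<kappa> by simp
    also have "\<dots> = (\<integral>x. e \<bullet> (indicator \<Omega> x *\<^sub>R f x *\<^sub>R x) - shadow_mid \<Omega> e * (indicator \<Omega> x * f x) \<partial>lebesgue)"
      unfolding set_lebesgue_integral_def by (intro Bochner_Integration.integral_cong) (auto simp: algebra_simps)
    also have "\<dots> = e \<bullet> (LINT x:\<Omega>|lebesgue. f x *\<^sub>R x) - shadow_mid \<Omega> e * m"
      unfolding set_lebesgue_integral_def m_def real_scaleR_def
      by (subst Bochner_Integration.integral_diff)
        (use fx fi in \<open>simp_all only: integrable_inner_right integral_inner_right integral_mult_right_zero integrable_mult_right\<close>)
    finally show ?thesis using m0 by (simp add: c_def field_simps)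
  qed
  have "shadow_sup \<Omega> e = e \<bullet> c + r" if e: "norm e = 1" for e
    using mid[OF e] radius[OF e] by (simp add: shadow_mid_def shadow_radius_def field_simps)
  then have "\<Omega> = ball c r" by (rule ball_if_shadow_of_ball[OF \<Omega>(1,2,5,4)])
  with r radius mid show ?thesis by (intro that[of r c])
qed

text \<open>
  The right-hand side mentions neither \<open>f\<close> nor the direction of \<open>a\<close>: the first yields uniqueness, the
  second radial symmetry.
\<close>

lemma exponential_moment_eq_profile_moment:
  fixes f :: "real ^ 'n \<Rightarrow> real" and a :: "real ^ 'n"
  assumes n: "CARD('n) \<ge> 2"
    and \<Omega>: "\<Omega> \<noteq> {}" "open \<Omega>" "connected \<Omega>" "bounded \<Omega>"
    and radius: "\<And>e. norm e = 1 \<Longrightarrow> shadow_radius \<Omega> e = r"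
    and mid: "\<And>e. norm e = 1 \<Longrightarrow> shadow_mid \<Omega> e = e \<bullet> c"
    and \<kappa>: "\<kappa> > 0"
    and slice: "\<And>e :: real ^ 'n. norm e = 1 \<Longrightarrow> slice_measure e = density lborel (\<lambda>_. ennreal \<kappa>)"
    and f: "set_integrable lebesgue \<Omega> f" and hyp: "hyperplane_integrals \<Omega> G f"
  shows "(LINT x:\<Omega>|lebesgue. exp (a \<bullet> (x - c)) * f x)
    = (\<integral>\<tau>. exp (norm a * \<tau>) * section_profile G r \<tau> \<partial>lebesgue) / \<kappa>"
proof -
  obtain e where e: "norm e = 1" "a = norm a *\<^sub>R e"
  proof (cases "a = 0")
    case True
    then show ?thesis using that exists_unit_vector by auto
  next
    case False
    then show ?thesis using that[of "a /\<^sub>R norm a"] by simp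
  qed
  have "(\<integral>\<tau>. exp (norm a * \<tau>) * section_profile G r \<tau> \<partial>lebesgue)
      = \<kappa> * (LINT x:\<Omega>|lebesgue. exp (norm a * (e \<bullet> x - e \<bullet> c)) * f x)"
    using plane_wave_integral(2)[OF n \<Omega> hyp f e(1) \<kappa> slice[OF e(1)], of "\<lambda>\<tau>. exp (norm a * \<tau>)"]
    unfolding radius[OF e(1)] mid[OF e(1)] by (simp add: continuous_intros)
  moreover have "norm a * (e \<bullet> x - e \<bullet> c) = a \<bullet> (x - c)" for x
    using arg_cong[OF e(2), of "\<lambda>v. v \<bullet> (x - c)"] by (simp add: inner_diff_right right_diff_distrib)
  ultimately show ?thesis using \<kappa> by simp
qed

theorem theorem2p1:
  fixes \<Omega> :: "(real ^ 'n) set" and G :: "real \<Rightarrow> real" and f :: "real ^ 'n \<Rightarrow> real"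
  assumes "CARD('n) \<ge> 2"
    and "\<Omega> \<noteq> {}" and "open \<Omega>" and "connected \<Omega>" and "bounded \<Omega>" and "convex \<Omega>"
    and "\<And>t. t \<ge> 0 \<Longrightarrow> G t > 0"
    and "\<And>K. compact K \<Longrightarrow> K \<subseteq> {0..} \<Longrightarrow> set_integrable lebesgue K G"
    and "set_integrable lebesgue \<Omega> f"
    and "hyperplane_integrals \<Omega> G f"
  shows "\<exists>c r. r > 0 \<and> \<Omega> = ball c r \<and> ae_radial_on \<Omega> c f \<and>
    (\<forall>g. set_integrable lebesgue \<Omega> g \<and> hyperplane_integrals \<Omega> G g \<longrightarrow>
      (AE x in lebesgue. x \<in> \<Omega> \<longrightarrow> g x = f x))"
proof -
  obtain c r where r: "r > 0" and ball: "\<Omega> = ball c r"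
    and radius: "\<And>e. norm e = 1 \<Longrightarrow> shadow_radius \<Omega> e = r"
    and mid: "\<And>e. norm e = 1 \<Longrightarrow> shadow_mid \<Omega> e = e \<bullet> c"
    by (rule domain_is_ball[OF assms(1-7,9,10)], assumption, rule that) blast+
  obtain \<kappa> :: real where \<kappa>: "\<kappa> > 0"
    and slice: "\<And>e :: real ^ 'n. norm e = 1 \<Longrightarrow> slice_measure e = density lborel (\<lambda>_. ennreal \<kappa>)"
    using slice_measure_eq_lborel[OF assms(1)] by blast
  note moment = exponential_moment_eq_profile_moment[OF assms(1-5) radius mid \<kappa> slice]
  have "ae_radial_on (ball c r) c f"
  proof (rule ae_radial_if_exponential_moments_radial)
    show "set_integrable lebesgue (ball c r) f" using assms(9) ball by simp
    show "(LINT x:ball c r|lebesgue. exp (a \<bullet> (x - c)) * f x) = (LINT x:ball c r|lebesgue. exp (b \<bullet> (x - c)) * f x)"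
      if "norm a = norm b" for a b
      using moment[OF _ _ _ assms(9,10), of a] moment[OF _ _ _ assms(9,10), of b] that ball by simp
  qed
  moreover have "AE x in lebesgue. x \<in> \<Omega> \<longrightarrow> g x = f x"
    if g: "set_integrable lebesgue \<Omega> g" "hyperplane_integrals \<Omega> G g" for g
  proof (rule set_AE_eq_if_exponential_moments_eq[OF g(1) assms(9)])
    show "\<Omega> \<in> sets borel" using assms(3) by simp
    show "bounded \<Omega>" by (rule assms(5))
    show "(LINT x:\<Omega>|lebesgue. exp (a \<bullet> (x - c)) * g x) = (LINT x:\<Omega>|lebesgue. exp (a \<bullet> (x - c)) * f x)" for a
      using moment[OF _ _ _ g, of a] moment[OF _ _ _ assms(9,10), of a] by simp
  qed
  ultimately show ?thesis using r ball by blast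
qed

end
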